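(* Let $(Q,I)$ be a gentle bound quiver and let $x\in Q_0$ be a vertex such that (c1) there is no arrow $\alpha$ with $s(\alpha)=t(\alpha)=x$; (c2) $x$ has in-degree $2$ and out-degree $2$ in $Q$; (c3) for any $\beta\in Q_1$ with $t(\beta)=x$ there exists $\gamma\in Q_1$ with $t(\gamma)=s(\beta)$ and $\gamma\beta\in I$. Let $(Q',I')$ be the gentle bound quiver obtained from $(Q,I)$ by the generalized APR-reflection at $x$, and let $k$ be any positive integer. Then $(Q'^{(k)},I'^{(k)})$ is obtained from $(Q^{(k)},I^{(k)})$ by a $k$-times iteration of generalized APR-reflections.
   Context: $K$ is an algebraically closed field. A quiver $Q=(Q_0,Q_1,s,t)$ is finite. Paths are composed from left to right: $\alpha_1\cdots\alpha_l$ (arrows $\alpha_i$, $l\ge1$) is a path of length $l$ if $t(\alpha_i)=s(\alpha_{i+1})$. A bound quiver $(Q,I)$ is locally gentle if $I$ is an ideal of $KQ$ generated by a set of paths of length $2$, every vertex $a$ has in-degree $d_{\rm in}(a)\le 2$ and out-degree $d_{\rm out}(a)\le 2$, and for every arrow $\alpha$ there is at most one arrow $\beta$ with $t(\beta)=s(\alpha)$, $\beta\alpha\in I$; at most one with $t(\beta)=s(\alpha)$, $\beta\alpha\notin I$; at most one with $s(\beta)=t(\alpha)$, $\alpha\beta\in I$; at most one with $s(\beta)=t(\alpha)$, $\alpha\beta\notin I$. It is gentle if moreover $\dim_K KQ/I<\infty$. Standing assumptions: $Q$ is connected and $Q_1\neq\emptyset$. Bound quivers are considered up to isomorphism. Generalized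 APR-reflection: let $(Q,I)$ be a gentle bound quiver and $x\in Q_0$ a vertex such that (r1) there is no arrow with source and target both $x$; (r2) for any $\alpha\in Q_1$ with $s(\alpha)=x$ there is $\beta_\alpha\in Q_1$ (necessarily unique) with $t(\beta_\alpha)=x$ and $\beta_\alpha\alpha\notin I$. (Conditions (c1)–(c3) imply (r1),(r2).) The bound quiver $(Q',I')$ obtained by the generalized APR-reflection at $x$ is: $Q'_0=Q_0$; $Q'_1=\{\lambda'\mid\lambda\in Q_1\}$ with $s(\lambda')=x$ if $t(\lambda)=x$; $s(\lambda')=s(\beta_\lambda)$ if $s(\lambda)=x$; $s(\lambda')=s(\lambda)$ otherwise; and $t(\lambda')=s(\lambda)$ if $t(\lambda)=x$; $t(\lambda')=x$ if $\lambda$ satisfies $( * )$ for some $\beta\in Q_1$; $t(\lambda')=t(\lambda)$ otherwise, where $( * )$ is: $t(\beta)=x$, $s(\beta)=t(\lambda)$ and $\lambda\beta\in I$. $I'$ is generated by the paths: $\lambda'\kappa'$ with $\lambda,\kappa\in Q_1$, $t(\kappa)\neq x$, $t(\lambda)=s(\kappa)\ne x$, $\lambda\kappa\in I$; $(\beta_\alpha)'\alpha'$ with $\alpha\in Q_1$, $s(\alpha)=x$; and $\lambda'\kappa'$ with $\lambda,\kappa\in Q_1$, $t(\kappa)=x$ and $\lambda$ satisfying $( * )$ for some $\beta\neq\kappa$. Blossoming: $(Q^{\rm bl},I^{\rm bl})$ is obtained by adding, for each $v\in Q_0$, $2-d_{\rm in}(v)$ incoming arrows from new pairwise distinct vertices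 and $2-d_{\rm out}(v)$ outgoing arrows to new pairwise distinct vertices, and adding length-two relations so that the result is locally gentle and $\alpha\beta\in I\Leftrightarrow\alpha\beta\in I^{\rm bl}$ for $\alpha,\beta\in Q_1$ (unique up to isomorphism). Put $d=2|Q_0|-|Q_1|$. The new vertices are $d$ sources $s_1,\dots,s_d$ and $d$ sinks $t_1,\dots,t_d$; $\sigma_p$ is the unique arrow starting at $s_p$ and $\tau_p$ the unique arrow ending at $t_p$. A path not in $I^{\rm bl}$ is maximal if it cannot be extended by an arrow on either side to a longer path not in $I^{\rm bl}$. The labeling is chosen so that for each $p$ there is a maximal path in $KQ^{\rm bl}/I^{\rm bl}$ from $s_p$ to $t_p$. Finite gentle repetition: for $k\ge1$, $Q^{(k)}$ has vertices $a^{[i]}$ ($a\in Q_0$, $1\le i\le k$), arrows $\alpha^{[i]}:s(\alpha)^{[i]}\to t(\alpha)^{[i]}$ ($\alpha\in Q_1$, $1\le i\le k$), and connecting arrows $\varpi_p^{[i]}: s(\tau_p)^{[i]}\to t(\sigma_p)^{[i+1]}$ ($1\le p\le d$, $1\le i<k$); $I^{(k)}$ is generated by the $\alpha^{[i]}\beta^{[i]}$ with $\alpha\beta\in I$, the $\alpha^{[i]}\varpi_p^{[i]}$ with $\alpha\tau_p\in I^{\rm bl}$, the $\varpi_p^{[i]}\beta^{[i+1]}$ with $\sigma_p\beta\in I^{\rm bl}$, and the $\varpi_p^{[i]}\varpi_{p'}^{[i+1]}$ with $\sigma_p\tau_{p'}\in I^{\rm bl}$ (composable arrows, $\alpha,\beta\in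 Q_1$). $(Q'^{(k)},I'^{(k)})$ is defined likewise from $(Q',I')$. *)

theory Defs
  imports
    "Graph_Theory.Graph_Theory"
    "HOL-Algebra.Ideal"
    "HOL-Library.Poly_Mapping"
    "HOL-Computational_Algebra.Polynomial"
begin

section \<open>Path algebras\<close>

text \<open>
  A path is given by its starting vertex and its list of arrows, so that the trivial path at \<open>v\<close>
  is \<open>(v, [])\<close>. Paths compose from left to right. Elements of the path algebra are finitely
  supported functions from paths to the field.
\<close>

type_synonym ('v, 'a, 'k) path_comb = "('v \<times> 'a list) \<Rightarrow>\<^sub>0 'k"

definition paths :: "('v, 'a) pre_digraph \<Rightarrow> ('v \<times> 'a list) set" where
  "paths Q = {(u, p). \<exists>v. pre_digraph.awalk Q u p v}"

definition path_mult ::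
    "('v, 'a) pre_digraph \<Rightarrow> ('v, 'a, 'k::field) path_comb \<Rightarrow> ('v, 'a, 'k) path_comb
      \<Rightarrow> ('v, 'a, 'k) path_comb" where
  "path_mult Q f g =
    (\<Sum>p\<in>Poly_Mapping.keys f. \<Sum>q\<in>Poly_Mapping.keys g.
      if pre_digraph.awalk Q (fst p) (snd p) (fst q)
      then Poly_Mapping.single (fst p, snd p @ snd q)
        (Poly_Mapping.lookup f p * Poly_Mapping.lookup g q)
      else 0)"

definition path_algebra :: "('v, 'a) pre_digraph \<Rightarrow> ('v, 'a, 'k::field) path_comb ring" where
  "path_algebra Q =
    \<lparr>carrier = {f. Poly_Mapping.keys f \<subseteq> paths Q},
     mult = path_mult Q,
     one = (\<Sum>v\<in>verts Q. Poly_Mapping.single (v, []) 1),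
     zero = 0,
     add = (+)\<rparr>"

text \<open>The library's generated ideals are only meaningful over rings, so the ring axioms are checked
  first.\<close>

lemma path_mult_superset:
  assumes "finite S" "finite T" "Poly_Mapping.keys f \<subseteq> S" "Poly_Mapping.keys g \<subseteq> T"
  shows "path_mult Q f g = (\<Sum>p\<in>S. \<Sum>q\<in>T.
      if pre_digraph.awalk Q (fst p) (snd p) (fst q)
      then Poly_Mapping.single (fst p, snd p @ snd q)
        (Poly_Mapping.lookup f p * Poly_Mapping.lookup g q)
      else 0)"
proof -
  have inner: "(\<Sum>q\<in>Poly_Mapping.keys g.
      if pre_digraph.awalk Q (fst p) (snd p) (fst q)
      then Poly_Mapping.single (fst p, snd p @ snd q)
        (Poly_Mapping.lookup f p * Poly_Mapping.lookup g q) else 0) = (\<Sum>q\<in>T.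
      if pre_digraph.awalk Q (fst p) (snd p) (fst q)
      then Poly_Mapping.single (fst p, snd p @ snd q)
        (Poly_Mapping.lookup f p * Poly_Mapping.lookup g q) else 0)" for p
    by (rule sum.mono_neutral_left) (use assms in \<open>auto simp: in_keys_iff\<close>)
  show ?thesis
    unfolding path_mult_def inner
    by (rule sum.mono_neutral_left) (use assms in \<open>auto simp: in_keys_iff intro!: sum.neutral\<close>)
qed

lemma path_mult_add_left: "path_mult Q (f + f') g = path_mult Q f g + path_mult Q f' g"
proof -
  let ?S = "Poly_Mapping.keys f \<union> Poly_Mapping.keys f'"
  have k: "Poly_Mapping.keys (f + f') \<subseteq> ?S" by (rule keys_add)
  show ?thesis
    by (simp add: path_mult_superset[of ?S "Poly_Mapping.keys g"] k lookup_add sum.distrib[symmetric])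
      (intro sum.cong refl, simp add: lookup_add algebra_simps single_add)
qed

lemma path_mult_add_right: "path_mult Q f (g + g') = path_mult Q f g + path_mult Q f g'"
proof -
  let ?S = "Poly_Mapping.keys g \<union> Poly_Mapping.keys g'"
  have k: "Poly_Mapping.keys (g + g') \<subseteq> ?S" by (rule keys_add)
  show ?thesis
    by (simp add: path_mult_superset[of "Poly_Mapping.keys f" ?S] k lookup_add sum.distrib[symmetric])
      (intro sum.cong refl, simp add: lookup_add algebra_simps single_add)
qed

lemma path_mult_zero [simp]: "path_mult Q 0 g = 0" "path_mult Q f 0 = 0"
  by (simp_all add: path_mult_def)

lemma path_mult_sum_left: "path_mult Q (sum F A) g = (\<Sum>i\<in>A. path_mult Q (F i) g)"
  by (induction A rule: infinite_finite_induct) (auto simp: path_mult_add_left)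

lemma path_mult_sum_right: "path_mult Q f (sum F A) = (\<Sum>i\<in>A. path_mult Q f (F i))"
  by (induction A rule: infinite_finite_induct) (auto simp: path_mult_add_right)

lemma path_mult_single:
  "path_mult Q (Poly_Mapping.single p a) (Poly_Mapping.single q b) =
    (if pre_digraph.awalk Q (fst p) (snd p) (fst q)
     then Poly_Mapping.single (fst p, snd p @ snd q) (a * b) else 0)"
  by (subst path_mult_superset[of "{p}" "{q}"]) auto

lemma path_comb_expand:
  "f = (\<Sum>p\<in>Poly_Mapping.keys f. Poly_Mapping.single p (Poly_Mapping.lookup f p))"
proof (rule poly_mapping_eqI)
  fix q
  show "Poly_Mapping.lookup f q = Poly_Mapping.lookup
      (\<Sum>p\<in>Poly_Mapping.keys f. Poly_Mapping.single p (Poly_Mapping.lookup f p)) q"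
    by (cases "q \<in> Poly_Mapping.keys f")
      (simp_all add: lookup_sum lookup_single when_def not_in_keys_iff_lookup_eq_zero)
qed

lemma path_mult_assoc:
  assumes "wf_digraph Q"
  shows "path_mult Q (path_mult Q f g) h = path_mult Q f (path_mult Q g h)"
proof -
  interpret wf_digraph Q by fact
  have s: "path_mult Q (path_mult Q (Poly_Mapping.single p a) (Poly_Mapping.single q b)) (Poly_Mapping.single r c)
     = path_mult Q (Poly_Mapping.single p a) (path_mult Q (Poly_Mapping.single q b) (Poly_Mapping.single r c))"
    for p q r a b c
  proof -
    have "awalk (fst p) (snd p @ snd q) (fst r) \<longleftrightarrow> awalk (fst q) (snd q) (fst r)"
      if "awalk (fst p) (snd p) (fst q)"
      using that by (auto simp: awalk_append_iff awlast_if_cas dest: awalk_ends)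
    then show ?thesis
      by (auto simp: path_mult_single mult.assoc)
  qed
  let ?e = "\<lambda>f p. Poly_Mapping.single p (Poly_Mapping.lookup f p)"
  have 1: "path_mult Q (path_mult Q (?e f p) (?e g q)) h = path_mult Q (?e f p) (path_mult Q (?e g q) h)"
    for p q
    using arg_cong[OF path_comb_expand[of h],
        of "path_mult Q (path_mult Q (?e f p) (?e g q))"]
      arg_cong[OF path_comb_expand[of h],
        of "\<lambda>h. path_mult Q (?e f p) (path_mult Q (?e g q) h)"]
    by (simp only: path_mult_sum_right s)
  have 2: "path_mult Q (path_mult Q (?e f p) g) h = path_mult Q (?e f p) (path_mult Q g h)" for p
    using arg_cong[OF path_comb_expand[of g],
        of "\<lambda>g. path_mult Q (path_mult Q (?e f p) g) h"]
      arg_cong[OF path_comb_expand[of g],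
        of "\<lambda>g. path_mult Q (?e f p) (path_mult Q g h)"]
    by (simp only: path_mult_sum_right path_mult_sum_left 1)
  show ?thesis
    using arg_cong[OF path_comb_expand[of f],
        of "\<lambda>f. path_mult Q (path_mult Q f g) h"]
      arg_cong[OF path_comb_expand[of f],
        of "\<lambda>f. path_mult Q f (path_mult Q g h)"]
    by (simp only: path_mult_sum_left 2)
qed

lemma path_mult_closed:
  assumes "wf_digraph Q" "Poly_Mapping.keys f \<subseteq> paths Q" "Poly_Mapping.keys g \<subseteq> paths Q"
  shows "Poly_Mapping.keys (path_mult Q f g) \<subseteq> paths Q"
proof -
  interpret wf_digraph Q by fact
  let ?t = "\<lambda>p q. if awalk (fst p) (snd p) (fst q)
      then Poly_Mapping.single (fst p, snd p @ snd q)
        (Poly_Mapping.lookup f p * Poly_Mapping.lookup g q)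
      else 0"
  have t: "Poly_Mapping.keys (?t p q) \<subseteq> paths Q" if "q \<in> Poly_Mapping.keys g" for p q
  proof (cases "awalk (fst p) (snd p) (fst q)")
    case True
    have "q \<in> paths Q"
      using that assms by blast
    then obtain v where "awalk (fst q) (snd q) v"
      by (auto simp: paths_def)
    with True have "awalk (fst p) (snd p @ snd q) v"
      by (rule awalk_appendI)
    then have "(fst p, snd p @ snd q) \<in> paths Q"
      unfolding paths_def by blast
    with True show ?thesis
      by (simp only: if_True keys_single) simp
  qed simp
  show ?thesis
    unfolding path_mult_def
    by (intro order.trans[OF keys_sum] UN_least t)
qed

lemma ring_path_algebra:
  assumes "fin_digraph Q"
  shows "ring (path_algebra Q :: ('v, 'a, 'k::field) path_comb ring)"
proof -
  interpret fin_digraph Q by fact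
  let ?A = "path_algebra Q :: ('v, 'a, 'k) path_comb ring"
  let ?one = "\<Sum>v\<in>verts Q. Poly_Mapping.single (v, []) 1 :: ('v, 'a, 'k) path_comb"
  have keys_add': "Poly_Mapping.keys (f + g) \<subseteq> paths Q"
    if "Poly_Mapping.keys f \<subseteq> paths Q" "Poly_Mapping.keys g \<subseteq> paths Q"
    for f g :: "('v, 'a, 'k) path_comb"
    using that keys_add[of f g] by blast
  have one_keys: "Poly_Mapping.keys ?one \<subseteq> paths Q"
    by (rule order.trans[OF keys_sum]) (auto simp: paths_def awalk_def)
  have l1: "path_mult Q ?one (Poly_Mapping.single p a) = Poly_Mapping.single p a"
    and r1: "path_mult Q (Poly_Mapping.single p a) ?one = Poly_Mapping.single p a"
    if p: "p \<in> paths Q" for p and a :: 'k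
  proof -
    obtain u w v where [simp]: "p = (u, w)" and w: "awalk u w v"
      using p by (auto simp: paths_def)
    have u: "u \<in> verts Q" "v \<in> verts Q" using w by auto
    have "awalk t [] u \<longleftrightarrow> t = u" if "t \<in> verts Q" for t
      using that by (auto simp: awalk_def)
    then have "path_mult Q ?one (Poly_Mapping.single p a) =
        (\<Sum>t\<in>verts Q. if t = u then Poly_Mapping.single p a else 0)"
      unfolding path_mult_sum_left by (intro sum.cong) (auto simp: path_mult_single)
    then show "path_mult Q ?one (Poly_Mapping.single p a) = Poly_Mapping.single p a"
      using u by simp
    have "awalk u w t \<longleftrightarrow> t = v" for t
      using w by (auto dest: awalk_ends)
    then have "path_mult Q (Poly_Mapping.single p a) ?one =
        (\<Sum>t\<in>verts Q. if t = v then Poly_Mapping.single p a else 0)"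
      unfolding path_mult_sum_right by (intro sum.cong) (auto simp: path_mult_single)
    then show "path_mult Q (Poly_Mapping.single p a) ?one = Poly_Mapping.single p a"
      using u by simp
  qed
  have L: "path_mult Q ?one f = f" and R: "path_mult Q f ?one = f"
    if "Poly_Mapping.keys f \<subseteq> paths Q" for f
  proof -
    have "path_mult Q ?one (\<Sum>p\<in>Poly_Mapping.keys f. Poly_Mapping.single p (Poly_Mapping.lookup f p))
        = (\<Sum>p\<in>Poly_Mapping.keys f. Poly_Mapping.single p (Poly_Mapping.lookup f p))"
      unfolding path_mult_sum_right using that l1 by (intro sum.cong) auto
    then show "path_mult Q ?one f = f" by (simp only: path_comb_expand[symmetric])
    have "path_mult Q (\<Sum>p\<in>Poly_Mapping.keys f. Poly_Mapping.single p (Poly_Mapping.lookup f p)) ?one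
        = (\<Sum>p\<in>Poly_Mapping.keys f. Poly_Mapping.single p (Poly_Mapping.lookup f p))"
      unfolding path_mult_sum_left[where F = "\<lambda>p. Poly_Mapping.single p (Poly_Mapping.lookup f p)"]
      using that r1 by (intro sum.cong) auto
    then show "path_mult Q f ?one = f" by (simp only: path_comb_expand[symmetric])
  qed
  have neg: "\<exists>g. Poly_Mapping.keys g \<subseteq> paths Q \<and> f + g = 0"
    if "Poly_Mapping.keys f \<subseteq> paths Q" for f :: "('v, 'a, 'k) path_comb"
    using that by (intro exI[of _ "- f"]) simp
  show ?thesis
  proof (rule ringI)
    show "abelian_group ?A"
      by (rule abelian_groupI)
        (auto simp: path_algebra_def add.assoc add.commute keys_add' intro: neg)
    show "monoid ?A"
      by (rule monoidI)
        (use one_keys path_mult_closed[OF wf_digraph_axioms] in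
          \<open>simp_all add: path_algebra_def path_mult_assoc wf_digraph_axioms L R\<close>)
  qed (auto simp: path_algebra_def path_mult_add_left path_mult_add_right)
qed

definition path_elem :: "('v, 'a) pre_digraph \<Rightarrow> 'a list \<Rightarrow> ('v, 'a, 'k::field) path_comb" where
  "path_elem Q p = Poly_Mapping.single (tail Q (hd p), p) 1"
  \<comment> \<open>used for nonempty lists \<open>p\<close> of consecutive arrows only\<close>

definition composable :: "('v, 'a) pre_digraph \<Rightarrow> 'a \<Rightarrow> 'a \<Rightarrow> bool" where
  "composable Q \<alpha> \<beta> \<longleftrightarrow> \<alpha> \<in> arcs Q \<and> \<beta> \<in> arcs Q \<and> head Q \<alpha> = tail Q \<beta>"

definition rel_ideal :: "('v, 'a) pre_digraph \<Rightarrow> ('a \<times> 'a) set \<Rightarrow> ('v, 'a, 'k::field) path_comb set"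
  where "rel_ideal Q R = Idl\<^bsub>path_algebra Q\<^esub> ((\<lambda>(\<alpha>, \<beta>). path_elem Q [\<alpha>, \<beta>]) ` R)"

definition finite_dim_quotient ::
    "('v, 'a) pre_digraph \<Rightarrow> ('v, 'a, 'k::field) path_comb set \<Rightarrow> bool" where
  "finite_dim_quotient Q I \<longleftrightarrow>
    (\<exists>B. finite B \<and> B \<subseteq> carrier (path_algebra Q) \<and>
      (\<forall>f\<in>carrier (path_algebra Q).
        \<exists>c. f - (\<Sum>b\<in>B. Poly_Mapping.map (\<lambda>y. c b * y) b) \<in> I))"


section \<open>Gentle bound quivers\<close>

text \<open>
  A bound quiver is a pair \<open>(Q, I)\<close> with \<open>I\<close> an ideal of the path algebra of \<open>Q\<close>. All quivers
  are finite, connected, and have at least one arrow.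
\<close>

definition quiver :: "('v, 'a) pre_digraph \<Rightarrow> bool" where
  "quiver Q \<longleftrightarrow> fin_digraph Q \<and> connected Q \<and> arcs Q \<noteq> {}"

definition locally_gentle ::
    "('v, 'a) pre_digraph \<Rightarrow> ('v, 'a, 'k::field) path_comb set \<Rightarrow> bool" where
  "locally_gentle Q I \<longleftrightarrow>
    quiver Q \<and>
    (\<exists>R \<subseteq> {(\<alpha>, \<beta>). composable Q \<alpha> \<beta>}. I = rel_ideal Q R) \<and>
    (\<forall>a\<in>verts Q. in_degree Q a \<le> 2 \<and> out_degree Q a \<le> 2) \<and>
    (\<forall>\<alpha>\<in>arcs Q.
      (\<exists>\<^sub>\<le>\<^sub>1\<beta>. composable Q \<beta> \<alpha> \<and> path_elem Q [\<beta>, \<alpha>] \<in> I) \<and>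
      (\<exists>\<^sub>\<le>\<^sub>1\<beta>. composable Q \<beta> \<alpha> \<and> path_elem Q [\<beta>, \<alpha>] \<notin> I) \<and>
      (\<exists>\<^sub>\<le>\<^sub>1\<beta>. composable Q \<alpha> \<beta> \<and> path_elem Q [\<alpha>, \<beta>] \<in> I) \<and>
      (\<exists>\<^sub>\<le>\<^sub>1\<beta>. composable Q \<alpha> \<beta> \<and> path_elem Q [\<alpha>, \<beta>] \<notin> I))"

definition gentle :: "('v, 'a) pre_digraph \<Rightarrow> ('v, 'a, 'k::field) path_comb set \<Rightarrow> bool" where
  "gentle Q I \<longleftrightarrow> locally_gentle Q I \<and> finite_dim_quotient Q I"

definition path_algebra_map ::
    "('v, 'a, 'w, 'b) digraph_isomorphism \<Rightarrow> ('v, 'a, 'k::field) path_comb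
      \<Rightarrow> ('w, 'b, 'k) path_comb" where
  "path_algebra_map h f =
    (\<Sum>p\<in>Poly_Mapping.keys f.
      Poly_Mapping.single (iso_verts h (fst p), map (iso_arcs h) (snd p)) (Poly_Mapping.lookup f p))"

text \<open>The fields \<open>iso_tail\<close> and \<open>iso_head\<close> of \<open>h\<close> are free outside the image of \<open>iso_arcs\<close>, so the
  equation \<open>Q' = app_iso h Q\<close> does not constrain \<open>tail Q'\<close> and \<open>head Q'\<close> outside \<open>arcs Q'\<close>.\<close>

definition bound_quiver_iso ::
    "('v, 'a) pre_digraph \<times> ('v, 'a, 'k::field) path_comb set
      \<Rightarrow> ('w, 'b) pre_digraph \<times> ('w, 'b, 'k) path_comb set \<Rightarrow> bool" where
  "bound_quiver_iso B B' \<longleftrightarrow>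
    (\<exists>h. pre_digraph.digraph_isomorphism (fst B) h \<and> fst B' = app_iso h (fst B) \<and>
      snd B' = path_algebra_map h ` snd B)"


section \<open>Generalized APR-reflection\<close>

text \<open>The arrow \<open>\<lambda>'\<close> of the reflected quiver is identified with \<open>\<lambda>\<close>.\<close>

definition apr_r1 :: "('v, 'a) pre_digraph \<Rightarrow> 'v \<Rightarrow> bool" where
  "apr_r1 Q x \<longleftrightarrow> \<not> (\<exists>\<alpha>\<in>arcs Q. tail Q \<alpha> = x \<and> head Q \<alpha> = x)"

definition apr_r2 ::
    "('v, 'a) pre_digraph \<Rightarrow> ('v, 'a, 'k::field) path_comb set \<Rightarrow> 'v \<Rightarrow> bool" where
  "apr_r2 Q I x \<longleftrightarrow>
    (\<forall>\<alpha>\<in>arcs Q. tail Q \<alpha> = x \<longrightarrow>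
      (\<exists>\<beta>\<in>arcs Q. head Q \<beta> = x \<and> path_elem Q [\<beta>, \<alpha>] \<notin> I))"

definition apr_beta ::
    "('v, 'a) pre_digraph \<Rightarrow> ('v, 'a, 'k::field) path_comb set \<Rightarrow> 'v \<Rightarrow> 'a \<Rightarrow> 'a" where
  "apr_beta Q I x \<alpha> = (THE \<beta>. \<beta> \<in> arcs Q \<and> head Q \<beta> = x \<and> path_elem Q [\<beta>, \<alpha>] \<notin> I)"

definition apr_star ::
    "('v, 'a) pre_digraph \<Rightarrow> ('v, 'a, 'k::field) path_comb set \<Rightarrow> 'v \<Rightarrow> 'a \<Rightarrow> 'a \<Rightarrow> bool" where
  "apr_star Q I x l \<beta> \<longleftrightarrow>
    \<beta> \<in> arcs Q \<and> head Q \<beta> = x \<and> tail Q \<beta> = head Q l \<and> path_elem Q [l, \<beta>] \<in> I"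

definition apr_quiver ::
    "('v, 'a) pre_digraph \<Rightarrow> ('v, 'a, 'k::field) path_comb set \<Rightarrow> 'v \<Rightarrow> ('v, 'a) pre_digraph" where
  "apr_quiver Q I x =
    \<lparr>verts = verts Q,
     arcs = arcs Q,
     tail = (\<lambda>l. if head Q l = x then x
       else if tail Q l = x then tail Q (apr_beta Q I x l)
       else tail Q l),
     head = (\<lambda>l. if head Q l = x then tail Q l
       else if \<exists>\<beta>. apr_star Q I x l \<beta> then x
       else head Q l)\<rparr>"

definition apr_relations ::
    "('v, 'a) pre_digraph \<Rightarrow> ('v, 'a, 'k::field) path_comb set \<Rightarrow> 'v \<Rightarrow> ('a \<times> 'a) set" where
  "apr_relations Q I x =
    {(l, k). l \<in> arcs Q \<and> k \<in> arcs Q \<and> head Q k \<noteq> x \<and>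
      head Q l = tail Q k \<and> tail Q k \<noteq> x \<and> path_elem Q [l, k] \<in> I} \<union>
    {(apr_beta Q I x \<alpha>, \<alpha>) | \<alpha>. \<alpha> \<in> arcs Q \<and> tail Q \<alpha> = x} \<union>
    {(l, k). l \<in> arcs Q \<and> k \<in> arcs Q \<and> head Q k = x \<and> (\<exists>\<beta>. \<beta> \<noteq> k \<and> apr_star Q I x l \<beta>)}"

definition apr_reflection ::
    "('v, 'a) pre_digraph \<Rightarrow> ('v, 'a, 'k::field) path_comb set \<Rightarrow> 'v
      \<Rightarrow> ('v, 'a) pre_digraph \<times> ('v, 'a, 'k) path_comb set" where
  "apr_reflection Q I x =
    (apr_quiver Q I x, rel_ideal (apr_quiver Q I x) (apr_relations Q I x))"

inductive apr_step ::
    "('v, 'a) pre_digraph \<times> ('v, 'a, 'k::field) path_comb set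
      \<Rightarrow> ('v, 'a) pre_digraph \<times> ('v, 'a, 'k) path_comb set \<Rightarrow> bool" where
  "gentle Q I \<Longrightarrow> x \<in> verts Q \<Longrightarrow> apr_r1 Q x \<Longrightarrow> apr_r2 Q I x
    \<Longrightarrow> apr_step (Q, I) (apr_reflection Q I x)"


section \<open>Blossoming\<close>

text \<open>
  The new vertices are called \<open>Source p\<close> and \<open>Sink p\<close>, and the new arrows \<open>Sigma p\<close> and \<open>Tau p\<close>,
  for \<open>1 \<le> p \<le> d\<close>; this fixes the labeling together with the blossoming. As the blossoming and
  its labeling are only unique up to isomorphism, they are described by a predicate.
\<close>

datatype 'v bl_vertex = Old_Vertex (old_vertex: 'v) | Source nat | Sink nat

datatype 'a bl_arrow = Old_Arrow 'a | Sigma nat | Tau nat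

definition blossom_number :: "('v, 'a) pre_digraph \<Rightarrow> nat" where
  "blossom_number Q = 2 * card (verts Q) - card (arcs Q)"

definition maximal_path ::
    "('v, 'a) pre_digraph \<Rightarrow> ('v, 'a, 'k::field) path_comb set \<Rightarrow> 'v \<Rightarrow> 'a list \<Rightarrow> 'v \<Rightarrow> bool" where
  "maximal_path Q I u p v \<longleftrightarrow>
    p \<noteq> [] \<and> pre_digraph.awalk Q u p v \<and> path_elem Q p \<notin> I \<and>
    (\<forall>\<alpha>\<in>arcs Q. head Q \<alpha> = u \<longrightarrow> path_elem Q (\<alpha> # p) \<in> I) \<and>
    (\<forall>\<alpha>\<in>arcs Q. tail Q \<alpha> = v \<longrightarrow> path_elem Q (p @ [\<alpha>]) \<in> I)"

definition blossoming ::
    "('v, 'a) pre_digraph \<Rightarrow> ('v, 'a, 'k::field) path_comb set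
      \<Rightarrow> ('v bl_vertex, 'a bl_arrow) pre_digraph \<Rightarrow> ('v bl_vertex, 'a bl_arrow, 'k) path_comb set
      \<Rightarrow> bool" where
  "blossoming Q I Qb Ib \<longleftrightarrow>
    (let P = {1..blossom_number Q} in
      verts Qb = Old_Vertex ` verts Q \<union> Source ` P \<union> Sink ` P \<and>
      arcs Qb = Old_Arrow ` arcs Q \<union> Sigma ` P \<union> Tau ` P \<and>
      (\<forall>\<alpha>\<in>arcs Q. tail Qb (Old_Arrow \<alpha>) = Old_Vertex (tail Q \<alpha>) \<and>
        head Qb (Old_Arrow \<alpha>) = Old_Vertex (head Q \<alpha>)) \<and>
      (\<forall>p\<in>P. tail Qb (Sigma p) = Source p \<and> head Qb (Sigma p) \<in> Old_Vertex ` verts Q \<and>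
        tail Qb (Tau p) \<in> Old_Vertex ` verts Q \<and> head Qb (Tau p) = Sink p) \<and>
      (\<forall>v\<in>verts Q.
        card {p \<in> P. head Qb (Sigma p) = Old_Vertex v} = 2 - in_degree Q v \<and>
        card {p \<in> P. tail Qb (Tau p) = Old_Vertex v} = 2 - out_degree Q v) \<and>
      locally_gentle Qb Ib \<and>
      (\<forall>\<alpha> \<beta>. composable Q \<alpha> \<beta> \<longrightarrow>
        (path_elem Q [\<alpha>, \<beta>] \<in> I \<longleftrightarrow> path_elem Qb [Old_Arrow \<alpha>, Old_Arrow \<beta>] \<in> Ib)) \<and>
      (\<forall>p\<in>P. \<exists>w. maximal_path Qb Ib (Source p) w (Sink p)))"


section \<open>Finite gentle repetitions\<close>

text \<open>\<open>Copy \<alpha> i\<close> is the arrow \<open>\<alpha>\<^sup>[\<^sup>i\<^sup>]\<close>, and \<open>Link p i\<close> is the connecting arrow from copy \<open>i\<close> to copy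
  \<open>i + 1\<close> with label \<open>p\<close>. The vertex \<open>a\<^sup>[\<^sup>i\<^sup>]\<close> is \<open>(a, i)\<close>.\<close>

datatype 'a rep_arrow = Copy 'a nat | Link nat nat

fun rep_tail ::
    "('v, 'a) pre_digraph \<Rightarrow> ('v bl_vertex, 'a bl_arrow) pre_digraph \<Rightarrow> 'a rep_arrow \<Rightarrow> 'v \<times> nat" where
  "rep_tail Q Qb (Copy \<alpha> i) = (tail Q \<alpha>, i)"
| "rep_tail Q Qb (Link p i) = (old_vertex (tail Qb (Tau p)), i)"

fun rep_head ::
    "('v, 'a) pre_digraph \<Rightarrow> ('v bl_vertex, 'a bl_arrow) pre_digraph \<Rightarrow> 'a rep_arrow \<Rightarrow> 'v \<times> nat" where
  "rep_head Q Qb (Copy \<alpha> i) = (head Q \<alpha>, i)"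
| "rep_head Q Qb (Link p i) = (old_vertex (head Qb (Sigma p)), i + 1)"

definition rep_quiver ::
    "('v, 'a) pre_digraph \<Rightarrow> ('v bl_vertex, 'a bl_arrow) pre_digraph \<Rightarrow> nat
      \<Rightarrow> ('v \<times> nat, 'a rep_arrow) pre_digraph" where
  "rep_quiver Q Qb k =
    \<lparr>verts = verts Q \<times> {1..k},
     arcs = {Copy \<alpha> i | \<alpha> i. \<alpha> \<in> arcs Q \<and> i \<in> {1..k}} \<union>
       {Link p i | p i. p \<in> {1..blossom_number Q} \<and> i \<in> {1..<k}},
     tail = rep_tail Q Qb,
     head = rep_head Q Qb\<rparr>"

definition rep_relations ::
    "('v, 'a) pre_digraph \<Rightarrow> ('v, 'a, 'k::field) path_comb set
      \<Rightarrow> ('v bl_vertex, 'a bl_arrow) pre_digraph \<Rightarrow> ('v bl_vertex, 'a bl_arrow, 'k) path_comb set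
      \<Rightarrow> nat \<Rightarrow> ('a rep_arrow \<times> 'a rep_arrow) set" where
  "rep_relations Q I Qb Ib k =
    {(Copy \<alpha> i, Copy \<beta> i) | \<alpha> \<beta> i. composable Q \<alpha> \<beta> \<and> path_elem Q [\<alpha>, \<beta>] \<in> I} \<union>
    {(Copy \<alpha> i, Link p i) | \<alpha> p i.
      composable Qb (Old_Arrow \<alpha>) (Tau p) \<and> path_elem Qb [Old_Arrow \<alpha>, Tau p] \<in> Ib} \<union>
    {(Link p i, Copy \<beta> (i + 1)) | p \<beta> i.
      composable Qb (Sigma p) (Old_Arrow \<beta>) \<and> path_elem Qb [Sigma p, Old_Arrow \<beta>] \<in> Ib} \<union>
    {(Link p i, Link q (i + 1)) | p q i.
      composable Qb (Sigma p) (Tau q) \<and> path_elem Qb [Sigma p, Tau q] \<in> Ib}"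

text \<open>The relations are listed for all \<open>i\<close>; those between arrows of the finite repetition are
  selected here.\<close>

definition gentle_repetition ::
    "('v, 'a) pre_digraph \<Rightarrow> ('v, 'a, 'k::field) path_comb set
      \<Rightarrow> ('v bl_vertex, 'a bl_arrow) pre_digraph \<Rightarrow> ('v bl_vertex, 'a bl_arrow, 'k) path_comb set
      \<Rightarrow> nat \<Rightarrow> ('v \<times> nat, 'a rep_arrow) pre_digraph \<times> ('v \<times> nat, 'a rep_arrow, 'k) path_comb set"
  where
  "gentle_repetition Q I Qb Ib k =
    (rep_quiver Q Qb k,
     rel_ideal (rep_quiver Q Qb k)
       (rep_relations Q I Qb Ib k \<inter> {(\<alpha>, \<beta>). composable (rep_quiver Q Qb k) \<alpha> \<beta>}))"

end

theory Submission
  imports Defs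
begin

text \<open>
  In the blossoming of a gentle bound quiver every old vertex has two incoming and two outgoing
  arrows, and the composable pairs that are not relations match the former with the latter. So the
  nonzero paths fall into threads, and the labelling says that thread \<open>p\<close> runs from \<open>\<sigma>\<^sub>p\<close> to \<open>\<tau>\<^sub>p\<close>.
  Glueing \<open>\<tau>\<^sub>p\<close> to \<open>\<sigma>\<^sub>p\<close> gives one formal arrow, the link \<open>p\<close>, that closes up its thread. Arrows and
  links together form a finite set \<open>X\<close> with a permutation \<open>nx\<close> (go on along the thread) and a target
  map whose fibres all have two elements; the source of \<open>nx a\<close> is the target of \<open>a\<close>, and two
  composable arrows \<open>a\<close>, \<open>b\<close> form a relation exactly if \<open>nx a \<noteq> b\<close>. This is a
  \<open>thread_system\<close> that \<open>presents\<close> the bound quiver, and the statement is about such systems: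

  \<^item> Every connected quiver with an arrow that is presented by a thread system is gentle
    (\<open>gentle_Q\<close>). The ideals enter only through the fact that the ideal generated by a set of paths of
    length two is spanned by the paths that contain one of them (\<open>rel_ideal_eq\<close>); a finite-dimensional
    quotient then means that the threads are not cyclic once the links are removed, which is
    expressed by a rank that grows along \<open>nx\<close>.

  \<^item> By (c1)--(c3), each arrow \<open>b\<close> into \<open>x\<close> comes with the arrow \<open>nx b\<close> out of \<open>x\<close> and with an
    arrow \<open>mate b\<close> into the source \<open>y\<close> of \<open>b\<close> that forms a relation with \<open>b\<close>. Let \<open>rin\<close> swap each \<open>b\<close>
    with \<open>mate b\<close> and let \<open>rout\<close> swap each \<open>b\<close> with \<open>nx b\<close>. The reflection replaces \<open>tgt\<close>, \<open>src\<close>, \<open>nx\<close>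
    by \<open>tgt \<circ> rin\<close>, \<open>src \<circ> rout\<close>, \<open>rout \<circ> nx \<circ> rin\<close> (\<open>reflected_presents\<close>): each passage through \<open>x\<close>
    is taken out from behind \<open>y\<close> and put in front of the other passage through \<open>y\<close>. Written this way,
    the reflection visibly yields a thread system again (\<open>reflected_thread_system\<close>).

  \<^item> The finite gentle repetition is presented by \<open>k\<close> copies of \<open>X\<close> in which a link leads from each copy
    to the next one, with the links of the last copy removed (\<open>copies_thread_system\<close>,
    \<open>repetition_presents\<close>). Links are moved neither by \<open>rin\<close> nor by \<open>rout\<close>, so the reflection at the
    \<open>i\<close>-th copy of \<open>x\<close> only reflects the \<open>i\<close>-th copy of \<open>X\<close>. After \<open>k\<close> reflections the result is presented
    by the copies of the reflected system (\<open>all_steps\<close>).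

  \<^item> Each thread of the reflected system still contains exactly one link
    (\<open>reflected_threads_close\<close>). A blossoming of the reflected quiver gives a second thread system with
    the same arrows and one link on each thread, so the two differ by a renaming of the links
    (\<open>relabel_nx\<close>), and this renaming induces the isomorphism of the repetitions (\<open>copies_iso\<close>).
\<close>

section \<open>Ideals generated by paths of length two\<close>

definition has_factor :: "('a \<times> 'a) set \<Rightarrow> 'a list \<Rightarrow> bool" where
  "has_factor R w \<longleftrightarrow> (\<exists>xs a b ys. w = xs @ a # b # ys \<and> (a, b) \<in> R)"

lemma has_factor_append: "has_factor R w \<Longrightarrow> has_factor R (xs @ w @ ys)"
  unfolding has_factor_def by (metis append.assoc append_Cons)

lemma has_factor_Cons:
  "has_factor R (a # w) \<longleftrightarrow> (w \<noteq> [] \<and> (a, hd w) \<in> R) \<or> has_factor R w"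
proof
  assume "has_factor R (a # w)"
  then obtain xs c b ys where e: "a # w = xs @ c # b # ys" "(c, b) \<in> R"
    unfolding has_factor_def by blast
  show "(w \<noteq> [] \<and> (a, hd w) \<in> R) \<or> has_factor R w"
  proof (cases xs)
    case Nil
    then show ?thesis using e by auto
  next
    case (Cons x xs')
    then show ?thesis using e unfolding has_factor_def by auto
  qed
next
  assume "(w \<noteq> [] \<and> (a, hd w) \<in> R) \<or> has_factor R w"
  then show "has_factor R (a # w)"
  proof
    assume "w \<noteq> [] \<and> (a, hd w) \<in> R"
    then have "a # w = [] @ a # hd w # tl w" "(a, hd w) \<in> R" by auto
    then show ?thesis unfolding has_factor_def by blast
  qed (metis append.right_neutral append_Cons append_Nil has_factor_append)
qed

lemma has_factor_Nil [simp]: "\<not> has_factor R []"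
  by (simp add: has_factor_def)

lemma has_factor_snoc:
  "has_factor R (w @ [b]) \<longleftrightarrow> (w \<noteq> [] \<and> (last w, b) \<in> R) \<or> has_factor R w"
  by (induction w) (auto simp: has_factor_Cons hd_append)

text \<open>
  Multiplying by a path on either side cannot destroy a factor, so the linear combinations of paths
  with a factor in \<open>R\<close> are closed under multiplication.
\<close>

lemma keys_closed_ideal:
  assumes Q: "fin_digraph Q"
  shows "ideal {f. Poly_Mapping.keys f \<subseteq> {p \<in> paths Q. has_factor R (snd p)}}
    (path_algebra Q :: ('v, 'a, 'k::field) path_comb ring)" (is "ideal ?J ?A")
proof -
  interpret fin_digraph Q by fact
  have m: "path_mult Q f g \<in> ?J"
    if f: "Poly_Mapping.keys f \<subseteq> paths Q" and g: "Poly_Mapping.keys g \<subseteq> paths Q"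
      and fg: "f \<in> ?J \<or> g \<in> ?J" for f g :: "('v, 'a, 'k) path_comb"
  proof -
    have "has_factor R (snd q)" if q: "q \<in> Poly_Mapping.keys (path_mult Q f g)" for q
    proof -
      have "Poly_Mapping.keys (path_mult Q f g) \<subseteq>
          (\<Union>p\<in>Poly_Mapping.keys f. \<Union>r\<in>Poly_Mapping.keys g. {(fst p, snd p @ snd r)})"
        unfolding path_mult_def
        by (intro order.trans[OF keys_sum] UN_mono order_refl) auto
      then obtain p r where pr: "p \<in> Poly_Mapping.keys f" "r \<in> Poly_Mapping.keys g"
        and qq: "q = (fst p, snd p @ snd r)"
        using q by fastforce
      from fg have "has_factor R (snd p) \<or> has_factor R (snd r)"
        using pr by auto
      then show ?thesis
        using has_factor_append[of R "snd p" "[]" "snd r"] has_factor_append[of R "snd r" "snd p" "[]"]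
        by (auto simp: qq)
    qed
    then show ?thesis
      using path_mult_closed[OF wf_digraph_axioms f g] by auto
  qed
  have add: "f + g \<in> ?J" if "f \<in> ?J" "g \<in> ?J" for f g :: "('v, 'a, 'k) path_comb"
    using that keys_add[of f g] by blast
  have neg: "\<ominus>\<^bsub>?A\<^esub> f = - f" if "f \<in> carrier ?A" for f
  proof -
    interpret A: ring ?A by (rule ring_path_algebra[OF Q])
    have "- f \<in> carrier ?A" "- f \<oplus>\<^bsub>?A\<^esub> f = \<zero>\<^bsub>?A\<^esub>"
      using that by (auto simp: path_algebra_def)
    then show ?thesis using A.minus_equality that by metis
  qed
  show ?thesis
  proof (rule idealI)
    show "ring ?A" by (rule ring_path_algebra[OF Q])
    then interpret A: ring ?A .
    show "subgroup ?J (add_monoid ?A)"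
    proof (rule A.add.subgroupI)
      show "?J \<subseteq> carrier ?A" by (auto simp: path_algebra_def)
      have "(0 :: ('v, 'a, 'k) path_comb) \<in> ?J" by simp
      then show "?J \<noteq> {}" by blast
      show "\<ominus>\<^bsub>?A\<^esub> f \<in> ?J" if "f \<in> ?J" for f
      proof -
        have "f \<in> carrier ?A" using that by (auto simp: path_algebra_def)
        then show ?thesis using that by (simp add: neg)
      qed
    qed (use add in \<open>auto simp: path_algebra_def\<close>)
  next
    fix f g assume "f \<in> ?J" "g \<in> carrier ?A"
    then show "g \<otimes>\<^bsub>?A\<^esub> f \<in> ?J" "f \<otimes>\<^bsub>?A\<^esub> g \<in> ?J"
      using m[of f g] m[of g f] by (simp_all add: path_algebra_def subset_iff)
  qed
qed

text \<open>
  A path \<open>xs @ a # b # ys\<close> is the product of \<open>xs\<close>, the generator \<open>[a, b]\<close> and \<open>ys\<close>.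
\<close>

lemma single_mem_rel_ideal:
  assumes Q: "fin_digraph Q" and R: "R \<subseteq> {(\<alpha>, \<beta>). composable Q \<alpha> \<beta>}"
    and p: "p \<in> paths Q" "has_factor R (snd p)"
  shows "Poly_Mapping.single p c \<in> (rel_ideal Q R :: ('v, 'a, 'k::field) path_comb set)"
proof -
  interpret fin_digraph Q by fact
  let ?A = "path_algebra Q :: ('v, 'a, 'k) path_comb ring"
  interpret A: ring ?A by (rule ring_path_algebra[OF Q])
  let ?G = "(\<lambda>(\<alpha>, \<beta>). path_elem Q [\<alpha>, \<beta>]) ` R :: ('v, 'a, 'k) path_comb set"
  have awalk2: "awalk (tail Q a) [a, b] (head Q b)" if "(a, b) \<in> R" for a b
    using that R by (auto simp: composable_def awalk_def cas_simp)
  have "path_elem Q [a, b] \<in> carrier ?A" if "(a, b) \<in> R" for a b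
  proof -
    have "(tail Q a, [a, b]) \<in> paths Q"
      using awalk2[OF that] unfolding paths_def by blast
    then show ?thesis by (simp add: path_algebra_def path_elem_def)
  qed
  then have GA: "?G \<subseteq> carrier ?A" by auto
  then have id: "ideal (rel_ideal Q R) ?A"
    unfolding rel_ideal_def by (rule A.genideal_ideal)
  have G: "?G \<subseteq> rel_ideal Q R"
    unfolding rel_ideal_def using GA by (rule A.genideal_self)
  from id interpret I: ideal "rel_ideal Q R" ?A .
  obtain u w v where [simp]: "p = (u, w)" and w: "awalk u w v"
    using p by (auto simp: paths_def)
  obtain xs a b ys where we: "w = xs @ a # b # ys" and ab: "(a, b) \<in> R"
    using p unfolding has_factor_def by auto
  have arcs: "a \<in> arcs Q" "b \<in> arcs Q" "head Q a = tail Q b" "head Q b \<in> verts Q"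
    using ab R by (auto simp: composable_def)
  have e: "path_elem Q [a, b] \<in> (rel_ideal Q R :: ('v, 'a, 'k) path_comb set)"
    using G ab by auto
  have w1: "awalk u xs (tail Q a)" and w2: "awalk (head Q b) ys v"
    using w by (auto simp: we awalk_simps)
  have g: "Poly_Mapping.single (u, xs) c \<in> carrier ?A" "Poly_Mapping.single (head Q b, ys) 1 \<in> carrier ?A"
    using w1 w2 by (auto simp: path_algebra_def paths_def)
  have w3: "awalk u (xs @ [a, b]) (head Q b)"
    using w1 awalk2[OF ab] by (auto intro: awalk_appendI)
  have "path_mult Q (path_mult Q (Poly_Mapping.single (u, xs) c) (path_elem Q [a, b]))
      (Poly_Mapping.single (head Q b, ys) 1) = Poly_Mapping.single p c"
    unfolding path_elem_def using w1 w3 by (simp add: path_mult_single we)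
  moreover have "path_mult Q (path_mult Q (Poly_Mapping.single (u, xs) c) (path_elem Q [a, b]))
      (Poly_Mapping.single (head Q b, ys) 1) \<in> rel_ideal Q R"
    using I.I_r_closed[OF I.I_l_closed[OF e g(1)] g(2)] by (simp add: path_algebra_def)
  ultimately show ?thesis by simp
qed

text \<open>
  Membership in an ideal generated by paths of length two can be read off from the support. This is
  the only way in which ideals are treated below.
\<close>

lemma rel_ideal_eq:
  assumes Q: "fin_digraph Q" and R: "R \<subseteq> {(\<alpha>, \<beta>). composable Q \<alpha> \<beta>}"
  shows "(rel_ideal Q R :: ('v, 'a, 'k::field) path_comb set) =
    {f. Poly_Mapping.keys f \<subseteq> {p \<in> paths Q. has_factor R (snd p)}}" (is "_ = ?J")
proof
  interpret fin_digraph Q by fact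
  let ?A = "path_algebra Q :: ('v, 'a, 'k) path_comb ring"
  interpret A: ring ?A by (rule ring_path_algebra[OF Q])
  let ?G = "(\<lambda>(\<alpha>, \<beta>). path_elem Q [\<alpha>, \<beta>]) ` R :: ('v, 'a, 'k) path_comb set"
  have GJ: "?G \<subseteq> ?J"
  proof
    fix g assume "g \<in> ?G"
    then obtain a b where ab: "(a, b) \<in> R" and g: "g = path_elem Q [a, b]" by auto
    have "awalk (tail Q a) [a, b] (head Q b)"
      using ab R by (auto simp: composable_def awalk_def cas_simp)
    then have "(tail Q a, [a, b]) \<in> paths Q" by (auto simp: paths_def)
    then show "g \<in> ?J" using ab by (auto simp: g path_elem_def has_factor_Cons)
  qed
  show "rel_ideal Q R \<subseteq> ?J"
    unfolding rel_ideal_def by (rule A.genideal_minimal[OF keys_closed_ideal[OF Q] GJ])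
  have "?G \<subseteq> carrier ?A" using GJ by (auto simp: path_algebra_def)
  then have "ideal (rel_ideal Q R) ?A"
    unfolding rel_ideal_def by (rule A.genideal_ideal)
  then interpret I: ideal "rel_ideal Q R" ?A .
  have add: "f + g \<in> rel_ideal Q R" if "f \<in> rel_ideal Q R" "g \<in> rel_ideal Q R"
    for f g :: "('v, 'a, 'k) path_comb"
    using I.a_closed[OF that] by (simp add: path_algebra_def)
  have zero: "(0 :: ('v, 'a, 'k) path_comb) \<in> rel_ideal Q R"
    using I.zero_closed by (simp add: path_algebra_def)
  show "?J \<subseteq> rel_ideal Q R"
  proof
    fix f :: "('v, 'a, 'k) path_comb" assume f: "f \<in> ?J"
    have "(\<Sum>p\<in>S. Poly_Mapping.single p (Poly_Mapping.lookup f p)) \<in> rel_ideal Q R"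
      if "finite S" "S \<subseteq> Poly_Mapping.keys f" for S
      using that
    proof (induction S rule: finite_induct)
      case (insert p S)
      then have "Poly_Mapping.single p (Poly_Mapping.lookup f p) \<in> rel_ideal Q R"
        using f by (intro single_mem_rel_ideal[OF Q R]) auto
      then show ?case using insert by (simp add: add)
    qed (simp add: zero)
    from this[of "Poly_Mapping.keys f"] show "f \<in> rel_ideal Q R"
      by (simp only: path_comb_expand[symmetric] finite_keys order_refl)
  qed
qed

lemma path_elem_mem_rel_ideal:
  assumes "fin_digraph Q" "R \<subseteq> {(\<alpha>, \<beta>). composable Q \<alpha> \<beta>}" "pre_digraph.awalk Q (tail Q (hd p)) p v"
  shows "path_elem Q p \<in> (rel_ideal Q R :: ('v, 'a, 'k::field) path_comb set) \<longleftrightarrow> has_factor R p"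
  unfolding rel_ideal_eq[OF assms(1,2)] using assms(3)
  by (auto simp: path_elem_def paths_def)

lemma path_elem_pair_mem_rel_ideal:
  assumes "fin_digraph Q" "R \<subseteq> {(\<alpha>, \<beta>). composable Q \<alpha> \<beta>}" "composable Q a b"
  shows "path_elem Q [a, b] \<in> (rel_ideal Q R :: ('v, 'a, 'k::field) path_comb set) \<longleftrightarrow> (a, b) \<in> R"
proof -
  interpret fin_digraph Q by fact
  have "awalk (tail Q a) [a, b] (head Q b)"
    using assms(3) by (auto simp: composable_def awalk_def cas_simp)
  then show ?thesis
    using path_elem_mem_rel_ideal[OF assms(1,2), of "[a, b]"] by (simp add: has_factor_Cons)
qed

text \<open>
  Paths without a factor in \<open>R\<close> form a basis of the quotient. If a finite set \<open>B\<close> spans the quotient,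
  then each of them occurs in the support of an element of \<open>B\<close>, since a path outside all these supports
  would keep the coefficient \<open>1\<close> after subtracting any combination of \<open>B\<close>.
\<close>

lemma finite_dim_quotient_iff:
  assumes Q: "fin_digraph Q" and R: "R \<subseteq> {(\<alpha>, \<beta>). composable Q \<alpha> \<beta>}"
  shows "finite_dim_quotient Q (rel_ideal Q R :: ('v, 'a, 'k::field) path_comb set)
    \<longleftrightarrow> finite {p \<in> paths Q. \<not> has_factor R (snd p)}" (is "?D \<longleftrightarrow> finite ?G")
proof
  assume ?D
  then obtain B :: "('v, 'a, 'k) path_comb set" where B: "finite B"
    and *: "\<And>f. f \<in> carrier (path_algebra Q) \<Longrightarrow>
        \<exists>c. f - (\<Sum>b\<in>B. Poly_Mapping.map (\<lambda>y. c b * y) b) \<in> rel_ideal Q R"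
    unfolding finite_dim_quotient_def by blast
  have "?G \<subseteq> (\<Union>b\<in>B. Poly_Mapping.keys b)"
  proof
    fix p assume p: "p \<in> ?G"
    let ?f = "Poly_Mapping.single p 1 :: ('v, 'a, 'k) path_comb"
    have "?f \<in> carrier (path_algebra Q)" using p by (simp add: path_algebra_def)
    from *[OF this] obtain c where
      "?f - (\<Sum>b\<in>B. Poly_Mapping.map (\<lambda>y. c b * y) b) \<in> rel_ideal Q R" ..
    then have "p \<notin> Poly_Mapping.keys (?f - (\<Sum>b\<in>B. Poly_Mapping.map (\<lambda>y. c b * y) b))"
      using p unfolding rel_ideal_eq[OF Q R] by auto
    then have "(\<Sum>b\<in>B. Poly_Mapping.lookup (Poly_Mapping.map (\<lambda>y. c b * y) b) p) = 1"
      by (simp add: in_keys_iff lookup_minus lookup_sum)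
    then have "\<not> (\<forall>b\<in>B. Poly_Mapping.lookup (Poly_Mapping.map (\<lambda>y. c b * y) b) p = 0)"
      by (metis (no_types, lifting) sum.neutral zero_neq_one)
    then obtain b where "b \<in> B" "Poly_Mapping.lookup b p \<noteq> 0"
      by (auto simp: map.rep_eq when_def split: if_splits)
    then show "p \<in> (\<Union>b\<in>B. Poly_Mapping.keys b)" by (auto simp: in_keys_iff)
  qed
  then show "finite ?G" using B by (auto intro: finite_subset)
next
  assume fin: "finite ?G"
  let ?e = "\<lambda>p. Poly_Mapping.single p 1 :: ('v, 'a, 'k) path_comb"
  have inj: "inj_on ?e ?G"
  proof (rule inj_onI)
    fix p q assume "?e p = ?e q"
    then have "Poly_Mapping.keys (?e p) = Poly_Mapping.keys (?e q)" by (rule arg_cong)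
    then show "p = q" by simp
  qed
  show ?D
    unfolding finite_dim_quotient_def
  proof (intro exI[of _ "?e ` ?G"] conjI ballI)
    show "?e ` ?G \<subseteq> carrier (path_algebra Q)" by (auto simp: path_algebra_def)
    fix f :: "('v, 'a, 'k) path_comb" assume f: "f \<in> carrier (path_algebra Q)"
    let ?c = "\<lambda>b. Poly_Mapping.lookup f (the_inv_into ?G ?e b)"
    have "(\<Sum>b\<in>?e ` ?G. Poly_Mapping.map (\<lambda>y. ?c b * y) b)
        = (\<Sum>p\<in>?G. Poly_Mapping.single p (Poly_Mapping.lookup f p))"
      unfolding sum.reindex[OF inj] o_def
      by (intro sum.cong refl) (simp add: the_inv_into_f_f[OF inj])
    moreover have "Poly_Mapping.keys (f - (\<Sum>p\<in>?G. Poly_Mapping.single p (Poly_Mapping.lookup f p)))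
        \<subseteq> {p \<in> paths Q. has_factor R (snd p)}"
    proof
      fix q assume q: "q \<in> Poly_Mapping.keys (f - (\<Sum>p\<in>?G. Poly_Mapping.single p (Poly_Mapping.lookup f p)))"
      have "Poly_Mapping.lookup (\<Sum>p\<in>?G. Poly_Mapping.single p (Poly_Mapping.lookup f p)) q
          = (if q \<in> ?G then Poly_Mapping.lookup f q else 0)"
        unfolding lookup_sum lookup_single when_def using fin by simp
      then show "q \<in> {p \<in> paths Q. has_factor R (snd p)}"
        using q f by (auto simp: in_keys_iff lookup_minus path_algebra_def split: if_splits)
    qed
    ultimately have "f - (\<Sum>b\<in>?e ` ?G. Poly_Mapping.map (\<lambda>y. ?c b * y) b) \<in> rel_ideal Q R"
      unfolding rel_ideal_eq[OF Q R] by simp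
    then show "\<exists>c. f - (\<Sum>b\<in>?e ` ?G. Poly_Mapping.map (\<lambda>y. c b * y) b) \<in> rel_ideal Q R"
      by (rule exI[of _ ?c])
  qed (use fin in simp)
qed

text \<open>
  By \<open>rel_ideal_eq\<close>, the ideals in question consist of all combinations of certain paths, so an
  isomorphism of bound quivers only has to match these paths.
\<close>

lemma path_algebra_map_keys:
  fixes h :: "('v, 'a, 'w, 'b) digraph_isomorphism"
  defines "H \<equiv> \<lambda>p. (iso_verts h (fst p), map (iso_arcs h) (snd p))"
  assumes inj: "inj_on H K"
  shows "path_algebra_map h ` {f. Poly_Mapping.keys f \<subseteq> K} =
    {g :: ('w, 'b, 'k::field) path_comb. Poly_Mapping.keys g \<subseteq> H ` K}"
proof (intro equalityI subsetI)
  fix g :: "('w, 'b, 'k) path_comb"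
  assume "g \<in> path_algebra_map h ` {f. Poly_Mapping.keys f \<subseteq> K}"
  then obtain f where f: "Poly_Mapping.keys f \<subseteq> K" and g: "g = path_algebra_map h f" by auto
  have "Poly_Mapping.keys g \<subseteq> (\<Union>p\<in>Poly_Mapping.keys f. {H p})"
    unfolding g path_algebra_map_def H_def by (intro order.trans[OF keys_sum] UN_mono) auto
  then show "g \<in> {g. Poly_Mapping.keys g \<subseteq> H ` K}" using f by blast
next
  fix g :: "('w, 'b, 'k) path_comb"
  assume g: "g \<in> {g. Poly_Mapping.keys g \<subseteq> H ` K}"
  define i where "i = the_inv_into K H"
  have i: "i q \<in> K" "H (i q) = q" if "q \<in> Poly_Mapping.keys g" for q
  proof -
    have q: "q \<in> H ` K" using that g by blast
    show "i q \<in> K" unfolding i_def by (rule the_inv_into_into[OF inj q order_refl])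
    show "H (i q) = q" unfolding i_def by (rule f_the_inv_into_f[OF inj q])
  qed
  define f where "f = (\<Sum>q\<in>Poly_Mapping.keys g. Poly_Mapping.single (i q) (Poly_Mapping.lookup g q))"
  have iinj: "inj_on i (Poly_Mapping.keys g)"
    by (rule inj_onI) (metis i(2))
  have lk: "Poly_Mapping.lookup f (i q) = Poly_Mapping.lookup g q" if q: "q \<in> Poly_Mapping.keys g" for q
  proof -
    have "i r = i q \<longleftrightarrow> r = q" if "r \<in> Poly_Mapping.keys g" for r
      using inj_onD[OF iinj _ that q] by blast
    then have "Poly_Mapping.lookup f (i q) = (\<Sum>r\<in>Poly_Mapping.keys g. if r = q then Poly_Mapping.lookup g r else 0)"
      unfolding f_def lookup_sum lookup_single when_def by (intro sum.cong) simp_all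
    then show ?thesis using q by simp
  qed
  have sub: "Poly_Mapping.keys f \<subseteq> i ` Poly_Mapping.keys g"
    unfolding f_def by (rule order.trans[OF keys_sum]) (auto split: if_splits)
  have "i q \<in> Poly_Mapping.keys f" if "q \<in> Poly_Mapping.keys g" for q
    using lk[OF that] that by (simp add: in_keys_iff)
  with sub have keys: "Poly_Mapping.keys f = i ` Poly_Mapping.keys g"
    by blast
  have "path_algebra_map h f = (\<Sum>q\<in>Poly_Mapping.keys g. Poly_Mapping.single (H (i q)) (Poly_Mapping.lookup f (i q)))"
    unfolding path_algebra_map_def keys sum.reindex[OF iinj] o_def H_def ..
  also have "\<dots> = (\<Sum>q\<in>Poly_Mapping.keys g. Poly_Mapping.single q (Poly_Mapping.lookup g q))"
    by (intro sum.cong refl) (simp add: lk i(2))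
  also have "\<dots> = g" by (simp only: path_comb_expand[symmetric])
  finally have "g = path_algebra_map h f" ..
  moreover have "f \<in> {f. Poly_Mapping.keys f \<subseteq> K}"
    using keys i(1) by auto
  ultimately show "g \<in> path_algebra_map h ` {f. Poly_Mapping.keys f \<subseteq> K}"
    by (rule image_eqI)
qed

section \<open>Connected quivers\<close>

text \<open>
  Connectedness is used and proved by way of two-valued functions that are constant along arrows:
  such a function can be moved from one quiver to another without handling walks. For the converse,
  take the function that tells the vertices linked to \<open>u\<close> from the others.
\<close>

lemma connected_iff_constant:
  assumes "wf_digraph G"
  shows "connected G \<longleftrightarrow> verts G \<noteq> {} \<and>
    (\<forall>f :: _ \<Rightarrow> bool. (\<forall>a\<in>arcs G. f (tail G a) = f (head G a)) \<longrightarrow>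
      (\<forall>u\<in>verts G. \<forall>v\<in>verts G. f u = f v))"
proof -
  interpret wf_digraph G by fact
  let ?S = "(arcs_ends G)\<^sup>s"
  have S: "(u, v) \<in> ?S \<longleftrightarrow> (\<exists>a\<in>arcs G. (u = tail G a \<and> v = head G a) \<or> (v = tail G a \<and> u = head G a))"
    for u v by (auto simp: symcl_def arcs_ends_def arc_to_ends_def)
  have const: "f u = f v" if "(u, v) \<in> rtrancl_on (verts G) ?S" "\<forall>a\<in>arcs G. f (tail G a) = f (head G a)"
    for u v and f :: "_ \<Rightarrow> bool"
    using that by induction (auto simp: S)
  have linked: "(u, v) \<in> rtrancl_on (verts G) ?S"
    if uv: "u \<in> verts G" "v \<in> verts G" and
      all: "\<forall>f :: _ \<Rightarrow> bool. (\<forall>a\<in>arcs G. f (tail G a) = f (head G a)) \<longrightarrow>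
        (\<forall>u\<in>verts G. \<forall>v\<in>verts G. f u = f v)" for u v
  proof -
    let ?f = "\<lambda>w. (u, w) \<in> rtrancl_on (verts G) ?S"
    have "?f (tail G a) = ?f (head G a)" if "a \<in> arcs G" for a
    proof
      assume "?f (tail G a)"
      then show "?f (head G a)"
        by (rule rtrancl_on_into_rtrancl_on) (use that in \<open>auto simp: S\<close>)
    next
      assume "?f (head G a)"
      then show "?f (tail G a)"
        by (rule rtrancl_on_into_rtrancl_on) (use that in \<open>auto simp: S\<close>)
    qed
    then have "\<forall>u\<in>verts G. \<forall>v\<in>verts G. ?f u = ?f v"
      by (intro spec[OF all, of ?f, THEN mp] ballI)
    from bspec[OF bspec[OF this uv(1)] uv(2)] have "?f u = ?f v" .
    then show ?thesis using uv by simp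
  qed
  show ?thesis
    unfolding connected_conv
  proof (rule conj_cong[OF refl], rule iffI)
    assume all: "\<forall>u\<in>verts G. \<forall>v\<in>verts G. (u, v) \<in> rtrancl_on (verts G) ?S"
    show "\<forall>f :: _ \<Rightarrow> bool. (\<forall>a\<in>arcs G. f (tail G a) = f (head G a)) \<longrightarrow>
        (\<forall>u\<in>verts G. \<forall>v\<in>verts G. f u = f v)"
      by (intro allI impI ballI, rule const[OF bspec[OF bspec[OF all]]])
  next
    assume all: "\<forall>f :: _ \<Rightarrow> bool. (\<forall>a\<in>arcs G. f (tail G a) = f (head G a)) \<longrightarrow>
        (\<forall>u\<in>verts G. \<forall>v\<in>verts G. f u = f v)"
    show "\<forall>u\<in>verts G. \<forall>v\<in>verts G. (u, v) \<in> rtrancl_on (verts G) ?S"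
      by (intro ballI linked[OF _ _ all])
  qed
qed

section \<open>Thread systems\<close>

text \<open>
  \<open>X\<close> consists of the arrows \<open>X - P\<close> and of the links \<open>P\<close>. The rank says that following \<open>nx\<close>
  through arrows only never leads back, so that every orbit of \<open>nx\<close> contains a link.
\<close>

locale thread_system =
  fixes V :: "'v set" and X P :: "'c set" and src tgt :: "'c \<Rightarrow> 'v" and nx :: "'c \<Rightarrow> 'c"
  assumes finite_X: "finite X" and P_subset: "P \<subseteq> X"
    and tgt_in: "a \<in> X \<Longrightarrow> tgt a \<in> V"
    and tgt_fibre: "v \<in> V \<Longrightarrow> card {a \<in> X. tgt a = v} = 2"
    and nx_in: "a \<in> X \<Longrightarrow> nx a \<in> X" and nx_inj: "inj_on nx X"
    and src_nx: "a \<in> X \<Longrightarrow> src (nx a) = tgt a"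
    and ranked: "\<exists>rk :: 'c \<Rightarrow> nat. \<forall>a\<in>X - P. nx a \<in> X - P \<longrightarrow> rk a < rk (nx a)"
begin

lemma nx_image: "nx ` X = X"
  using finite_X nx_inj nx_in by (simp add: endo_inj_surj image_subsetI)

lemma pred_ex:
  assumes "a \<in> X"
  obtains b where "b \<in> X" "nx b = a" "tgt b = src a"
  using assms nx_image src_nx by (metis imageE)

lemma nx_eq: "a \<in> X \<Longrightarrow> b \<in> X \<Longrightarrow> nx a = nx b \<longleftrightarrow> a = b"
  using nx_inj by (auto dest: inj_onD)

lemma src_in: "a \<in> X \<Longrightarrow> src a \<in> V"
proof -
  assume "a \<in> X"
  then obtain b where "b \<in> X" "tgt b = src a" by (rule pred_ex)
  then show ?thesis using tgt_in by metis
qed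

lemma src_fibre_eq: "{a \<in> X. src a = v} = nx ` {a \<in> X. tgt a = v}"
proof (intro equalityI subsetI)
  fix a assume "a \<in> {a \<in> X. src a = v}"
  then obtain b where "b \<in> X" "nx b = a" "tgt b = v" by (auto elim: pred_ex)
  then show "a \<in> nx ` {a \<in> X. tgt a = v}" by blast
qed (use src_nx nx_in in auto)

lemma src_fibre: "v \<in> V \<Longrightarrow> card {a \<in> X. src a = v} = 2"
  unfolding src_fibre_eq using nx_inj tgt_fibre
  by (subst card_image) (auto intro: inj_on_subset)

lemma tgt_twin:
  assumes "a \<in> X" "b \<in> X" "c \<in> X" "tgt a = tgt c" "tgt b = tgt c" "a \<noteq> b"
  shows "c = a \<or> c = b"
proof -
  let ?F = "{d \<in> X. tgt d = tgt c}"
  have "card {a, b} = card ?F" using assms tgt_fibre tgt_in by auto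
  moreover have "finite ?F" using finite_X by simp
  ultimately have "{a, b} = ?F" using assms by (intro card_subset_eq) auto
  then show ?thesis using assms by blast
qed

lemma src_twin:
  assumes "a \<in> X" "b \<in> X" "c \<in> X" "src a = src c" "src b = src c" "a \<noteq> b"
  shows "c = a \<or> c = b"
proof -
  obtain a' b' c' where "a' \<in> X" "nx a' = a" "tgt a' = src a" "b' \<in> X" "nx b' = b" "tgt b' = src b"
      "c' \<in> X" "nx c' = c" "tgt c' = src c"
    using pred_ex assms(1-3) by metis
  then show ?thesis using tgt_twin[of a' b' c'] assms by auto
qed

lemma finite_V: "finite V"
proof -
  have "V \<subseteq> tgt ` X"
  proof
    fix v assume "v \<in> V"
    then have "{a \<in> X. tgt a = v} \<noteq> {}" using tgt_fibre by (metis card.empty zero_neq_numeral)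
    then show "v \<in> tgt ` X" by blast
  qed
  then show ?thesis using finite_X by (blast intro: finite_subset)
qed

text \<open>
  Without links, \<open>nx\<close> would raise the rank forever.
\<close>

lemma P_nonempty:
  assumes "X - P \<noteq> {}"
  shows "P \<noteq> {}"
proof
  assume P: "P = {}"
  obtain rk :: "'c \<Rightarrow> nat" where rk: "\<And>a. a \<in> X \<Longrightarrow> rk a < rk (nx a)"
    using ranked P nx_in by auto
  have X: "finite (rk ` X)" "rk ` X \<noteq> {}" using finite_X assms by auto
  then obtain a where a: "a \<in> X" "rk a = Max (rk ` X)" by (metis Max_in imageE)
  have "rk (nx a) \<le> Max (rk ` X)" using X nx_in[OF a(1)] by simp
  then show False using rk[OF a(1)] a by simp
qed

end

text \<open>
  The function \<open>th\<close> assigns its link to each thread. It forces two links on the same orbit of \<open>nx\<close>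
  to be equal. In terms of a blossoming, the maximal path from \<open>s\<^sub>p\<close> ends in the sink \<open>t\<^sub>p\<close> with the same label.
\<close>

definition threads_close :: "'c set \<Rightarrow> 'c set \<Rightarrow> ('c \<Rightarrow> 'c) \<Rightarrow> bool" where
  "threads_close X P nx \<longleftrightarrow>
    (\<exists>th. (\<forall>a\<in>X. th (nx a) = th a) \<and> (\<forall>p\<in>P. th p = p))"

section \<open>Bound quivers presented by thread systems\<close>

text \<open>
  The set \<open>A\<close> stands for the arrows \<open>X - P\<close> of a thread system. Arrows of \<open>Q\<close> are only identified
  with its elements along \<open>\<iota>\<close>, because \<open>X\<close> also contains links and so lives in another type.
\<close>

definition presents ::
    "'v set \<Rightarrow> 'c set \<Rightarrow> ('c \<Rightarrow> 'v) \<Rightarrow> ('c \<Rightarrow> 'v) \<Rightarrow> ('c \<Rightarrow> 'c)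
      \<Rightarrow> ('v, 'a) pre_digraph \<Rightarrow> ('v, 'a, 'k::field) path_comb set \<Rightarrow> ('a \<Rightarrow> 'c) \<Rightarrow> bool" where
  "presents V A src tgt nx Q I \<iota> \<longleftrightarrow>
    verts Q = V \<and> bij_betw \<iota> (arcs Q) A \<and>
    (\<forall>a\<in>arcs Q. tail Q a = src (\<iota> a) \<and> head Q a = tgt (\<iota> a)) \<and>
    I = rel_ideal Q {(a, b). composable Q a b \<and> nx (\<iota> a) \<noteq> \<iota> b}"

lemma presents_cong:
  assumes "\<And>a. a \<in> A \<Longrightarrow> src a = src' a" "\<And>a. a \<in> A \<Longrightarrow> tgt a = tgt' a"
    "\<And>a. a \<in> A \<Longrightarrow> nx a = nx' a"
  shows "presents V A src tgt nx Q I \<iota> \<longleftrightarrow> presents V A src' tgt' nx' Q I \<iota>"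
proof (cases "bij_betw \<iota> (arcs Q) A")
  case True
  have in_A: "\<iota> a \<in> A" if "a \<in> arcs Q" for a
    by (rule bij_betw_apply[OF True that])
  have nx: "nx (\<iota> a) = nx' (\<iota> a)" if "composable Q a b" for a b
    by (rule assms(3)[OF in_A]) (use that in \<open>simp add: composable_def\<close>)
  have "composable Q a b \<and> nx (\<iota> a) \<noteq> \<iota> b \<longleftrightarrow> composable Q a b \<and> nx' (\<iota> a) \<noteq> \<iota> b" for a b
    using nx[of a b] by (cases "composable Q a b") simp_all
  moreover have "tail Q a = src (\<iota> a) \<and> head Q a = tgt (\<iota> a) \<longleftrightarrow>
      tail Q a = src' (\<iota> a) \<and> head Q a = tgt' (\<iota> a)" if "a \<in> arcs Q" for a
    by (simp only: assms(1)[OF in_A[OF that]] assms(2)[OF in_A[OF that]])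
  ultimately show ?thesis
    by (simp only: presents_def cong: ball_cong)
qed (simp add: presents_def)

locale presented = thread_system V X P src tgt nx
  for V :: "'v set" and X P :: "'c set" and src tgt :: "'c \<Rightarrow> 'v" and nx :: "'c \<Rightarrow> 'c" +
  fixes Q :: "('v, 'a) pre_digraph" and I :: "('v, 'a, 'k::field) path_comb set" and \<iota> :: "'a \<Rightarrow> 'c"
  assumes presents: "presents V (X - P) src tgt nx Q I \<iota>"
begin

lemma verts_Q: "verts Q = V"
  and \<iota>_bij: "bij_betw \<iota> (arcs Q) (X - P)"
  and tail_Q: "a \<in> arcs Q \<Longrightarrow> tail Q a = src (\<iota> a)"
  and head_Q: "a \<in> arcs Q \<Longrightarrow> head Q a = tgt (\<iota> a)"
  and I_eq: "I = rel_ideal Q {(a, b). composable Q a b \<and> nx (\<iota> a) \<noteq> \<iota> b}"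
  using presents by (auto simp: presents_def)

lemma \<iota>_in: "a \<in> arcs Q \<Longrightarrow> \<iota> a \<in> X - P"
  using \<iota>_bij by (auto dest: bij_betwE)

lemma \<iota>_X: "a \<in> arcs Q \<Longrightarrow> \<iota> a \<in> X"
  using \<iota>_in by simp

lemma \<iota>_eq: "a \<in> arcs Q \<Longrightarrow> b \<in> arcs Q \<Longrightarrow> \<iota> a = \<iota> b \<longleftrightarrow> a = b"
  using \<iota>_bij by (auto simp: bij_betw_def dest: inj_onD)

lemma \<iota>_surj:
  assumes "c \<in> X - P"
  obtains a where "a \<in> arcs Q" "\<iota> a = c"
proof -
  have "c \<in> \<iota> ` arcs Q" using assms \<iota>_bij by (simp add: bij_betw_def)
  then show ?thesis using that by blast
qed

lemma fin_digraph_Q: "fin_digraph Q"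
proof
  show "finite (arcs Q)" using \<iota>_bij finite_X by (metis bij_betw_finite finite_Diff)
qed (auto simp: verts_Q finite_V tail_Q head_Q src_in tgt_in \<iota>_X)

lemma composable_Q:
  "composable Q a b \<longleftrightarrow> a \<in> arcs Q \<and> b \<in> arcs Q \<and> tgt (\<iota> a) = src (\<iota> b)"
  by (auto simp: composable_def tail_Q head_Q)

lemma path_elem_mem_I:
  assumes "composable Q a b"
  shows "path_elem Q [a, b] \<in> I \<longleftrightarrow> nx (\<iota> a) \<noteq> \<iota> b"
  unfolding I_eq using assms by (subst path_elem_pair_mem_rel_ideal[OF fin_digraph_Q]) auto

lemma degrees:
  assumes "v \<in> verts Q"
  shows "in_degree Q v \<le> 2" "out_degree Q v \<le> 2"
proof -
  have inj: "inj_on \<iota> Y" if "Y \<subseteq> arcs Q" for Y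
    using \<iota>_bij that by (auto simp: bij_betw_def intro: inj_on_subset)
  have "card (in_arcs Q v) \<le> card {a \<in> X. tgt a = v}"
    by (rule card_inj_on_le[where f = \<iota>])
      (auto simp: in_arcs_def head_Q \<iota>_X finite_X intro!: inj)
  then show "in_degree Q v \<le> 2" using assms tgt_fibre by (simp add: in_degree_def verts_Q)
  have "card (out_arcs Q v) \<le> card {a \<in> X. src a = v}"
    by (rule card_inj_on_le[where f = \<iota>])
      (auto simp: out_arcs_def tail_Q \<iota>_X finite_X intro!: inj)
  then show "out_degree Q v \<le> 2" using assms src_fibre by (simp add: out_degree_def verts_Q)
qed

text \<open>
  Among the two elements of \<open>X\<close> that end at the source of \<open>a\<close>, exactly one is followed by \<open>a\<close>,
  and dually for those that start at the target of \<open>a\<close>.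
\<close>

lemma at_most_one:
  shows "\<exists>\<^sub>\<le>\<^sub>1b. composable Q b a \<and> path_elem Q [b, a] \<in> I"
    and "\<exists>\<^sub>\<le>\<^sub>1b. composable Q b a \<and> path_elem Q [b, a] \<notin> I"
    and "\<exists>\<^sub>\<le>\<^sub>1b. composable Q a b \<and> path_elem Q [a, b] \<in> I"
    and "\<exists>\<^sub>\<le>\<^sub>1b. composable Q a b \<and> path_elem Q [a, b] \<notin> I"
proof -
  have "b = c" if "composable Q b a" "path_elem Q [b, a] \<in> I" "composable Q c a" "path_elem Q [c, a] \<in> I" for b c
  proof -
    have *: "a \<in> arcs Q" "b \<in> arcs Q" "c \<in> arcs Q" "tgt (\<iota> b) = src (\<iota> a)" "tgt (\<iota> c) = src (\<iota> a)"
      using that by (auto simp: composable_Q)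
    obtain d where d: "d \<in> X" "nx d = \<iota> a" "tgt d = src (\<iota> a)" using pred_ex \<iota>_X * by metis
    have "\<iota> b \<noteq> d" "\<iota> c \<noteq> d" using that d by (auto simp: path_elem_mem_I)
    then have "\<iota> b = \<iota> c" using tgt_twin[of "\<iota> b" d "\<iota> c"] * d \<iota>_X by auto
    then show ?thesis using \<iota>_eq * by blast
  qed
  then show "\<exists>\<^sub>\<le>\<^sub>1b. composable Q b a \<and> path_elem Q [b, a] \<in> I" by (auto simp: Uniq_def)
  have "b = c" if "composable Q b a" "path_elem Q [b, a] \<notin> I" "composable Q c a" "path_elem Q [c, a] \<notin> I" for b c
    using that nx_eq \<iota>_X \<iota>_eq by (metis composable_Q path_elem_mem_I)
  then show "\<exists>\<^sub>\<le>\<^sub>1b. composable Q b a \<and> path_elem Q [b, a] \<notin> I" by (auto simp: Uniq_def)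
  have "b = c" if "composable Q a b" "path_elem Q [a, b] \<in> I" "composable Q a c" "path_elem Q [a, c] \<in> I" for b c
  proof -
    have *: "a \<in> arcs Q" "b \<in> arcs Q" "c \<in> arcs Q" "src (\<iota> b) = tgt (\<iota> a)" "src (\<iota> c) = tgt (\<iota> a)"
      using that by (auto simp: composable_Q)
    have "nx (\<iota> a) \<noteq> \<iota> b" "nx (\<iota> a) \<noteq> \<iota> c" using that by (auto simp: path_elem_mem_I)
    then have "\<iota> b = \<iota> c" using src_twin[of "\<iota> b" "nx (\<iota> a)" "\<iota> c"] * \<iota>_X nx_in src_nx by auto
    then show ?thesis using \<iota>_eq * by blast
  qed
  then show "\<exists>\<^sub>\<le>\<^sub>1b. composable Q a b \<and> path_elem Q [a, b] \<in> I" by (auto simp: Uniq_def)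
  have "b = c" if "composable Q a b" "path_elem Q [a, b] \<notin> I" "composable Q a c" "path_elem Q [a, c] \<notin> I" for b c
    using that \<iota>_eq by (metis composable_Q path_elem_mem_I)
  then show "\<exists>\<^sub>\<le>\<^sub>1b. composable Q a b \<and> path_elem Q [a, b] \<notin> I" by (auto simp: Uniq_def)
qed

text \<open>
  The rank grows along a path without relations, so such a path does not repeat an arrow, and
  there are only finitely many of them.
\<close>

lemma finite_dim: "finite_dim_quotient Q I"
proof -
  interpret Q: fin_digraph Q by (rule fin_digraph_Q)
  let ?R = "{(a, b). composable Q a b \<and> nx (\<iota> a) \<noteq> \<iota> b}"
  obtain rk :: "'c \<Rightarrow> nat" where rk: "\<And>a. a \<in> X - P \<Longrightarrow> nx a \<in> X - P \<Longrightarrow> rk a < rk (nx a)"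
    using ranked by blast
  have "sorted_wrt (\<lambda>a b. rk (\<iota> a) < rk (\<iota> b)) w"
    if "set w \<subseteq> arcs Q" "Q.cas u w v" "\<not> has_factor ?R w" for u w v
    using that
  proof (induction w arbitrary: u)
    case (Cons a w)
    then have IH: "sorted_wrt (\<lambda>a b. rk (\<iota> a) < rk (\<iota> b)) w" by (auto simp: has_factor_Cons)
    show ?case
    proof (cases w)
      case (Cons b w')
      have ab: "a \<in> arcs Q" "b \<in> arcs Q" "composable Q a b"
        using Cons.prems \<open>w = b # w'\<close> by (auto simp: composable_def)
      then have "nx (\<iota> a) = \<iota> b"
        using Cons.prems \<open>w = b # w'\<close> by (auto simp: has_factor_Cons)
      then have "rk (\<iota> a) < rk (\<iota> b)" using rk \<iota>_in ab by metis
      then show ?thesis using IH \<open>w = b # w'\<close> by force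
    qed simp
  qed simp
  then have "sorted_wrt (<) (map (rk \<circ> \<iota>) w)"
    if "set w \<subseteq> arcs Q" "Q.cas u w v" "\<not> has_factor ?R w" for u w v
    using that by (simp add: sorted_wrt_map)
  then have dist: "distinct w" if "set w \<subseteq> arcs Q" "Q.cas u w v" "\<not> has_factor ?R w" for u w v
    using that unfolding strict_sorted_iff distinct_map by blast
  have "{p \<in> paths Q. \<not> has_factor ?R (snd p)} \<subseteq> verts Q \<times> {w. set w \<subseteq> arcs Q \<and> distinct w}"
    using dist by (auto simp: paths_def Q.awalk_def)
  moreover have "finite (verts Q \<times> {w. set w \<subseteq> arcs Q \<and> distinct w})"
    using finite_subset_distinct[OF Q.finite_arcs] by simp
  ultimately have "finite {p \<in> paths Q. \<not> has_factor ?R (snd p)}" by (rule finite_subset)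
  then show ?thesis
    unfolding I_eq by (subst finite_dim_quotient_iff[OF fin_digraph_Q]) auto
qed

lemma gentle_Q:
  assumes "connected Q" "arcs Q \<noteq> {}"
  shows "gentle Q I"
proof -
  have "\<exists>R\<subseteq>{(a, b). composable Q a b}. I = rel_ideal Q R"
    using I_eq by (intro exI[of _ "{(a, b). composable Q a b \<and> nx (\<iota> a) \<noteq> \<iota> b}"] conjI) auto
  then show ?thesis
    unfolding gentle_def locally_gentle_def quiver_def
    by (intro conjI ballI assms fin_digraph_Q degrees at_most_one finite_dim)
qed

end

section \<open>Reflecting a thread system\<close>

text \<open>
  An involution whenever \<open>f\<close> is injective on \<open>B\<close> and maps it to elements outside \<open>B\<close>.
\<close>

definition swap_along :: "('c \<Rightarrow> 'c) \<Rightarrow> 'c set \<Rightarrow> 'c \<Rightarrow> 'c" where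
  "swap_along f B a =
    (if a \<in> B then f a else if a \<in> f ` B then the_inv_into B f a else a)"

lemma swap_along_in: "b \<in> B \<Longrightarrow> swap_along f B b = f b"
  by (simp add: swap_along_def)

lemma swap_along_out: "a \<notin> B \<Longrightarrow> a \<notin> f ` B \<Longrightarrow> swap_along f B a = a"
  by (simp add: swap_along_def)

lemma swap_along_image:
  assumes "inj_on f B" "f ` B \<inter> B = {}" "b \<in> B"
  shows "swap_along f B (f b) = b"
  using assms by (auto simp: swap_along_def the_inv_into_f_f)

lemma swap_along_cases:
  obtains (moved) "a \<in> B" | (image) b where "b \<in> B" "a = f b" | (fixed) "a \<notin> B" "a \<notin> f ` B"
  by blast

lemma swap_along_swap_along:
  assumes "inj_on f B" "f ` B \<inter> B = {}"
  shows "swap_along f B (swap_along f B a) = a"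
  by (cases rule: swap_along_cases[where a = a and f = f and B = B])
    (auto simp: swap_along_in swap_along_out swap_along_image[OF assms])

lemma swap_along_mem:
  assumes "inj_on f B" "f ` B \<inter> B = {}" "B \<subseteq> Y" "f ` B \<subseteq> Y"
  shows "swap_along f B a \<in> Y \<longleftrightarrow> a \<in> Y"
  by (cases rule: swap_along_cases[where a = a and f = f and B = B])
    (use assms in \<open>auto simp: swap_along_in swap_along_out swap_along_image[OF assms(1,2)]\<close>)

lemma swap_along_copy:
  assumes "inj_on f B" "f ` B \<inter> B = {}" "f' ` (B \<times> {n}) \<inter> B \<times> {n} = {}"
    "\<And>b. b \<in> B \<Longrightarrow> f' (b, n) = (f b, n)"
  shows "swap_along f' (B \<times> {n}) (a, i) = (if i = n then (swap_along f B a, i) else (a, i))"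
proof -
  have inj: "inj_on f' (B \<times> {n})"
    using assms(1,4) by (auto simp: inj_on_def)
  show ?thesis
  proof (cases "i = n")
    case True
    show ?thesis
    proof (cases rule: swap_along_cases[where a = a and f = f and B = B])
      case moved
      then show ?thesis using True assms(4) by (simp add: swap_along_in)
    next
      case (image b)
      then have "(a, i) = f' (b, n)" using True assms(4) by simp
      then show ?thesis
        using True image swap_along_image[OF inj assms(3), of "(b, n)"] swap_along_image[OF assms(1,2) image(1)]
        by simp
    next
      case fixed
      have "(a, i) \<notin> f' ` (B \<times> {n})" using fixed assms(4) by auto
      then show ?thesis using True fixed by (simp add: swap_along_out)
    qed
  next
    case False
    have "(a, i) \<notin> f' ` (B \<times> {n})" "(a, i) \<notin> B \<times> {n}" using False assms(4) by auto
    then show ?thesis using False by (simp add: swap_along_out)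
  qed
qed

text \<open>
  The assumptions are the combinatorial content of (c1)--(c3): both elements that end at \<open>x\<close> are
  arrows and are followed by arrows, none of them is a loop, and each forms a relation with an
  arrow \<open>mate b\<close> before it.
\<close>

locale thread_reflection = thread_system V X P src tgt nx
  for V :: "'v set" and X P :: "'c set" and src tgt :: "'c \<Rightarrow> 'v" and nx :: "'c \<Rightarrow> 'c" +
  fixes x :: 'v and mate :: "'c \<Rightarrow> 'c"
  assumes x_in: "x \<in> V"
    and into_x: "b \<in> X \<Longrightarrow> tgt b = x \<Longrightarrow> b \<notin> P \<and> nx b \<notin> P \<and> src b \<noteq> x"
    and mate: "b \<in> X \<Longrightarrow> tgt b = x \<Longrightarrow>
      mate b \<in> X \<and> mate b \<notin> P \<and> tgt (mate b) = src b \<and> nx (mate b) \<noteq> b"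
begin

definition entering :: "'c set" where "entering = {b \<in> X. tgt b = x}"

definition rin :: "'c \<Rightarrow> 'c" where "rin = swap_along mate entering"
definition rout :: "'c \<Rightarrow> 'c" where "rout = swap_along nx entering"

abbreviation src' :: "'c \<Rightarrow> 'v" where "src' \<equiv> src \<circ> rout"
abbreviation tgt' :: "'c \<Rightarrow> 'v" where "tgt' \<equiv> tgt \<circ> rin"
abbreviation nx' :: "'c \<Rightarrow> 'c" where "nx' \<equiv> rout \<circ> nx \<circ> rin"

lemma entering_D: assumes "b \<in> entering"
  shows "b \<in> X" "tgt b = x" "b \<notin> P" "nx b \<in> X" "nx b \<notin> P" "src b \<noteq> x" "src (nx b) = x"
    "mate b \<in> X" "mate b \<notin> P" "tgt (mate b) = src b" "nx (mate b) \<noteq> b"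
proof -
  show b: "b \<in> X" and t: "tgt b = x" using assms by (simp_all add: entering_def)
  show "b \<notin> P" "nx b \<notin> P" "src b \<noteq> x" using into_x[OF b t] by simp_all
  show "mate b \<in> X" "mate b \<notin> P" "tgt (mate b) = src b" "nx (mate b) \<noteq> b"
    using mate[OF b t] by simp_all
  show "nx b \<in> X" by (rule nx_in[OF b])
  show "src (nx b) = x" using src_nx[OF b] t by simp
qed

lemma entering_I: "b \<in> X \<Longrightarrow> tgt b = x \<Longrightarrow> b \<in> entering"
  by (simp add: entering_def)

lemma nx_entering: "nx ` entering \<inter> entering = {}"
proof -
  have "nx b \<notin> entering" if "b \<in> entering" for b using entering_D(6)[of "nx b"] entering_D(7)[OF that] by blast
  then show ?thesis by blast
qed

lemma mate_entering: "mate ` entering \<inter> entering = {}"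
proof -
  have "mate b \<notin> entering" if "b \<in> entering" for b
    using entering_D(2)[of "mate b"] entering_D(6,10)[OF that] by metis
  then show ?thesis by blast
qed

text \<open>
  The predecessor of \<open>b\<close> on its thread and the mate of \<open>b\<close> are two different elements that end at the
  source of \<open>b\<close>, so there is no third one.
\<close>

lemma into_src:
  assumes "b \<in> entering" "c \<in> X" "tgt c = src b"
  shows "nx c = b \<or> c = mate b"
proof -
  obtain d where d: "d \<in> X" "nx d = b" "tgt d = src b" using pred_ex entering_D(1)[OF assms(1)] by metis
  have "d \<noteq> mate b" using d entering_D(11)[OF assms(1)] by metis
  then show ?thesis
    using tgt_twin[of d "mate b" c] d assms entering_D(8,10)[OF assms(1)] by auto
qed

lemma out_src:
  assumes "b \<in> entering" "d \<in> X" "src d = src b"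
  shows "d = b \<or> d = nx (mate b)"
proof -
  obtain c where "c \<in> X" "nx c = d" "tgt c = src d" using pred_ex assms(2) by metis
  then show ?thesis using into_src[of b c] assms by auto
qed

lemma nx_entering_iff: "d \<in> nx ` entering \<longleftrightarrow> d \<in> X \<and> src d = x"
proof
  assume "d \<in> X \<and> src d = x"
  then obtain b where "b \<in> X" "nx b = d" "tgt b = x" using pred_ex by metis
  then show "d \<in> nx ` entering" using entering_I by blast
qed (use entering_D in auto)

lemma inj_nx_entering: "inj_on nx entering"
  using nx_inj by (rule inj_on_subset) (simp add: entering_def)

text \<open>
  If both arrows into \<open>x\<close> start at the same vertex, then the mate of each of them is the predecessor
  of the other.
\<close>

lemma inj_mate: "inj_on mate entering"
proof (rule inj_onI, rule ccontr)
  fix b c assume b: "b \<in> entering" and c: "c \<in> entering" and e: "mate b = mate c" and ne: "b \<noteq> c"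
  have "src b = src c" using entering_D(10) b c e by metis
  then have "c = nx (mate b)" using out_src[OF b, of c] entering_D(1)[OF c] ne by auto
  then show False using entering_D(11)[OF c] e by simp
qed

lemma rin_entering: "b \<in> entering \<Longrightarrow> rin b = mate b"
  unfolding rin_def by (rule swap_along_in)

lemma rin_mate: "b \<in> entering \<Longrightarrow> rin (mate b) = b"
  unfolding rin_def by (rule swap_along_image[OF inj_mate mate_entering])

lemma rin_other: "a \<notin> entering \<Longrightarrow> a \<notin> mate ` entering \<Longrightarrow> rin a = a"
  unfolding rin_def by (rule swap_along_out)

lemma rin_rin: "rin (rin a) = a"
  unfolding rin_def by (rule swap_along_swap_along[OF inj_mate mate_entering])

lemma rin_A: "rin a \<in> X - P \<longleftrightarrow> a \<in> X - P"
  unfolding rin_def by (rule swap_along_mem[OF inj_mate mate_entering]) (auto simp: entering_D)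

lemma rin_X: "rin a \<in> X \<longleftrightarrow> a \<in> X"
  unfolding rin_def by (rule swap_along_mem[OF inj_mate mate_entering]) (auto simp: entering_D)

lemma rout_entering: "b \<in> entering \<Longrightarrow> rout b = nx b"
  unfolding rout_def by (rule swap_along_in)

lemma rout_nx: "b \<in> entering \<Longrightarrow> rout (nx b) = b"
  unfolding rout_def by (rule swap_along_image[OF inj_nx_entering nx_entering])

lemma rout_other: "a \<notin> entering \<Longrightarrow> a \<notin> nx ` entering \<Longrightarrow> rout a = a"
  unfolding rout_def by (rule swap_along_out)

lemma rout_rout: "rout (rout a) = a"
  unfolding rout_def by (rule swap_along_swap_along[OF inj_nx_entering nx_entering])

lemma rout_X: "rout a \<in> X \<longleftrightarrow> a \<in> X"
  unfolding rout_def by (rule swap_along_mem[OF inj_nx_entering nx_entering]) (auto simp: entering_D)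

lemma rin_P: "p \<in> P \<Longrightarrow> rin p = p"
  by (rule rin_other) (auto simp: entering_D)

text \<open>
  The effect on the threads: an arrow \<open>b\<close> into \<open>x\<close> is skipped where it was (\<open>through\<close>) and inserted
  right after its mate (\<open>enter\<close>). The thread goes on from there as it did after the mate (\<open>leave\<close>),
  where the other arrow into \<open>x\<close> is skipped if it comes next (\<open>leave_through\<close>).
\<close>

lemma nx'_cases [consumes 1]:
  assumes a: "a \<in> X"
  obtains (through) b where "b \<in> entering" "a \<notin> entering" "nx a = b" "nx' a = nx b"
  | (enter) b where "b \<in> entering" "a = mate b" "nx' a = b"
  | (leave) "a \<in> entering" "nx (mate a) \<notin> entering" "nx' a = nx (mate a)"
  | (leave_through) b where "a \<in> entering" "b \<in> entering" "nx (mate a) = b" "nx' a = nx b"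
  | (same) "a \<notin> entering" "nx a \<notin> entering" "nx' a = nx a"
proof -
  have other: "rout (nx c) = (if nx c \<in> entering then nx (nx c) else nx c)" if c: "c \<in> X" "c \<notin> entering" for c
  proof (cases "nx c \<in> entering")
    case False
    moreover have "nx c \<notin> nx ` entering" using c nx_eq entering_D(1) by (metis imageE)
    ultimately show ?thesis using rout_other by simp
  qed (simp add: rout_entering)
  show ?thesis
  proof (cases rule: swap_along_cases[where a = a and f = mate and B = entering])
    case moved
    have "mate a \<notin> entering" "mate a \<in> X" using moved mate_entering entering_D(8) by auto
    then have "nx' a = (if nx (mate a) \<in> entering then nx (nx (mate a)) else nx (mate a))"
      using other moved by (simp add: rin_entering)
    then show ?thesis using leave leave_through moved by (cases "nx (mate a) \<in> entering") auto
  next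
    case (image b)
    then have "nx' a = b" by (simp add: rin_mate rout_nx)
    then show ?thesis using enter image by blast
  next
    case fixed
    then have "nx' a = (if nx a \<in> entering then nx (nx a) else nx a)"
      using other a by (simp add: rin_other)
    then show ?thesis using through same fixed by (cases "nx a \<in> entering") auto
  qed
qed

text \<open>
  Since \<open>rin\<close> and \<open>rout\<close> are involutions, all conditions except the one on ranks are inherited
  directly. For the rank, doubling all values leaves room for each \<open>b\<close> right above its mate.
\<close>

lemma reflected_thread_system: "thread_system V X P src' tgt' nx'"
proof
  show "finite X" "P \<subseteq> X" by (rule finite_X, rule P_subset)
  show "tgt' a \<in> V" if "a \<in> X" for a using that tgt_in rin_X by simp
  show "nx' a \<in> X" if "a \<in> X" for a using that nx_in rin_X rout_X by simp
  show "src' (nx' a) = tgt' a" if "a \<in> X" for a using that src_nx rin_X by (simp add: rout_rout)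
  show "inj_on nx' X"
  proof (rule inj_onI)
    fix a b assume ab: "a \<in> X" "b \<in> X" "nx' a = nx' b"
    then have "nx (rin a) = nx (rin b)" using rout_rout by (metis comp_apply)
    then have "rin a = rin b" using nx_eq rin_X ab by blast
    then show "a = b" using rin_rin by metis
  qed
  show "card {a \<in> X. tgt' a = v} = 2" if "v \<in> V" for v
  proof -
    have "{a \<in> X. tgt' a = v} = rin ` {a \<in> X. tgt a = v}"
    proof (intro equalityI subsetI)
      fix a assume "a \<in> {a \<in> X. tgt' a = v}"
      then have "rin a \<in> {a \<in> X. tgt a = v}" by (simp add: rin_X)
      then show "a \<in> rin ` {a \<in> X. tgt a = v}" using rin_rin by (metis image_eqI)
    qed (auto simp: rin_X rin_rin)
    moreover have "inj_on rin Y" for Y by (rule inj_onI) (metis rin_rin)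
    ultimately show ?thesis using tgt_fibre[OF that] by (simp add: card_image)
  qed
  obtain rk :: "'c \<Rightarrow> nat" where rk: "\<And>a. a \<in> X - P \<Longrightarrow> nx a \<in> X - P \<Longrightarrow> rk a < rk (nx a)"
    using ranked by blast
  \<comment> \<open>the odd values are used for the arrows into \<open>x\<close> only\<close>
  define rk' where "rk' a = (if a \<in> entering then Suc (2 * rk (mate a)) else 2 * rk a)" for a
  have "rk' a < rk' (nx' a)" if a: "a \<in> X - P" "nx' a \<in> X - P" for a
  proof -
    have aX: "a \<in> X" using a by simp
    show ?thesis
      using aX
    proof (cases rule: nx'_cases)
      case (through b)
      have "nx b \<notin> entering" using nx_entering through by blast
      moreover have "rk a < rk b" "rk b < rk (nx b)" using rk a through entering_D by auto
      ultimately show ?thesis using through by (simp add: rk'_def)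
    next
      case (enter b)
      have "a \<notin> entering" using mate_entering enter by blast
      then show ?thesis using enter by (simp add: rk'_def)
    next
      case leave
      have "rk (mate a) < rk (nx (mate a))" using rk[of "mate a"] a leave entering_D(8,9) by auto
      then show ?thesis using leave by (simp add: rk'_def)
    next
      case (leave_through b)
      have "nx b \<notin> entering" using nx_entering leave_through by blast
      moreover have "rk (mate a) < rk b" "rk b < rk (nx b)"
        using rk[of "mate a"] rk[of b] leave_through entering_D by auto
      ultimately show ?thesis using leave_through by (simp add: rk'_def)
    next
      case same
      then show ?thesis using rk a by (auto simp: rk'_def)
    qed
  qed
  then show "\<exists>rk :: 'c \<Rightarrow> nat. \<forall>a\<in>X - P. nx' a \<in> X - P \<longrightarrow> rk a < rk (nx' a)" by blast
qed

text \<open>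
  An arrow into \<open>x\<close> changes over to the thread of its mate; all other elements stay on their thread.
\<close>

lemma reflected_threads_close:
  assumes "threads_close X P nx"
  shows "threads_close X P nx'"
proof -
  obtain th where th: "\<And>a. a \<in> X \<Longrightarrow> th (nx a) = th a" "\<And>p. p \<in> P \<Longrightarrow> th p = p"
    using assms by (auto simp: threads_close_def)
  define th' where "th' a = (if a \<in> entering then th (mate a) else th a)" for a
  have "th' (nx' a) = th' a" if a: "a \<in> X" for a
    using a
  proof (cases rule: nx'_cases)
    case (through b)
    have "nx b \<notin> entering" using nx_entering through by blast
    moreover have "th (nx b) = th a" using th a through entering_D by metis
    ultimately show ?thesis using through by (simp add: th'_def)
  next
    case (enter b)
    have "a \<notin> entering" using mate_entering enter by blast
    then show ?thesis using enter by (simp add: th'_def)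
  next
    case leave
    then show ?thesis using th(1)[of "mate a"] entering_D(8) by (simp add: th'_def)
  next
    case (leave_through b)
    have "nx b \<notin> entering" using nx_entering leave_through by blast
    moreover have "th (nx b) = th (mate a)" using th leave_through entering_D by metis
    ultimately show ?thesis using leave_through by (simp add: th'_def)
  next
    case same
    then show ?thesis using th a by (simp add: th'_def)
  qed
  moreover have "th' p = p" if "p \<in> P" for p
    using that th entering_D(3) by (auto simp: th'_def)
  ultimately show ?thesis unfolding threads_close_def by blast
qed

end

section \<open>Reflections of presented quivers\<close>

locale presented_reflection = thread_reflection V X P src tgt nx x mate +
    presented V X P src tgt nx Q I \<iota>
  for V :: "'v set" and X P :: "'c set" and src tgt :: "'c \<Rightarrow> 'v" and nx :: "'c \<Rightarrow> 'c"
    and x :: 'v and mate :: "'c \<Rightarrow> 'c"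
    and Q :: "('v, 'a) pre_digraph" and I :: "('v, 'a, 'k::field) path_comb set" and \<iota> :: "'a \<Rightarrow> 'c"
begin

lemma x_in_Q: "x \<in> verts Q"
  using x_in verts_Q by simp

lemma apr_r1_x: "apr_r1 Q x"
proof -
  have "tail Q a \<noteq> x" if "a \<in> arcs Q" "head Q a = x" for a
    using into_x[of "\<iota> a"] that by (simp add: tail_Q head_Q \<iota>_X)
  then show ?thesis unfolding apr_r1_def by blast
qed

text \<open>
  As both elements that end at \<open>x\<close> are arrows, so is the predecessor on its thread of an arrow \<open>a\<close>
  that starts at \<open>x\<close>. It is the only arrow into \<open>x\<close> that forms no relation with \<open>a\<close>.
\<close>

lemma arrow_before:
  assumes "a \<in> arcs Q" "tail Q a = x"
  obtains b where "b \<in> arcs Q" "\<iota> b \<in> entering" "nx (\<iota> b) = \<iota> a" "composable Q b a" "apr_beta Q I x a = b"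
    "path_elem Q [b, a] \<notin> I"
proof -
  have "\<iota> a \<in> nx ` entering" using assms \<iota>_X tail_Q by (simp add: nx_entering_iff)
  then obtain c where c: "c \<in> entering" "nx c = \<iota> a" by auto
  have "c \<in> X - P" using entering_D(1,3)[OF c(1)] by simp
  then obtain b where b: "b \<in> arcs Q" "\<iota> b = c" using \<iota>_surj by metis
  have comp: "composable Q b' a" if "b' \<in> arcs Q" "head Q b' = x" for b'
    using that assms by (auto simp: composable_def)
  have hb: "head Q b = x" using b c entering_D(2) head_Q by metis
  have "apr_beta Q I x a = b"
    unfolding apr_beta_def
  proof (rule the_equality)
    show "b \<in> arcs Q \<and> head Q b = x \<and> path_elem Q [b, a] \<notin> I"
      using b c hb comp path_elem_mem_I by metis
    show "b' = b" if "b' \<in> arcs Q \<and> head Q b' = x \<and> path_elem Q [b', a] \<notin> I" for b'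
    proof -
      have "nx (\<iota> b') = \<iota> a" using that comp path_elem_mem_I by blast
      then have "\<iota> b' = \<iota> b" using b c nx_eq \<iota>_X that by metis
      then show ?thesis using \<iota>_eq that b by blast
    qed
  qed
  moreover have "path_elem Q [b, a] \<notin> I" using b c hb comp path_elem_mem_I by metis
  ultimately show ?thesis using that[of b] b c hb comp by simp
qed

lemma apr_r2_x: "apr_r2 Q I x"
  unfolding apr_r2_def
proof (intro ballI impI)
  fix a assume "a \<in> arcs Q" "tail Q a = x"
  then show "\<exists>b\<in>arcs Q. head Q b = x \<and> path_elem Q [b, a] \<notin> I"
  proof (rule arrow_before)
    fix b assume "b \<in> arcs Q" "composable Q b a" "path_elem Q [b, a] \<notin> I"
    then show ?thesis using \<open>tail Q a = x\<close> by (auto simp: composable_def)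
  qed
qed

text \<open>
  An arrow that ends at the source of \<open>b\<close> either precedes \<open>b\<close> on its thread or is the mate of \<open>b\<close>.
  The relation in \<open>(*)\<close> excludes the former.
\<close>

lemma star_iff:
  assumes "l \<in> arcs Q"
  shows "apr_star Q I x l b \<longleftrightarrow> b \<in> arcs Q \<and> \<iota> b \<in> entering \<and> \<iota> l = mate (\<iota> b)"
proof (cases "b \<in> arcs Q \<and> \<iota> b \<in> entering")
  case True
  then have b: "b \<in> arcs Q" "\<iota> b \<in> entering" by auto
  have "apr_star Q I x l b \<longleftrightarrow> tgt (\<iota> l) = src (\<iota> b) \<and> nx (\<iota> l) \<noteq> \<iota> b"
    unfolding apr_star_def using b assms path_elem_mem_I[of l b] entering_D(2)[OF b(2)]
    by (auto simp: composable_def head_Q tail_Q)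
  also have "\<dots> \<longleftrightarrow> \<iota> l = mate (\<iota> b)"
    using into_src[OF b(2) \<iota>_X[OF assms]] entering_D(10,11)[OF b(2)] by metis
  finally show ?thesis using b by blast
next
  case False
  then show ?thesis unfolding apr_star_def using entering_I \<iota>_X head_Q by metis
qed

lemma apr_quiver_sel [simp]:
  "verts (apr_quiver Q I x) = verts Q" "arcs (apr_quiver Q I x) = arcs Q"
  by (simp_all add: apr_quiver_def)

lemma in_entering_iff: "a \<in> arcs Q \<Longrightarrow> \<iota> a \<in> entering \<longleftrightarrow> head Q a = x"
  using \<iota>_X by (simp add: entering_def head_Q)

lemma in_nx_entering_iff: "a \<in> arcs Q \<Longrightarrow> \<iota> a \<in> nx ` entering \<longleftrightarrow> tail Q a = x"
  using \<iota>_X by (simp add: nx_entering_iff tail_Q)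

lemma in_mate_entering_iff: "a \<in> arcs Q \<Longrightarrow> \<iota> a \<in> mate ` entering \<longleftrightarrow> (\<exists>b. apr_star Q I x a b)"
proof -
  assume a: "a \<in> arcs Q"
  have "\<exists>c\<in>arcs Q. \<iota> c = b" if "b \<in> entering" for b
    using \<iota>_surj[of b] entering_D(1,3)[OF that] by blast
  then show ?thesis unfolding star_iff[OF a] by blast
qed

lemma tail_apr:
  assumes a: "a \<in> arcs Q"
  shows "tail (apr_quiver Q I x) a = src' (\<iota> a)"
proof (cases rule: swap_along_cases[where a = "\<iota> a" and f = nx and B = entering])
  case moved
  then show ?thesis using entering_D(7)[OF moved] in_entering_iff[OF a] by (simp add: apr_quiver_def rout_entering)
next
  case (image b)
  have t: "tail Q a = x" using in_nx_entering_iff[OF a] image by blast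
  have h: "head Q a \<noteq> x" using nx_entering image in_entering_iff[OF a] by auto
  obtain c where c: "c \<in> arcs Q" "\<iota> c \<in> entering" "nx (\<iota> c) = \<iota> a" "apr_beta Q I x a = c"
    using arrow_before[OF a t] by metis
  have "\<iota> c = b" using inj_nx_entering c image by (metis inj_onD)
  then show ?thesis using image t h c by (simp add: apr_quiver_def rout_nx tail_Q)
next
  case fixed
  then show ?thesis
    using in_entering_iff[OF a] in_nx_entering_iff[OF a] a by (simp add: apr_quiver_def rout_other tail_Q)
qed

lemma head_apr:
  assumes a: "a \<in> arcs Q"
  shows "head (apr_quiver Q I x) a = tgt' (\<iota> a)"
proof (cases rule: swap_along_cases[where a = "\<iota> a" and f = mate and B = entering])
  case moved
  then show ?thesis using entering_D(10)[OF moved] in_entering_iff[OF a] a by (simp add: apr_quiver_def rin_entering tail_Q)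
next
  case (image b)
  have "head Q a \<noteq> x" using mate_entering image in_entering_iff[OF a] by auto
  moreover have "\<exists>b. apr_star Q I x a b" using image in_mate_entering_iff[OF a] by blast
  ultimately show ?thesis using image entering_D(2) by (simp add: apr_quiver_def rin_mate)
next
  case fixed
  then show ?thesis
    using in_entering_iff[OF a] in_mate_entering_iff[OF a] a by (simp add: apr_quiver_def rin_other head_Q)
qed

text \<open>
  A pair \<open>(a, b)\<close> is a relation after the reflection if and only if \<open>(rin a, rout b)\<close> was one before.
  The three families of generators correspond to the three cases for \<open>b\<close>. If \<open>b\<close> ends at \<open>x\<close>, then
  \<open>rout b\<close> starts at \<open>x\<close> and \<open>rin a\<close> has to be the other arrow into \<open>x\<close>, which makes \<open>a\<close> its mate. If
  \<open>b\<close> starts at \<open>x\<close>, then \<open>rout b\<close> is the arrow before it, and the only relation that ends with this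
  arrow begins with its mate. Otherwise \<open>rout\<close> fixes \<open>b\<close>, and an arrow moved by \<open>rin\<close> forms a relation
  with \<open>b\<close> neither before nor after the reflection.
\<close>

lemma apr_relations_eq:
  "apr_relations Q I x = {(a, b). composable (apr_quiver Q I x) a b \<and> nx' (\<iota> a) \<noteq> \<iota> b}"
proof -
  have comp: "composable (apr_quiver Q I x) a b \<longleftrightarrow>
      a \<in> arcs Q \<and> b \<in> arcs Q \<and> tgt (rin (\<iota> a)) = src (rout (\<iota> b))" for a b
    by (auto simp: composable_def tail_apr head_apr)
  have nx': "nx' c \<noteq> d \<longleftrightarrow> nx (rin c) \<noteq> rout d" for c d
    using rout_rout by (metis comp_apply)
  have "(a, b) \<in> apr_relations Q I x \<longleftrightarrow>
      tgt (rin (\<iota> a)) = src (rout (\<iota> b)) \<and> nx (rin (\<iota> a)) \<noteq> rout (\<iota> b)"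
    if a: "a \<in> arcs Q" and b: "b \<in> arcs Q" for a b
  proof (cases rule: swap_along_cases[where a = "\<iota> b" and f = nx and B = entering])
    case moved
    then have hb: "head Q b = x" using in_entering_iff[OF b] by blast
    have tb: "tail Q b \<noteq> x" using entering_D(6)[OF moved] tail_Q b by simp
    have "(a, b) \<in> apr_relations Q I x \<longleftrightarrow> (\<exists>c. c \<noteq> b \<and> apr_star Q I x a c)"
      using a b hb tb by (auto simp: apr_relations_def)
    also have "\<dots> \<longleftrightarrow> rin (\<iota> a) \<in> entering \<and> rin (\<iota> a) \<noteq> \<iota> b"
    proof
      assume "\<exists>c. c \<noteq> b \<and> apr_star Q I x a c"
      then obtain c where "c \<noteq> b" "c \<in> arcs Q" "\<iota> c \<in> entering" "\<iota> a = mate (\<iota> c)"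
        using star_iff[OF a] by blast
      then show "rin (\<iota> a) \<in> entering \<and> rin (\<iota> a) \<noteq> \<iota> b" using rin_mate \<iota>_eq b by auto
    next
      assume r: "rin (\<iota> a) \<in> entering \<and> rin (\<iota> a) \<noteq> \<iota> b"
      then obtain c where c: "c \<in> arcs Q" "\<iota> c = rin (\<iota> a)" using \<iota>_surj entering_D(1,3) by (metis DiffI)
      then have "\<iota> a = mate (\<iota> c)" using r rin_entering rin_rin by metis
      then have "apr_star Q I x a c" unfolding star_iff[OF a] using c r by simp
      moreover have "c \<noteq> b" using c r by metis
      ultimately show "\<exists>c. c \<noteq> b \<and> apr_star Q I x a c" by blast
    qed
    also have "\<dots> \<longleftrightarrow> tgt (rin (\<iota> a)) = src (rout (\<iota> b)) \<and> nx (rin (\<iota> a)) \<noteq> rout (\<iota> b)"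
    proof -
      have "rin (\<iota> a) \<in> X" using a \<iota>_X rin_X by blast
      then show ?thesis
        using entering_D(1,7)[OF moved] nx_eq by (auto simp: entering_def rout_entering[OF moved])
    qed
    finally show ?thesis .
  next
    case (image c)
    have tb: "tail Q b = x" using in_nx_entering_iff[OF b] image by blast
    have hb: "head Q b \<noteq> x" using nx_entering image in_entering_iff[OF b] by auto
    obtain d where d: "d \<in> arcs Q" "\<iota> d \<in> entering" "nx (\<iota> d) = \<iota> b" "apr_beta Q I x b = d"
      using arrow_before[OF b tb] by metis
    have dc: "\<iota> d = c" using inj_nx_entering d image by (metis inj_onD)
    have "(a, b) \<in> apr_relations Q I x \<longleftrightarrow> a = d"
      using a b hb tb d by (auto simp: apr_relations_def)
    also have "\<dots> \<longleftrightarrow> rin (\<iota> a) = mate c"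
      using a d dc \<iota>_eq rin_rin rin_entering by metis
    also have "\<dots> \<longleftrightarrow> tgt (rin (\<iota> a)) = src c \<and> nx (rin (\<iota> a)) \<noteq> c"
      using into_src[of c "rin (\<iota> a)"] image entering_D(10,11) a \<iota>_X rin_X by metis
    finally show ?thesis using image by (simp add: rout_nx)
  next
    case fixed
    have tb: "tail Q b \<noteq> x" and hb: "head Q b \<noteq> x" using fixed in_entering_iff in_nx_entering_iff b by auto
    have "(a, b) \<in> apr_relations Q I x \<longleftrightarrow> head Q a = tail Q b \<and> path_elem Q [a, b] \<in> I"
      using a b hb tb by (auto simp: apr_relations_def)
    also have "\<dots> \<longleftrightarrow> tgt (\<iota> a) = src (\<iota> b) \<and> nx (\<iota> a) \<noteq> \<iota> b"
      using path_elem_mem_I[of a b] a b by (auto simp: composable_def head_Q tail_Q)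
    also have "\<dots> \<longleftrightarrow> tgt (rin (\<iota> a)) = src (\<iota> b) \<and> nx (rin (\<iota> a)) \<noteq> \<iota> b"
    proof (cases "rin (\<iota> a) = \<iota> a")
      case False
      then consider (moved) "\<iota> a \<in> entering" | (image) c where "c \<in> entering" "\<iota> a = mate c"
        using rin_other by blast
      then obtain c where c: "c \<in> entering" "(\<iota> a = c \<and> rin (\<iota> a) = mate c) \<or> (\<iota> a = mate c \<and> rin (\<iota> a) = c)"
      proof cases
        case moved
        then show ?thesis using that[of "\<iota> a"] by (simp add: rin_entering)
      next
        case (image c)
        then show ?thesis using that[of c] by (simp add: rin_mate)
      qed
      have x: "tgt c \<noteq> src (\<iota> b)" using entering_D(2)[OF c(1)] tb tail_Q b by simp
      have "\<not> (tgt (mate c) = src (\<iota> b) \<and> nx (mate c) \<noteq> \<iota> b)"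
        using out_src[OF c(1) \<iota>_X[OF b]] entering_D(10)[OF c(1)] fixed c(1) by metis
      then show ?thesis using c(2) x by auto
    qed simp
    finally show ?thesis using fixed by (simp add: rout_other)
  qed
  moreover have "a \<in> arcs Q \<and> b \<in> arcs Q" if "(a, b) \<in> apr_relations Q I x" for a b
  proof -
    have "apr_beta Q I x c \<in> arcs Q" if "c \<in> arcs Q" "tail Q c = x" for c
      using that by (rule arrow_before) simp
    then show ?thesis using that unfolding apr_relations_def by blast
  qed
  ultimately show ?thesis unfolding comp nx' by blast
qed

lemma reflected_presents:
  "presents V (X - P) src' tgt' nx' (apr_quiver Q I x)
    (rel_ideal (apr_quiver Q I x) (apr_relations Q I x) :: ('v, 'a, 'k) path_comb set) \<iota>"
  unfolding presents_def apr_relations_eq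
  by (intro conjI ballI refl) (simp_all only: apr_quiver_sel verts_Q \<iota>_bij tail_apr head_apr)

lemma reflected_presented:
  "presented V X P src' tgt' nx' (apr_quiver Q I x)
    (rel_ideal (apr_quiver Q I x) (apr_relations Q I x) :: ('v, 'a, 'k) path_comb set) \<iota>"
  by (rule presented.intro[OF reflected_thread_system presented_axioms.intro[OF reflected_presents]])

text \<open>
  A reflected arrow has its ends where they were, except that \<open>x\<close> may be exchanged with the source of
  an arrow \<open>b\<close> into \<open>x\<close>. The reflected arrow \<open>b\<close> itself joins these two vertices, so a function that is
  constant along the reflected arrows is constant along the original ones.
\<close>

lemma reflected_connected:
  assumes "connected Q"
  shows "connected (apr_quiver Q I x)"
proof -
  have wf: "wf_digraph Q" "wf_digraph (apr_quiver Q I x)"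
    using fin_digraph_Q presented.fin_digraph_Q[OF reflected_presented]
    by (simp_all add: fin_digraph_def)
  have "f u = f v"
    if f: "\<forall>a\<in>arcs Q. f (tail (apr_quiver Q I x) a) = f (head (apr_quiver Q I x) a)"
      and uv: "u \<in> verts Q" "v \<in> verts Q" for f :: "'v \<Rightarrow> bool" and u v
  proof -
    have f': "f (src' c) = f (tgt' c)" if c: "c \<in> X - P" for c
    proof -
      obtain a where a: "a \<in> arcs Q" "\<iota> a = c" using \<iota>_surj[OF c] .
      then show ?thesis using bspec[OF f a(1)] by (simp only: tail_apr head_apr a(2))
    qed
    have x: "f x = f (src b)" if "b \<in> entering" for b
    proof -
      have "b \<in> X - P" using entering_D(1,3)[OF that] by simp
      from f'[OF this] show ?thesis
        using entering_D(7,10)[OF that] by (simp add: rin_entering[OF that] rout_entering[OF that])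
    qed
    have fs: "f (src' c) = f (src c)" for c
      by (cases rule: swap_along_cases[where a = c and f = nx and B = entering])
        (auto simp: rout_entering rout_nx rout_other entering_D x)
    have ft: "f (tgt' c) = f (tgt c)" for c
      by (cases rule: swap_along_cases[where a = c and f = mate and B = entering])
        (auto simp: rin_entering rin_mate rin_other entering_D x)
    have const: "\<forall>a\<in>arcs Q. f (tail Q a) = f (head Q a)"
    proof
      fix a assume a: "a \<in> arcs Q"
      show "f (tail Q a) = f (head Q a)"
        using f'[OF \<iota>_in[OF a]] by (simp only: fs ft tail_Q[OF a] head_Q[OF a])
    qed
    from assms have "\<forall>f :: 'v \<Rightarrow> bool. (\<forall>a\<in>arcs Q. f (tail Q a) = f (head Q a)) \<longrightarrow>
        (\<forall>u\<in>verts Q. \<forall>v\<in>verts Q. f u = f v)"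
      unfolding connected_iff_constant[OF wf(1)] by (rule conjunct2)
    from spec[OF this, of f] const have "\<forall>u\<in>verts Q. \<forall>v\<in>verts Q. f u = f v" by (rule mp)
    from bspec[OF bspec[OF this uv(1)] uv(2)] show ?thesis .
  qed
  moreover have "verts Q \<noteq> {}" using x_in_Q by blast
  ultimately show ?thesis
    unfolding connected_iff_constant[OF wf(2)] apr_quiver_sel by (intro conjI allI impI ballI)
qed

lemma apr_step_reflection:
  assumes "connected Q" "arcs Q \<noteq> {}"
  shows "apr_step (Q, I) (apr_reflection Q I x)"
  by (intro apr_step.intros gentle_Q assms x_in_Q apr_r1_x apr_r2_x)

end

section \<open>Repetitions of thread systems\<close>

text \<open>
  Copy \<open>i\<close> of an element \<open>a\<close> is \<open>(a, i)\<close>. An arrow ends in its own copy and a link in the next one,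
  whose number is \<open>landing\<close>. The links of copy \<open>k\<close> lead back to copy \<open>1\<close>; they are the links of the
  repetition, while all other links become arrows. The systems repeated may differ from copy to copy,
  which describes the stages where only some of the copies have been reflected. The target and the
  successor of an element are those of the system in the copy where it ends.
\<close>

definition landing :: "nat \<Rightarrow> 'c set \<Rightarrow> 'c \<times> nat \<Rightarrow> nat" where
  "landing k P z = (if fst z \<in> P then if snd z = k then 1 else Suc (snd z) else snd z)"

definition copy_src :: "(nat \<Rightarrow> 'c \<Rightarrow> 'v) \<Rightarrow> 'c \<times> nat \<Rightarrow> 'v \<times> nat" where
  "copy_src src z = (src (snd z) (fst z), snd z)"

definition copy_along :: "nat \<Rightarrow> 'c set \<Rightarrow> (nat \<Rightarrow> 'c \<Rightarrow> 'd) \<Rightarrow> 'c \<times> nat \<Rightarrow> 'd \<times> nat" where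
  "copy_along k P f z = (f (landing k P z) (fst z), landing k P z)"

lemma landing_in: "k \<ge> 1 \<Longrightarrow> snd z \<in> {1..k} \<Longrightarrow> landing k P z \<in> {1..k}"
  by (auto simp: landing_def)

lemma landing_inj:
  assumes "landing k P z = landing k P w" "fst z = fst w" "snd z \<in> {1..k}" "snd w \<in> {1..k}"
  shows "z = w"
proof -
  have "snd z = snd w"
    using assms unfolding landing_def by (cases "fst w \<in> P"; cases "snd z = k"; cases "snd w = k") simp_all
  then show ?thesis using assms(2) by (simp add: prod_eq_iff)
qed

lemma landing_surj:
  assumes "j \<in> {1..k}"
  obtains i where "i \<in> {1..k}" "landing k P (a, i) = j"
proof (cases "a \<in> P")
  case True
  show ?thesis
  proof (cases "j = 1")
    case True
    then show ?thesis using that[of k] assms \<open>a \<in> P\<close> by (simp add: landing_def)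
  next
    case False
    then have "j - 1 \<in> {1..k}" "j - 1 \<noteq> k" "Suc (j - 1) = j" using assms by auto
    then show ?thesis using that[of "j - 1"] \<open>a \<in> P\<close> by (simp add: landing_def)
  qed
next
  case False
  then show ?thesis using that[of j] assms by (simp add: landing_def)
qed

text \<open>
  The rank of the repetition counts the copies first. Inside a copy, links are placed above all
  arrows, because a link is the last element of its thread in that copy.
\<close>

lemma copies_thread_system:
  fixes src tgt :: "nat \<Rightarrow> 'c \<Rightarrow> 'v" and nx :: "nat \<Rightarrow> 'c \<Rightarrow> 'c"
  assumes k: "k \<ge> 1"
    and sys: "\<And>i. i \<in> {1..k} \<Longrightarrow> thread_system V X P (src i) (tgt i) (nx i)"
  shows "thread_system (V \<times> {1..k}) (X \<times> {1..k}) (P \<times> {k})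
    (copy_src src) (copy_along k P tgt) (copy_along k P nx)"
proof -
  have one: "1 \<in> {1..k}" using k by simp
  note X = thread_system.finite_X[OF sys[OF one]] and P = thread_system.P_subset[OF sys[OF one]]
  note nx_in = thread_system.nx_in[OF sys] and tgt_in = thread_system.tgt_in[OF sys]
  have land: "landing k P z \<in> {1..k}" if "z \<in> X \<times> {1..k}" for z
    by (rule landing_in[OF k]) (use that in auto)
  show ?thesis
  proof
    show "finite (X \<times> {1..k})" using X by simp
    show "P \<times> {k} \<subseteq> X \<times> {1..k}" using P k by auto
    show "copy_along k P tgt z \<in> V \<times> {1..k}" if "z \<in> X \<times> {1..k}" for z
      using that land[OF that] tgt_in[OF land[OF that]] by (auto simp: copy_along_def)
    show "copy_along k P nx z \<in> X \<times> {1..k}" if "z \<in> X \<times> {1..k}" for z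
      using that land[OF that] nx_in[OF land[OF that]] by (auto simp: copy_along_def)
    show "copy_src src (copy_along k P nx z) = copy_along k P tgt z" if "z \<in> X \<times> {1..k}" for z
      using that thread_system.src_nx[OF sys[OF land[OF that]]]
      by (auto simp: copy_along_def copy_src_def)
    show "inj_on (copy_along k P nx) (X \<times> {1..k})"
    proof (rule inj_onI)
      fix z w assume zw: "z \<in> X \<times> {1..k}" "w \<in> X \<times> {1..k}" "copy_along k P nx z = copy_along k P nx w"
      then have l: "landing k P z = landing k P w" and n: "nx (landing k P z) (fst z) = nx (landing k P z) (fst w)"
        by (auto simp: copy_along_def)
      have "fst z = fst w"
        using thread_system.nx_eq[OF sys[OF land[OF zw(1)]]] n zw by auto
      then show "z = w" using landing_inj[OF l] zw by auto
    qed
    show "card {z \<in> X \<times> {1..k}. copy_along k P tgt z = w} = 2" if "w \<in> V \<times> {1..k}" for w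
    proof -
      obtain v j where w: "w = (v, j)" "v \<in> V" "j \<in> {1..k}" using \<open>w \<in> _\<close> by auto
      have "bij_betw fst {z \<in> X \<times> {1..k}. copy_along k P tgt z = w} {a \<in> X. tgt j a = v}"
      proof (rule bij_betwI')
        fix z z' assume "z \<in> {z \<in> X \<times> {1..k}. copy_along k P tgt z = w}"
          "z' \<in> {z \<in> X \<times> {1..k}. copy_along k P tgt z = w}"
        then have "landing k P z = landing k P z'" "snd z \<in> {1..k}" "snd z' \<in> {1..k}"
          by (auto simp: copy_along_def w)
        then show "(fst z = fst z') = (z = z')"
          using landing_inj[of k P z z'] by blast
      next
        fix z assume "z \<in> {z \<in> X \<times> {1..k}. copy_along k P tgt z = w}"
        then show "fst z \<in> {a \<in> X. tgt j a = v}" by (auto simp: copy_along_def w)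
      next
        fix a assume a: "a \<in> {a \<in> X. tgt j a = v}"
        obtain i where "i \<in> {1..k}" "landing k P (a, i) = j" using landing_surj[OF w(3)] .
        then show "\<exists>z\<in>{z \<in> X \<times> {1..k}. copy_along k P tgt z = w}. a = fst z"
          using a by (intro bexI[of _ "(a, i)"]) (auto simp: copy_along_def w)
      qed
      then show ?thesis
        using thread_system.tgt_fibre[OF sys[OF w(3)] w(2)] by (simp add: bij_betw_same_card)
    qed
    have "\<exists>rk. \<forall>i\<in>{1..k}. \<forall>a\<in>X - P. nx i a \<in> X - P \<longrightarrow> rk i a < (rk i (nx i a) :: nat)"
      by (rule bchoice) (use thread_system.ranked[OF sys] in blast)
    then obtain rk :: "nat \<Rightarrow> 'c \<Rightarrow> nat"
      where rk: "\<And>i a. i \<in> {1..k} \<Longrightarrow> a \<in> X - P \<Longrightarrow> nx i a \<in> X - P \<Longrightarrow> rk i a < rk i (nx i a)"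
      by blast
    have "finite ((\<lambda>z. rk (snd z) (fst z)) ` (X \<times> {1..k}))" using X by simp
    \<comment> \<open>\<open>K\<close> exceeds the ranks of all arrows in all copies\<close>
    then obtain K where K: "(\<lambda>z. rk (snd z) (fst z)) ` (X \<times> {1..k}) \<subseteq> {..<K}"
      using finite_nat_bounded by blast
    have rkK: "rk i a < K" if "a \<in> X" "i \<in> {1..k}" for a i
    proof -
      have "(a, i) \<in> X \<times> {1..k}" using that by simp
      then show ?thesis using K by fastforce
    qed
    define h where "h z = snd z * Suc K + (if fst z \<in> P then K else rk (snd z) (fst z))" for z
    have "h z < h (copy_along k P nx z)"
      if z: "z \<in> X \<times> {1..k} - P \<times> {k}" "copy_along k P nx z \<in> X \<times> {1..k} - P \<times> {k}" for z
    proof -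
      obtain a i where zi: "z = (a, i)" "a \<in> X" "i \<in> {1..k}" using z by auto
      show ?thesis
      proof (cases "a \<in> P")
        case True
        then have "landing k P z = Suc i" using z zi by (auto simp: landing_def)
        then show ?thesis using True by (simp add: h_def zi copy_along_def)
      next
        case False
        then have l: "landing k P z = i" by (simp add: landing_def zi)
        show ?thesis
        proof (cases "nx i a \<in> P")
          case True
          then show ?thesis using False l rkK[OF zi(2,3)] by (simp add: h_def zi copy_along_def)
        next
          case nxP: False
          have "rk i a < rk i (nx i a)" using rk[OF zi(3)] zi False nxP nx_in[OF zi(3)] by auto
          then show ?thesis using False nxP l by (simp add: h_def zi copy_along_def)
        qed
      qed
    qed
    then show "\<exists>rk :: 'c \<times> nat \<Rightarrow> nat. \<forall>z\<in>X \<times> {1..k} - P \<times> {k}.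
        copy_along k P nx z \<in> X \<times> {1..k} - P \<times> {k} \<longrightarrow> rk z < rk (copy_along k P nx z)"
      by (intro exI[of _ h] ballI impI)
  qed
qed

section \<open>Reflecting the copies one after the other\<close>

definition switch :: "nat \<Rightarrow> 'f \<Rightarrow> 'f \<Rightarrow> nat \<Rightarrow> 'f" where
  "switch m f g i = (if i \<le> m then g else f)"

context thread_reflection
begin

lemma mixed_thread_system:
  assumes "k \<ge> 1"
  shows "thread_system (V \<times> {1..k}) (X \<times> {1..k}) (P \<times> {k}) (copy_src (switch m src src'))
    (copy_along k P (switch m tgt tgt')) (copy_along k P (switch m nx nx'))"
  by (rule copies_thread_system[OF assms])
    (use reflected_thread_system thread_system_axioms in \<open>simp add: switch_def\<close>)

text \<open>
  An element that ends in copy \<open>m + 1\<close> of \<open>x\<close> is an arrow of this copy, as no link ends at \<open>x\<close>.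
\<close>

lemma mixed_into_x:
  assumes "z \<in> X \<times> {1..k}" "copy_along k P (switch m tgt tgt') z = (x, Suc m)"
  obtains b where "b \<in> entering" "z = (b, Suc m)"
proof -
  obtain a i where z: "z = (a, i)" "a \<in> X" using assms(1) by auto
  have l: "landing k P z = Suc m" and "tgt a = x"
    using assms(2) z by (auto simp: copy_along_def switch_def)
  then have "a \<in> entering" using z entering_I by blast
  moreover have "i = Suc m" using l entering_D(3)[OF \<open>a \<in> entering\<close>] by (simp add: z landing_def)
  ultimately show ?thesis using that z by blast
qed

lemma mixed_reflection:
  assumes k: "k \<ge> 1" and m: "m < k"
  shows "thread_reflection (V \<times> {1..k}) (X \<times> {1..k}) (P \<times> {k}) (copy_src (switch m src src'))
    (copy_along k P (switch m tgt tgt')) (copy_along k P (switch m nx nx'))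
    (x, Suc m) (map_prod mate id)"
proof (rule thread_reflection.intro[OF mixed_thread_system[OF k] thread_reflection_axioms.intro])
  show "(x, Suc m) \<in> V \<times> {1..k}" using x_in m by simp
next
  fix z assume "z \<in> X \<times> {1..k}" "copy_along k P (switch m tgt tgt') z = (x, Suc m)"
  then obtain b where b: "b \<in> entering" and z: "z = (b, Suc m)" by (rule mixed_into_x)
  have l: "landing k P z = Suc m" "landing k P (mate b, Suc m) = Suc m"
    using entering_D[OF b] by (simp_all add: landing_def z)
  show "z \<notin> P \<times> {k} \<and> copy_along k P (switch m nx nx') z \<notin> P \<times> {k} \<and>
      copy_src (switch m src src') z \<noteq> (x, Suc m)"
    using entering_D[OF b] l by (simp add: z copy_along_def copy_src_def switch_def)
  show "map_prod mate id z \<in> X \<times> {1..k} \<and> map_prod mate id z \<notin> P \<times> {k} \<and>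
      copy_along k P (switch m tgt tgt') (map_prod mate id z) = copy_src (switch m src src') z \<and>
      copy_along k P (switch m nx nx') (map_prod mate id z) \<noteq> z"
    using entering_D[OF b] l m by (simp add: z copy_along_def copy_src_def switch_def)
qed

text \<open>
  The two swaps for copy \<open>m + 1\<close> of \<open>x\<close> are the swaps of the given system, carried out in copy \<open>m + 1\<close>
  only. A link into this copy is not moved, but its successor is taken in the reflected system, just
  as it is in the repetition with one more copy reflected.
\<close>

lemma mixed_step:
  fixes Q :: "('v \<times> nat, 'a) pre_digraph" and I :: "('v \<times> nat, 'a, 'k::field) path_comb set"
  assumes k: "k \<ge> 1" and m: "m < k"
    and pres: "presents (V \<times> {1..k}) (X \<times> {1..k} - P \<times> {k}) (copy_src (switch m src src'))
      (copy_along k P (switch m tgt tgt')) (copy_along k P (switch m nx nx')) Q I \<iota>"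
    and conn: "connected Q" and ne: "arcs Q \<noteq> {}"
  obtains Q' I' where "apr_step (Q, I) (Q', I')" "connected Q'" "arcs Q' \<noteq> {}"
    "presents (V \<times> {1..k}) (X \<times> {1..k} - P \<times> {k}) (copy_src (switch (Suc m) src src'))
      (copy_along k P (switch (Suc m) tgt tgt')) (copy_along k P (switch (Suc m) nx nx')) Q' I' \<iota>"
proof -
  interpret M: thread_reflection "V \<times> {1..k}" "X \<times> {1..k}" "P \<times> {k}" "copy_src (switch m src src')"
    "copy_along k P (switch m tgt tgt')" "copy_along k P (switch m nx nx')" "(x, Suc m)" "map_prod mate id"
    by (rule mixed_reflection[OF k m])
  have R: "presented_reflection (V \<times> {1..k}) (X \<times> {1..k}) (P \<times> {k}) (copy_src (switch m src src'))
    (copy_along k P (switch m tgt tgt')) (copy_along k P (switch m nx nx')) (x, Suc m) (map_prod mate id) Q I \<iota>"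
    by (intro presented_reflection.intro presented.intro presented_axioms.intro
      M.thread_reflection_axioms M.thread_system_axioms pres)
  have land_entering: "landing k P (b, i) = i" if "b \<in> entering" for b i
    using entering_D(3)[OF that] by (simp add: landing_def)
  have M_entering: "M.entering = entering \<times> {Suc m}"
  proof (intro equalityI subsetI)
    fix z assume "z \<in> M.entering"
    then have "z \<in> X \<times> {1..k}" "copy_along k P (switch m tgt tgt') z = (x, Suc m)"
      unfolding M.entering_def by blast+
    then obtain b where "b \<in> entering" "z = (b, Suc m)" by (rule mixed_into_x)
    then show "z \<in> entering \<times> {Suc m}" by simp
  next
    fix z assume "z \<in> entering \<times> {Suc m}"
    then obtain b where "b \<in> entering" "z = (b, Suc m)" by auto
    then show "z \<in> M.entering"
      unfolding M.entering_def using entering_D(1,2) m by (simp add: copy_along_def land_entering switch_def)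
  qed
  have "M.rin = swap_along (map_prod mate id) (entering \<times> {Suc m})"
    unfolding M.rin_def M_entering ..
  moreover have "map_prod mate id ` (entering \<times> {Suc m}) \<inter> entering \<times> {Suc m} = {}"
    using M.mate_entering unfolding M_entering .
  ultimately have rin: "M.rin (a, i) = (if i = Suc m then (rin a, i) else (a, i))" for a i
    using swap_along_copy[OF inj_mate mate_entering, of "map_prod mate id" "Suc m" a i]
    by (simp add: rin_def[symmetric])
  have nx_copy: "copy_along k P (switch m nx nx') (b, Suc m) = (nx b, Suc m)" if "b \<in> entering" for b
    using that by (simp add: copy_along_def land_entering switch_def)
  have M_rout: "M.rout = swap_along (copy_along k P (switch m nx nx')) (entering \<times> {Suc m})"
    unfolding M.rout_def M_entering ..
  have "copy_along k P (switch m nx nx') ` (entering \<times> {Suc m}) \<inter> entering \<times> {Suc m} = {}"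
    using M.nx_entering unfolding M_entering .
  note swap = swap_along_copy[OF inj_nx_entering nx_entering this nx_copy]
  have "swap_along nx entering a = rout a" for a
    by (simp only: rout_def)
  then have rout: "M.rout (a, i) = (if i = Suc m then (rout a, i) else (a, i))" for a i
    using swap[of a i] by (simp only: M_rout)
  have land_P: "landing k P (a, i) = i" if "a \<notin> P" for a i
    using that by (simp add: landing_def)
  define ri where "ri = M.rin"
  define ro where "ro = M.rout"
  have ri: "ri (a, i) = (if i = Suc m then (rin a, i) else (a, i))"
    and ro: "ro (a, i) = (if i = Suc m then (rout a, i) else (a, i))" for a i
    unfolding ri_def ro_def by (rule rin, rule rout)
  have s: "copy_src (switch m src src') (ro z) = copy_src (switch (Suc m) src src') z" for z
    by (cases z) (auto simp: ro copy_src_def switch_def)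
  have tn: "copy_along k P (switch m tgt tgt') (ri z) = copy_along k P (switch (Suc m) tgt tgt') z \<and>
      ro (copy_along k P (switch m nx nx') (ri z)) = copy_along k P (switch (Suc m) nx nx') z"
    if "z \<in> X \<times> {1..k}" for z
  proof -
    obtain a i where z: "z = (a, i)" "a \<in> X" using \<open>z \<in> X \<times> {1..k}\<close> by auto
    show ?thesis
    proof (cases "a \<in> P")
      case True
      then show ?thesis
        by (auto simp: z ri ro rin_P copy_along_def switch_def)
    next
      case False
      then have "rin a \<notin> P" using rin_A[of a] z by blast
      then show ?thesis using False
        by (auto simp: z ri ro copy_along_def land_P switch_def)
    qed
  qed
  let ?Q' = "apr_quiver Q I (x, Suc m)"
  let ?I' = "rel_ideal ?Q' (apr_relations Q I (x, Suc m)) :: ('v \<times> nat, 'a, 'k) path_comb set"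
  show ?thesis
  proof (rule that[of ?Q' ?I'])
    show "apr_step (Q, I) (?Q', ?I')"
      using presented_reflection.apr_step_reflection[OF R conn ne] by (simp add: apr_reflection_def)
    show "connected ?Q'" by (rule presented_reflection.reflected_connected[OF R conn])
    show "arcs ?Q' \<noteq> {}" using ne by (simp add: apr_quiver_def)
    have "presents (V \<times> {1..k}) (X \<times> {1..k} - P \<times> {k}) M.src' M.tgt' M.nx' ?Q' ?I' \<iota> \<longleftrightarrow>
      presents (V \<times> {1..k}) (X \<times> {1..k} - P \<times> {k}) (copy_src (switch (Suc m) src src'))
      (copy_along k P (switch (Suc m) tgt tgt')) (copy_along k P (switch (Suc m) nx nx')) ?Q' ?I' \<iota>"
      by (rule presents_cong) (simp_all only: comp_apply ri_def[symmetric] ro_def[symmetric] s tn Diff_iff)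
    then show "presents (V \<times> {1..k}) (X \<times> {1..k} - P \<times> {k}) (copy_src (switch (Suc m) src src'))
      (copy_along k P (switch (Suc m) tgt tgt')) (copy_along k P (switch (Suc m) nx nx')) ?Q' ?I' \<iota>"
      using presented_reflection.reflected_presents[OF R] by blast
  qed
qed

lemma mixed_steps:
  fixes Q :: "('v \<times> nat, 'a) pre_digraph" and I :: "('v \<times> nat, 'a, 'k::field) path_comb set"
  assumes k: "k \<ge> 1" and m: "m \<le> k"
    and pres: "presents (V \<times> {1..k}) (X \<times> {1..k} - P \<times> {k}) (copy_src (\<lambda>_. src))
      (copy_along k P (\<lambda>_. tgt)) (copy_along k P (\<lambda>_. nx)) Q I \<iota>"
    and conn: "connected Q" and ne: "arcs Q \<noteq> {}"
  shows "\<exists>Q' I'. (apr_step ^^ m) (Q, I) (Q', I') \<and> connected Q' \<and> arcs Q' \<noteq> {} \<and>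
    presents (V \<times> {1..k}) (X \<times> {1..k} - P \<times> {k}) (copy_src (switch m src src'))
      (copy_along k P (switch m tgt tgt')) (copy_along k P (switch m nx nx')) Q' I' \<iota>"
  using m
proof (induction m)
  case 0
  have "landing k P z \<noteq> 0" if "z \<in> X \<times> {1..k} - P \<times> {k}" for z
    using landing_in[OF k, of z P] that by auto
  moreover have "snd z \<noteq> 0" if "z \<in> X \<times> {1..k} - P \<times> {k}" for z
    using that by auto
  ultimately have "presents (V \<times> {1..k}) (X \<times> {1..k} - P \<times> {k}) (copy_src (\<lambda>_. src))
      (copy_along k P (\<lambda>_. tgt)) (copy_along k P (\<lambda>_. nx)) Q I \<iota> \<longleftrightarrow>
    presents (V \<times> {1..k}) (X \<times> {1..k} - P \<times> {k}) (copy_src (switch 0 src src'))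
      (copy_along k P (switch 0 tgt tgt')) (copy_along k P (switch 0 nx nx')) Q I \<iota>"
    by (intro presents_cong) (simp_all only: copy_src_def copy_along_def switch_def le_zero_eq if_False)
  with pres have "presents (V \<times> {1..k}) (X \<times> {1..k} - P \<times> {k}) (copy_src (switch 0 src src'))
      (copy_along k P (switch 0 tgt tgt')) (copy_along k P (switch 0 nx nx')) Q I \<iota>"
    by (rule iffD1[rotated])
  then show ?case using conn ne by (intro exI[of _ Q] exI[of _ I] conjI relpowp_0_I)
next
  case (Suc m)
  obtain Q' I' where 1: "(apr_step ^^ m) (Q, I) (Q', I')" "connected Q'" "arcs Q' \<noteq> {}"
    and 2: "presents (V \<times> {1..k}) (X \<times> {1..k} - P \<times> {k}) (copy_src (switch m src src'))
      (copy_along k P (switch m tgt tgt')) (copy_along k P (switch m nx nx')) Q' I' \<iota>"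
    using Suc.IH[OF Suc_leD[OF Suc.prems]] by blast
  obtain Q'' I'' where 3: "apr_step (Q', I') (Q'', I'')" "connected Q''" "arcs Q'' \<noteq> {}"
    "presents (V \<times> {1..k}) (X \<times> {1..k} - P \<times> {k}) (copy_src (switch (Suc m) src src'))
      (copy_along k P (switch (Suc m) tgt tgt')) (copy_along k P (switch (Suc m) nx nx')) Q'' I'' \<iota>"
    using mixed_step[OF k Suc_le_lessD[OF Suc.prems] 2 1(2,3)] by blast
  have "(apr_step ^^ Suc m) (Q, I) (Q'', I'')" using 1(1) 3(1) by (rule relpowp_Suc_I)
  then show ?case
    by (intro exI[of _ Q''] exI[of _ I''] conjI 3(2-4))
qed

lemma all_steps:
  fixes Q :: "('v \<times> nat, 'a) pre_digraph" and I :: "('v \<times> nat, 'a, 'k::field) path_comb set"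
  assumes k: "k \<ge> 1"
    and pres: "presents (V \<times> {1..k}) (X \<times> {1..k} - P \<times> {k}) (copy_src (\<lambda>_. src))
      (copy_along k P (\<lambda>_. tgt)) (copy_along k P (\<lambda>_. nx)) Q I \<iota>"
    and conn: "connected Q" and ne: "arcs Q \<noteq> {}"
  obtains Q' I' where "(apr_step ^^ k) (Q, I) (Q', I')"
    "presents (V \<times> {1..k}) (X \<times> {1..k} - P \<times> {k}) (copy_src (\<lambda>_. src'))
      (copy_along k P (\<lambda>_. tgt')) (copy_along k P (\<lambda>_. nx')) Q' I' \<iota>"
proof -
  obtain Q' I' where 1: "(apr_step ^^ k) (Q, I) (Q', I')"
    and 2: "presents (V \<times> {1..k}) (X \<times> {1..k} - P \<times> {k}) (copy_src (switch k src src'))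
      (copy_along k P (switch k tgt tgt')) (copy_along k P (switch k nx nx')) Q' I' \<iota>"
    using mixed_steps[OF k order_refl pres conn ne] by blast
  have "landing k P z \<le> k" if "z \<in> X \<times> {1..k} - P \<times> {k}" for z
    using landing_in[OF k, of z P] that by auto
  moreover have "snd z \<le> k" if "z \<in> X \<times> {1..k} - P \<times> {k}" for z
    using that by auto
  ultimately have "presents (V \<times> {1..k}) (X \<times> {1..k} - P \<times> {k}) (copy_src (switch k src src'))
      (copy_along k P (switch k tgt tgt')) (copy_along k P (switch k nx nx')) Q' I' \<iota> \<longleftrightarrow>
    presents (V \<times> {1..k}) (X \<times> {1..k} - P \<times> {k}) (copy_src (\<lambda>_. src'))
      (copy_along k P (\<lambda>_. tgt')) (copy_along k P (\<lambda>_. nx')) Q' I' \<iota>"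
    by (intro presents_cong) (simp_all only: copy_src_def copy_along_def switch_def if_True)
  with 2 have "presents (V \<times> {1..k}) (X \<times> {1..k} - P \<times> {k}) (copy_src (\<lambda>_. src'))
      (copy_along k P (\<lambda>_. tgt')) (copy_along k P (\<lambda>_. nx')) Q' I' \<iota>"
    by (rule iffD1[rotated])
  from that[OF 1 this] show ?thesis .
qed

end

section \<open>Thread systems with the same arrows\<close>

text \<open>
  Among the two elements that end at \<open>v\<close>, count the arrows, the links followed by an arrow, and the
  links followed by a link. The first two numbers depend only on the arrows and on which arrows follow
  each other: the arrows that start at \<open>v\<close> but do not follow an arrow are those that follow a link. So
  the third number is also determined by the arrows.
\<close>

lemma (in thread_system) card_loose:
  assumes v: "v \<in> V"
  shows "card {a \<in> X - P. tgt a = v}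
      + card ({a \<in> X - P. src a = v} - nx ` {a \<in> X - P. tgt a = v})
      + card {p \<in> P. tgt p = v \<and> nx p \<in> P} = 2"
proof -
  let ?A = "{a \<in> X - P. tgt a = v}"
  let ?M = "{p \<in> P. tgt p = v \<and> nx p \<in> X - P}"
  let ?L = "{p \<in> P. tgt p = v \<and> nx p \<in> P}"
  have P_X: "p \<in> X" if "p \<in> P" for p using P_subset that by blast
  have F: "{a \<in> X. tgt a = v} = ?A \<union> (?M \<union> ?L)"
    using P_X nx_in by blast
  have fin: "finite ?A" "finite ?M" "finite ?L"
    using finite_X finite_subset[OF P_subset finite_X] by auto
  have "card {a \<in> X. tgt a = v} = card ?A + card (?M \<union> ?L)"
    unfolding F using fin by (intro card_Un_disjoint) auto
  also have "card (?M \<union> ?L) = card ?M + card ?L"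
    using fin by (intro card_Un_disjoint) auto
  also have "card ?M = card (nx ` ?M)"
    using nx_inj P_X by (intro card_image[symmetric]) (auto intro: inj_on_subset)
  also have "nx ` ?M = {a \<in> X - P. src a = v} - nx ` ?A"
  proof (intro equalityI subsetI)
    fix b assume "b \<in> nx ` ?M"
    then obtain p where p: "p \<in> P" "tgt p = v" "nx p \<in> X - P" "b = nx p" by auto
    have "nx p \<noteq> nx a" if "a \<in> ?A" for a
      using that p P_X nx_eq[of p a] by auto
    then show "b \<in> {a \<in> X - P. src a = v} - nx ` ?A"
      using p P_X src_nx by auto
  next
    fix b assume b: "b \<in> {a \<in> X - P. src a = v} - nx ` ?A"
    then obtain a where a: "a \<in> X" "nx a = b" "tgt a = src b" using pred_ex[of b] by blast
    then have "a \<in> P" using b by auto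
    then show "b \<in> nx ` ?M" using a b by auto
  qed
  finally show ?thesis using tgt_fibre[OF v] by simp
qed

text \<open>
  Two thread systems that share their arrows and in which each thread has one link. They differ by a
  renaming of links, because a link is determined by the arrow after it or, if its thread has no
  arrow, by its vertex. The last assumption rules out a vertex without arrows, at which there would be
  two indistinguishable threads of the latter kind.
\<close>

locale thread_comparison = S1: thread_system V X P src1 tgt1 nx1 + S2: thread_system V X P src2 tgt2 nx2
  for V :: "'v set" and X P :: "'c set" and src1 tgt1 src2 tgt2 :: "'c \<Rightarrow> 'v" and nx1 nx2 :: "'c \<Rightarrow> 'c" +
  assumes src_same: "a \<in> X - P \<Longrightarrow> src1 a = src2 a" and tgt_same: "a \<in> X - P \<Longrightarrow> tgt1 a = tgt2 a"
    and nx_same: "a \<in> X - P \<Longrightarrow> b \<in> X - P \<Longrightarrow> nx1 a = b \<longleftrightarrow> nx2 a = b"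
    and close1: "threads_close X P nx1" and close2: "threads_close X P nx2"
    and touched: "v \<in> V \<Longrightarrow> \<exists>a\<in>X - P. tgt1 a = v \<or> src1 a = v"
begin

lemma P_X: "p \<in> P \<Longrightarrow> p \<in> X"
  using S1.P_subset by blast

lemma nx1_same: "a \<in> X - P \<Longrightarrow> nx1 a \<in> X - P \<Longrightarrow> nx2 a = nx1 a"
  using nx_same[of a "nx1 a"] by simp

lemma nx2_same: "a \<in> X - P \<Longrightarrow> nx2 a \<in> X - P \<Longrightarrow> nx1 a = nx2 a"
  using nx_same[of a "nx2 a"] by simp

lemma nx1_link:
  assumes "a \<in> X - P" "nx1 a \<in> P"
  shows "nx2 a \<in> P"
proof (rule ccontr)
  assume "nx2 a \<notin> P"
  then have "nx1 a = nx2 a" using nx2_same[OF assms(1)] S2.nx_in[of a] assms(1) by simp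
  then show False using assms(2) \<open>nx2 a \<notin> P\<close> by simp
qed

text \<open>
  If a link is followed by an arrow, the matching link is found before the same arrow. If it is not,
  then \<open>card_loose\<close> provides a link at the same vertex that is not followed by an arrow either.
\<close>

lemma matching_link:
  assumes p: "p \<in> P"
  shows "\<exists>q\<in>P. tgt2 q = tgt1 p \<and> (nx1 p \<in> X - P \<longrightarrow> nx2 q = nx1 p) \<and> (nx1 p \<in> P \<longrightarrow> nx2 q \<in> P)"
proof (cases "nx1 p \<in> P")
  case False
  then have n: "nx1 p \<in> X - P" using S1.nx_in P_X p by blast
  then obtain q where q: "q \<in> X" "nx2 q = nx1 p" "tgt2 q = src2 (nx1 p)"
    using S2.pred_ex by (metis DiffD1)
  have "q \<in> P"
  proof (rule ccontr)
    assume "q \<notin> P"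
    then have "nx1 q = nx1 p" using nx2_same[of q] q n by auto
    then have "q = p" using S1.nx_eq q P_X p by blast
    then show False using \<open>q \<notin> P\<close> p by blast
  qed
  moreover have "tgt2 q = tgt1 p" using q src_same[OF n] S1.src_nx P_X p by auto
  ultimately show ?thesis using q False by blast
next
  case True
  let ?v = "tgt1 p"
  let ?L1 = "{p \<in> P. tgt1 p = ?v \<and> nx1 p \<in> P}" and ?L2 = "{p \<in> P. tgt2 p = ?v \<and> nx2 p \<in> P}"
  have v: "?v \<in> V" using S1.tgt_in P_X p by blast
  have A: "{a \<in> X - P. tgt1 a = ?v} = {a \<in> X - P. tgt2 a = ?v}"
    using tgt_same by auto
  have M: "{a \<in> X - P. src1 a = ?v} - nx1 ` {a \<in> X - P. tgt1 a = ?v}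
      = {a \<in> X - P. src2 a = ?v} - nx2 ` {a \<in> X - P. tgt2 a = ?v}"
  proof -
    have "{a \<in> X - P. src1 a = ?v} = {a \<in> X - P. src2 a = ?v}" using src_same by auto
    moreover have "b \<in> nx1 ` {a \<in> X - P. tgt1 a = ?v} \<longleftrightarrow> b \<in> nx2 ` {a \<in> X - P. tgt2 a = ?v}"
      if b: "b \<in> X - P" for b
    proof -
      have "(\<exists>a\<in>{a \<in> X - P. tgt1 a = ?v}. nx1 a = b) \<longleftrightarrow> (\<exists>a\<in>{a \<in> X - P. tgt1 a = ?v}. nx2 a = b)"
        using nx_same[OF _ b] by (intro bex_cong) auto
      then show ?thesis unfolding A[symmetric] by (simp only: image_iff eq_commute[of b])
    qed
    ultimately show ?thesis by blast
  qed
  have "card ?L1 = card ?L2"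
    using S1.card_loose[OF v] S2.card_loose[OF v] unfolding M unfolding A by linarith
  moreover have "p \<in> ?L1" using p True by simp
  moreover have "finite ?L1" using finite_subset[OF S1.P_subset S1.finite_X] by simp
  ultimately have "?L2 \<noteq> {}" by (metis card.empty card_0_eq empty_iff)
  then show ?thesis using True by blast
qed

text \<open>
  Two such links would be the only elements that end at their vertex and would be followed by the only
  elements that start there, so the vertex would touch no arrow.
\<close>

lemma loose_unique:
  assumes "p \<in> P" "q \<in> P" "tgt1 p = tgt1 q" "nx1 p \<in> P" "nx1 q \<in> P"
  shows "p = q"
proof (rule ccontr)
  assume ne: "p \<noteq> q"
  have v: "tgt1 p \<in> V" using S1.tgt_in P_X assms by blast
  then obtain a where a: "a \<in> X - P" "tgt1 a = tgt1 p \<or> src1 a = tgt1 p" using touched by blast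
  from a(2) show False
  proof
    assume "tgt1 a = tgt1 p"
    then have "a = p \<or> a = q"
      using assms a(1) ne by (intro S1.tgt_twin) (simp_all add: P_X)
    then show False using a(1) assms(1,2) by auto
  next
    assume s: "src1 a = tgt1 p"
    obtain c where c: "c \<in> X" "nx1 c = a" "tgt1 c = src1 a" using S1.pred_ex[of a] a(1) by auto
    then have "c = p \<or> c = q"
      using assms s ne by (intro S1.tgt_twin) (simp_all add: P_X)
    then show False using a(1) c(2) assms(4,5) by auto
  qed
qed

definition relabel :: "'c \<Rightarrow> 'c" where
  "relabel a = (if a \<in> P then SOME q. q \<in> P \<and> tgt2 q = tgt1 a \<and>
    (nx1 a \<in> X - P \<longrightarrow> nx2 q = nx1 a) \<and> (nx1 a \<in> P \<longrightarrow> nx2 q \<in> P) else a)"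

lemma relabel_arrow: "a \<in> X - P \<Longrightarrow> relabel a = a"
  by (simp add: relabel_def)

lemma relabel_link:
  assumes p: "p \<in> P"
  shows "relabel p \<in> P" "tgt2 (relabel p) = tgt1 p" "nx1 p \<in> X - P \<Longrightarrow> nx2 (relabel p) = nx1 p"
    "nx1 p \<in> P \<Longrightarrow> nx2 (relabel p) \<in> P"
proof -
  have "\<exists>q. q \<in> P \<and> tgt2 q = tgt1 p \<and> (nx1 p \<in> X - P \<longrightarrow> nx2 q = nx1 p) \<and> (nx1 p \<in> P \<longrightarrow> nx2 q \<in> P)"
    using matching_link[OF p] by blast
  from someI_ex[OF this] show "relabel p \<in> P" "tgt2 (relabel p) = tgt1 p"
    "nx1 p \<in> X - P \<Longrightarrow> nx2 (relabel p) = nx1 p" "nx1 p \<in> P \<Longrightarrow> nx2 (relabel p) \<in> P"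
    using p by (simp_all add: relabel_def)
qed

lemma relabel_P: "relabel a \<in> P \<longleftrightarrow> a \<in> P"
proof (cases "a \<in> P")
  case True
  then show ?thesis using relabel_link(1) by simp
next
  case False
  then show ?thesis by (simp add: relabel_def)
qed

lemma relabel_X: "a \<in> X \<Longrightarrow> relabel a \<in> X"
proof (cases "a \<in> P")
  case True
  then show ?thesis using P_X[OF relabel_link(1)] by simp
next
  case False
  then show "a \<in> X \<Longrightarrow> ?thesis" by (simp add: relabel_def)
qed

lemma relabel_inj: "inj_on relabel X"
proof (rule inj_onI)
  fix a b assume ab: "a \<in> X" "b \<in> X" "relabel a = relabel b"
  show "a = b"
  proof (cases "a \<in> P")
    case False
    then have "b \<notin> P" using relabel_P ab by metis
    then show ?thesis using False ab by (simp add: relabel_def)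
  next
    case a: True
    then have b: "b \<in> P" using relabel_P ab by metis
    have t: "tgt1 a = tgt1 b" using relabel_link(2) a b ab(3) by metis
    have X: "nx1 a \<in> X" "nx1 b \<in> X" using S1.nx_in ab by auto
    show ?thesis
    proof (cases "nx1 a \<in> P")
      case True
      then have "nx2 (relabel b) \<in> P" using relabel_link(4)[OF a] ab(3) by simp
      then have "nx1 b \<in> P" using relabel_link(3)[OF b] X(2) by (metis DiffI)
      then show ?thesis using loose_unique a b t True by blast
    next
      case False
      then have n: "nx2 (relabel b) = nx1 a" using relabel_link(3)[OF a] ab(3) X by simp
      then have "nx1 b \<notin> P" using relabel_link(4)[OF b] False by auto
      then have "nx1 b = nx1 a" using relabel_link(3)[OF b] X n by simp
      then show ?thesis using S1.nx_eq ab by metis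
    qed
  qed
qed

lemma relabel_bij: "bij_betw relabel X X"
  using relabel_inj relabel_X S1.finite_X by (simp add: bij_betw_def endo_inj_surj image_subsetI)

lemma relabel_tgt: "a \<in> X \<Longrightarrow> tgt2 (relabel a) = tgt1 a"
  using relabel_link(2) tgt_same relabel_arrow by (cases "a \<in> P") simp_all

text \<open>
  The renaming respects the beginnings of the threads by construction. That it respects their ends
  needs the links to close the threads: following a thread from its first arrow shows that corresponding
  arrows have corresponding links, and the link at the end is the link at the beginning.
\<close>

lemma relabel_nx:
  assumes a: "a \<in> X"
  shows "relabel (nx1 a) = nx2 (relabel a)"
proof -
  obtain th1 where th1: "\<And>a. a \<in> X \<Longrightarrow> th1 (nx1 a) = th1 a" "\<And>p. p \<in> P \<Longrightarrow> th1 p = p"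
    using close1 by (auto simp: threads_close_def)
  obtain th2 where th2: "\<And>a. a \<in> X \<Longrightarrow> th2 (nx2 a) = th2 a" "\<And>p. p \<in> P \<Longrightarrow> th2 p = p"
    using close2 by (auto simp: threads_close_def)
  obtain rk :: "'c \<Rightarrow> nat" where rk: "\<And>a. a \<in> X - P \<Longrightarrow> nx1 a \<in> X - P \<Longrightarrow> rk a < rk (nx1 a)"
    using S1.ranked by blast
  \<comment> \<open>induction along the thread, starting from the first arrow after a link\<close>
  have th: "th2 a = relabel (th1 a)" if "a \<in> X - P" for a
    using that
  proof (induction "rk a" arbitrary: a rule: less_induct)
    case less
    obtain c where c: "c \<in> X" "nx1 c = a" using S1.pred_ex less.prems by blast
    show ?case
    proof (cases "c \<in> P")
      case True
      then have "nx2 (relabel c) = a" using relabel_link(3) c less.prems by blast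
      then have "th2 a = relabel c"
        using th2 relabel_link(1)[OF True] P_X by metis
      then show ?thesis using th1(1)[OF c(1)] th1(2)[OF True] c by simp
    next
      case False
      then have "rk c < rk a" using rk[of c] c less.prems by auto
      then have IH: "th2 c = relabel (th1 c)" using less.hyps False c by blast
      have "nx2 c = a" using nx1_same[of c] False c less.prems by blast
      then have "th2 a = th2 c" using th2(1) c by blast
      then show ?thesis using IH th1(1)[OF c(1)] c by simp
    qed
  qed
  have nX: "nx1 a \<in> X" using S1.nx_in a by blast
  show ?thesis
  proof (cases "a \<in> P")
    case aP: True
    show ?thesis
    proof (cases "nx1 a \<in> P")
      case True
      then have "nx1 a = a" using th1(1)[OF a] th1(2)[OF True] th1(2)[OF aP] by simp
      moreover have "nx2 (relabel a) \<in> P" using relabel_link(4)[OF aP True] .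
      then have "nx2 (relabel a) = relabel a"
        using th2(1)[OF relabel_X[OF a]] th2(2) relabel_link(1)[OF aP] by simp
      ultimately show ?thesis by simp
    next
      case False
      then show ?thesis using relabel_link(3)[OF aP] nX relabel_arrow by simp
    qed
  next
    case aA: False
    then have aA': "a \<in> X - P" using a by simp
    show ?thesis
    proof (cases "nx1 a \<in> P")
      case True
      then have "nx2 a \<in> P" using nx1_link[OF aA'] by blast
      then have "nx2 a = th2 a" using th2 a by metis
      also have "\<dots> = relabel (nx1 a)" using th[OF aA'] th1(1)[OF a] th1(2)[OF True] by simp
      finally show ?thesis using relabel_arrow[OF aA'] by simp
    next
      case False
      then show ?thesis using nx1_same[OF aA'] relabel_arrow[OF aA'] relabel_arrow[of "nx1 a"] nX by simp
    qed
  qed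
qed

lemma relabel_src: "a \<in> X \<Longrightarrow> src2 (relabel a) = src1 a"
proof -
  assume "a \<in> X"
  then obtain c where c: "c \<in> X" "nx1 c = a" "tgt1 c = src1 a" by (rule S1.pred_ex)
  then show ?thesis
    using relabel_nx[OF c(1)] S2.src_nx[OF relabel_X[OF c(1)]] relabel_tgt[OF c(1)] by simp
qed

end

section \<open>Isomorphisms of presented quivers\<close>

lemma has_factor_map:
  assumes "\<And>a b. a \<in> A \<Longrightarrow> b \<in> A \<Longrightarrow> (g a, g b) \<in> R' \<longleftrightarrow> (a, b) \<in> R" "set w \<subseteq> A"
  shows "has_factor R' (map g w) \<longleftrightarrow> has_factor R w"
  using assms(2)
proof (induction w)
  case (Cons a w)
  then show ?case using assms(1)[of a "hd w"]
    by (cases w) (simp_all add: has_factor_Cons)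
qed simp

text \<open>
  A bijection between the arrows that respects sources, targets and successors identifies the paths
  and the relations, and therefore the ideals, which are determined by the paths they contain.
\<close>

lemma presents_iso:
  fixes Q1 :: "('v, 'a) pre_digraph" and I1 :: "('v, 'a, 'k::field) path_comb set"
    and Q2 :: "('v, 'b) pre_digraph" and I2 :: "('v, 'b, 'k::field) path_comb set"
  assumes 1: "presented V X1 P1 src1 tgt1 nx1 Q1 I1 \<iota>1" and 2: "presented V X2 P2 src2 tgt2 nx2 Q2 I2 \<iota>2"
    and bij: "bij_betw \<phi> (X1 - P1) (X2 - P2)"
    and src: "\<And>a. a \<in> X1 - P1 \<Longrightarrow> src2 (\<phi> a) = src1 a"
    and tgt: "\<And>a. a \<in> X1 - P1 \<Longrightarrow> tgt2 (\<phi> a) = tgt1 a"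
    and nx: "\<And>a b. a \<in> X1 - P1 \<Longrightarrow> b \<in> X1 - P1 \<Longrightarrow> nx2 (\<phi> a) = \<phi> b \<longleftrightarrow> nx1 a = b"
  shows "bound_quiver_iso (Q1, I1) (Q2, I2)"
proof -
  interpret S1: presented V X1 P1 src1 tgt1 nx1 Q1 I1 \<iota>1 by (rule 1)
  interpret S2: presented V X2 P2 src2 tgt2 nx2 Q2 I2 \<iota>2 by (rule 2)
  interpret Q1: fin_digraph Q1 by (rule S1.fin_digraph_Q)
  interpret Q2: fin_digraph Q2 by (rule S2.fin_digraph_Q)
  define g where "g = the_inv_into (arcs Q2) \<iota>2 \<circ> (\<phi> \<circ> \<iota>1)"
  have gbij: "bij_betw g (arcs Q1) (arcs Q2)"
    unfolding g_def using S1.\<iota>_bij bij S2.\<iota>_bij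
    by (intro bij_betw_trans[OF _ bij_betw_the_inv_into]) (auto intro: bij_betw_trans)
  have g_in: "g a \<in> arcs Q2" if "a \<in> arcs Q1" for a
    using bij_betw_apply[OF gbij that] .
  have g: "\<iota>2 (g a) = \<phi> (\<iota>1 a)" if "a \<in> arcs Q1" for a
  proof -
    have "\<phi> (\<iota>1 a) \<in> \<iota>2 ` arcs Q2"
      using bij_betw_apply[OF bij S1.\<iota>_in[OF that]] S2.\<iota>_bij by (simp add: bij_betw_def)
    then show ?thesis
      using S2.\<iota>_bij by (simp add: g_def bij_betw_def f_the_inv_into_f)
  qed
  have tail: "tail Q2 (g a) = tail Q1 a" and head: "head Q2 (g a) = head Q1 a" if "a \<in> arcs Q1" for a
    using src[OF S1.\<iota>_in[OF that]] tgt[OF S1.\<iota>_in[OF that]]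
    by (simp_all only: S1.tail_Q[OF that] S1.head_Q[OF that] S2.tail_Q[OF g_in[OF that]]
      S2.head_Q[OF g_in[OF that]] g[OF that])
  let ?R1 = "{(a, b). composable Q1 a b \<and> nx1 (\<iota>1 a) \<noteq> \<iota>1 b}"
  let ?R2 = "{(a, b). composable Q2 a b \<and> nx2 (\<iota>2 a) \<noteq> \<iota>2 b}"
  have R: "(g a, g b) \<in> ?R2 \<longleftrightarrow> (a, b) \<in> ?R1" if "a \<in> arcs Q1" "b \<in> arcs Q1" for a b
    using that nx[OF S1.\<iota>_in[OF that(1)] S1.\<iota>_in[OF that(2)]]
    by (simp add: composable_def tail head g_in g)
  have cas: "Q2.cas u (map g w) v \<longleftrightarrow> Q1.cas u w v" if "set w \<subseteq> arcs Q1" for u w v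
    using that by (induction w arbitrary: u) (simp_all add: tail head)
  have verts: "verts Q1 = verts Q2" by (simp add: S1.verts_Q S2.verts_Q)
  define H where "H p = (fst p, map g (snd p))" for p :: "'v \<times> 'a list"
  let ?K1 = "{p \<in> paths Q1. has_factor ?R1 (snd p)}" and ?K2 = "{p \<in> paths Q2. has_factor ?R2 (snd p)}"
  have HK: "H p \<in> ?K2 \<longleftrightarrow> p \<in> ?K1" if "set (snd p) \<subseteq> arcs Q1" for p
  proof -
    have "set (map g (snd p)) \<subseteq> arcs Q2" using that g_in by auto
    then have "H p \<in> paths Q2 \<longleftrightarrow> p \<in> paths Q1"
      using that by (auto simp: H_def paths_def Q1.awalk_def Q2.awalk_def cas verts)
    moreover have "has_factor ?R2 (map g (snd p)) \<longleftrightarrow> has_factor ?R1 (snd p)"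
      by (rule has_factor_map[OF R that])
    ultimately show ?thesis by (simp add: H_def)
  qed
  have arcs1: "set (snd p) \<subseteq> arcs Q1" if "p \<in> ?K1" for p
    using that by (auto simp: paths_def Q1.awalk_def)
  have arcs2: "set (snd p) \<subseteq> arcs Q2" if "p \<in> ?K2" for p
    using that by (auto simp: paths_def Q2.awalk_def)
  have image: "H ` ?K1 = ?K2"
  proof (intro equalityI subsetI)
    fix q assume "q \<in> H ` ?K1"
    then show "q \<in> ?K2" using HK arcs1 by blast
  next
    fix q assume q: "q \<in> ?K2"
    let ?i = "the_inv_into (arcs Q1) g"
    have i: "?i b \<in> arcs Q1 \<and> g (?i b) = b" if "b \<in> arcs Q2" for b
      using that gbij the_inv_into_into[of g "arcs Q1" b "arcs Q1"] f_the_inv_into_f[of g "arcs Q1" b]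
      by (simp add: bij_betw_def)
    have "map g (map ?i (snd q)) = snd q" using arcs2[OF q] i by (auto simp: map_idI subset_iff)
    then have Hq: "H (fst q, map ?i (snd q)) = q" by (simp add: H_def)
    have "set (snd (fst q, map ?i (snd q))) \<subseteq> arcs Q1" using arcs2[OF q] i by auto
    from HK[OF this] q have "(fst q, map ?i (snd q)) \<in> ?K1" unfolding Hq by (rule iffD1)
    with Hq[symmetric] show "q \<in> H ` ?K1" by (rule image_eqI)
  qed
  define h where "h = \<lparr>iso_verts = id, iso_arcs = g, iso_head = head Q2, iso_tail = tail Q2\<rparr>"
  have sel: "iso_verts h = id" "iso_arcs h = g" "iso_head h = head Q2" "iso_tail h = tail Q2"
    by (simp_all add: h_def)
  have iso: "Q1.digraph_isomorphism h"
    unfolding Q1.digraph_isomorphism_def sel using gbij Q1.wf_digraph_axioms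
    by (simp add: bij_betw_def tail head)
  have app: "Q2 = app_iso h Q1"
    using gbij by (simp add: app_iso_def sel verts bij_betw_def)
  have inj: "inj_on H ?K1"
  proof (rule inj_onI)
    fix p q assume pq: "p \<in> ?K1" "q \<in> ?K1" "H p = H q"
    have "inj_on g (set (snd p) \<union> set (snd q))"
      using gbij arcs1[OF pq(1)] arcs1[OF pq(2)] by (auto simp: bij_betw_def intro: inj_on_subset)
    then show "p = q" using pq(3) by (auto simp: H_def prod_eq_iff map_inj_on)
  qed
  have "H = (\<lambda>p. (iso_verts h (fst p), map (iso_arcs h) (snd p)))"
    by (simp add: H_def sel fun_eq_iff)
  then have "path_algebra_map h ` {f. Poly_Mapping.keys f \<subseteq> ?K1} =
      {f :: ('v, 'b, 'k) path_comb. Poly_Mapping.keys f \<subseteq> H ` ?K1}"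
    using path_algebra_map_keys[of h ?K1] inj by simp
  then have "I2 = path_algebra_map h ` I1"
    unfolding image S1.I_eq S2.I_eq
    by (subst rel_ideal_eq[OF S1.fin_digraph_Q], blast, subst rel_ideal_eq[OF S2.fin_digraph_Q], blast) simp
  then show ?thesis
    unfolding bound_quiver_iso_def using iso app by (intro exI[of _ h] conjI) simp_all
qed

lemma copies_iso:
  assumes k: "k \<ge> 1"
    and 1: "thread_system V X P src1 tgt1 nx1" and 2: "thread_system V X P src2 tgt2 nx2"
    and bij: "bij_betw \<phi> X X" and P: "\<And>a. a \<in> X \<Longrightarrow> \<phi> a \<in> P \<longleftrightarrow> a \<in> P"
    and src: "\<And>a. a \<in> X \<Longrightarrow> src2 (\<phi> a) = src1 a"
    and tgt: "\<And>a. a \<in> X \<Longrightarrow> tgt2 (\<phi> a) = tgt1 a"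
    and nx: "\<And>a. a \<in> X \<Longrightarrow> \<phi> (nx1 a) = nx2 (\<phi> a)"
    and pres1: "presents (V \<times> {1..k}) (X \<times> {1..k} - P \<times> {k}) (copy_src (\<lambda>_. src1))
      (copy_along k P (\<lambda>_. tgt1)) (copy_along k P (\<lambda>_. nx1)) Q1 (I1 :: (_, _, 'k::field) path_comb set) \<iota>1"
    and pres2: "presents (V \<times> {1..k}) (X \<times> {1..k} - P \<times> {k}) (copy_src (\<lambda>_. src2))
      (copy_along k P (\<lambda>_. tgt2)) (copy_along k P (\<lambda>_. nx2)) Q2 (I2 :: (_, _, 'k::field) path_comb set) \<iota>2"
  shows "bound_quiver_iso (Q1, I1) (Q2, I2)"
proof (rule presents_iso[where \<phi> = "map_prod \<phi> id"])
  show "presented (V \<times> {1..k}) (X \<times> {1..k}) (P \<times> {k}) (copy_src (\<lambda>_. src1))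
      (copy_along k P (\<lambda>_. tgt1)) (copy_along k P (\<lambda>_. nx1)) Q1 I1 \<iota>1"
    by (intro presented.intro copies_thread_system[OF k] 1 presented_axioms.intro pres1)
  show "presented (V \<times> {1..k}) (X \<times> {1..k}) (P \<times> {k}) (copy_src (\<lambda>_. src2))
      (copy_along k P (\<lambda>_. tgt2)) (copy_along k P (\<lambda>_. nx2)) Q2 I2 \<iota>2"
    by (intro presented.intro copies_thread_system[OF k] 2 presented_axioms.intro pres2)
  have \<phi>_in: "\<phi> a \<in> X" if "a \<in> X" for a using bij_betw_apply[OF bij that] .
  have \<phi>_eq: "\<phi> a = \<phi> b \<longleftrightarrow> a = b" if "a \<in> X" "b \<in> X" for a b
    using that bij by (auto simp: bij_betw_def dest: inj_onD)
  have land: "landing k P (\<phi> a, i) = landing k P (a, i)" if "a \<in> X" for a i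
    using P[OF that] by (simp add: landing_def)
  have nx1_in: "nx1 a \<in> X" if "a \<in> X" for a using thread_system.nx_in[OF 1 that] .
  show "bij_betw (map_prod \<phi> id) (X \<times> {1..k} - P \<times> {k}) (X \<times> {1..k} - P \<times> {k})"
    unfolding bij_betw_def
  proof (intro conjI equalityI subsetI)
    show "inj_on (map_prod \<phi> id) (X \<times> {1..k} - P \<times> {k})"
      using \<phi>_eq by (auto simp: inj_on_def)
    fix z assume "z \<in> map_prod \<phi> id ` (X \<times> {1..k} - P \<times> {k})"
    then show "z \<in> X \<times> {1..k} - P \<times> {k}" using \<phi>_in P by auto
  next
    fix z assume z: "z \<in> X \<times> {1..k} - P \<times> {k}"
    obtain b i where bi: "z = (b, i)" by (cases z)
    then obtain a where a: "a \<in> X" "b = \<phi> a" using z bij by (auto simp: bij_betw_def)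
    have "(a, i) \<in> X \<times> {1..k} - P \<times> {k}" using a z P bi by auto
    then show "z \<in> map_prod \<phi> id ` (X \<times> {1..k} - P \<times> {k})"
      using a bi by (intro image_eqI[of _ _ "(a, i)"]) simp_all
  qed
  fix z assume z: "z \<in> X \<times> {1..k} - P \<times> {k}"
  then obtain a i where zi: "z = (a, i)" "a \<in> X" by auto
  show "copy_src (\<lambda>_. src2) (map_prod \<phi> id z) = copy_src (\<lambda>_. src1) z"
    using zi src by (simp add: copy_src_def)
  show "copy_along k P (\<lambda>_. tgt2) (map_prod \<phi> id z) = copy_along k P (\<lambda>_. tgt1) z"
    using zi tgt land by (simp add: copy_along_def)
  fix w assume w: "w \<in> X \<times> {1..k} - P \<times> {k}"
  then obtain b j where wj: "w = (b, j)" "b \<in> X" by auto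
  show "(copy_along k P (\<lambda>_. nx2) (map_prod \<phi> id z) = map_prod \<phi> id w) =
      (copy_along k P (\<lambda>_. nx1) z = w)"
    using zi wj land by (simp add: copy_along_def nx[symmetric] \<phi>_eq nx1_in)
qed

context thread_system
begin

definition next_link :: "'c \<Rightarrow> 'c" where
  "next_link a = (nx ^^ (LEAST n. (nx ^^ n) a \<in> P)) a"

lemma next_link_link: "p \<in> P \<Longrightarrow> next_link p = p"
  unfolding next_link_def by (subst Least_eq_0) simp_all

text \<open>
  On a thread that never meets a link the rank would grow beyond its maximum.
\<close>

lemma reaches_link:
  assumes a: "a \<in> X"
  shows "\<exists>n. (nx ^^ n) a \<in> P"
proof (rule ccontr)
  assume no: "\<nexists>n. (nx ^^ n) a \<in> P"
  obtain rk :: "'c \<Rightarrow> nat" where rk: "\<And>a. a \<in> X - P \<Longrightarrow> nx a \<in> X - P \<Longrightarrow> rk a < rk (nx a)"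
    using ranked by blast
  have X: "(nx ^^ n) a \<in> X - P" for n
  proof (induction n)
    case 0
    have "(nx ^^ 0) a \<notin> P" using no by blast
    then show ?case using a by simp
  next
    case (Suc n)
    have "(nx ^^ Suc n) a \<notin> P" using no by blast
    then show ?case using Suc nx_in by simp
  qed
  have lower: "n \<le> rk ((nx ^^ n) a)" for n
  proof (induction n)
    case (Suc n)
    have "rk ((nx ^^ n) a) < rk ((nx ^^ Suc n) a)"
      using rk[OF X[of n]] X[of "Suc n"] by simp
    then show ?case using Suc by simp
  qed simp
  have "rk ((nx ^^ n) a) \<le> Max (rk ` X)" for n
    using X[of n] finite_X by (intro Max_ge) auto
  from order.trans[OF lower this] have "Suc (Max (rk ` X)) \<le> Max (rk ` X)" .
  then show False by simp
qed

lemma next_link_nx: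
  assumes "a \<in> X - P"
  shows "next_link (nx a) = next_link a"
proof -
  obtain n where "(nx ^^ n) a \<in> P" using reaches_link assms by blast
  then have "(LEAST n. (nx ^^ n) a \<in> P) = Suc (LEAST n. (nx ^^ Suc n) a \<in> P)"
    by (rule Least_Suc) (use assms in simp)
  then show ?thesis by (simp add: next_link_def funpow_swap1)
qed

end

context presented
begin

lemma touched:
  assumes "connected Q" "arcs Q \<noteq> {}" "v \<in> V"
  shows "\<exists>a\<in>X - P. tgt a = v \<or> src a = v"
proof (rule ccontr)
  assume no: "\<not> (\<exists>a\<in>X - P. tgt a = v \<or> src a = v)"
  have wf: "wf_digraph Q" using fin_digraph_Q by (simp add: fin_digraph_def)
  let ?f = "\<lambda>u. u = v"
  have off: "tail Q a \<noteq> v" "head Q a \<noteq> v" if "a \<in> arcs Q" for a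
    using no \<iota>_in[OF that] tail_Q[OF that] head_Q[OF that] by auto
  then have const: "\<forall>a\<in>arcs Q. ?f (tail Q a) = ?f (head Q a)" by simp
  have "\<forall>f :: 'v \<Rightarrow> bool. (\<forall>a\<in>arcs Q. f (tail Q a) = f (head Q a)) \<longrightarrow>
      (\<forall>u\<in>verts Q. \<forall>v\<in>verts Q. f u = f v)"
    using assms(1) unfolding connected_iff_constant[OF wf] by (rule conjunct2)
  from spec[OF this, of ?f] const have *: "\<forall>u\<in>verts Q. \<forall>w\<in>verts Q. ?f u = ?f w" by (rule mp)
  obtain a where a: "a \<in> arcs Q" using assms(2) by blast
  have "tail Q a \<in> verts Q" using tail_Q[OF a] src_in[OF \<iota>_X[OF a]] verts_Q by simp
  moreover have "v \<in> verts Q" using assms(3) verts_Q by simp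
  ultimately have "?f (tail Q a) = ?f v" by (rule bspec[OF bspec[OF *]])
  then show False using off[OF a] by simp
qed

end

lemma presented_comparison:
  fixes Q :: "('v, 'a) pre_digraph" and I :: "('v, 'a, 'k::field) path_comb set"
  assumes 1: "presented V X P src1 tgt1 nx1 Q I \<iota>" and 2: "presented V X P src2 tgt2 nx2 Q I \<iota>"
    and "threads_close X P nx1" "threads_close X P nx2" "connected Q" "arcs Q \<noteq> {}"
  shows "thread_comparison V X P src1 tgt1 src2 tgt2 nx1 nx2"
proof -
  interpret S1: presented V X P src1 tgt1 nx1 Q I \<iota> by (rule 1)
  interpret S2: presented V X P src2 tgt2 nx2 Q I \<iota> by (rule 2)
  have src: "src1 a = src2 a" and tgt: "tgt1 a = tgt2 a" if a: "a \<in> X - P" for a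
  proof -
    obtain b where b: "b \<in> arcs Q" "\<iota> b = a" using S1.\<iota>_surj[OF a] .
    show "src1 a = src2 a" using S1.tail_Q[OF b(1)] S2.tail_Q[OF b(1)] b(2) by simp
    show "tgt1 a = tgt2 a" using S1.head_Q[OF b(1)] S2.head_Q[OF b(1)] b(2) by simp
  qed
  have nx: "nx1 a = b \<longleftrightarrow> nx2 a = b" if ab: "a \<in> X - P" "b \<in> X - P" for a b
  proof (cases "tgt1 a = src1 b")
    case True
    obtain a' where a': "a' \<in> arcs Q" "\<iota> a' = a" using S1.\<iota>_surj[OF ab(1)] .
    obtain b' where b': "b' \<in> arcs Q" "\<iota> b' = b" using S1.\<iota>_surj[OF ab(2)] .
    have "composable Q a' b'" using True a' b' by (simp add: S1.composable_Q)
    from S1.path_elem_mem_I[OF this] S2.path_elem_mem_I[OF this] show ?thesis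
      using a' b' by simp
  next
    case False
    then show ?thesis using S1.src_nx[of a] S2.src_nx[of a] src[OF ab(2)] tgt[OF ab(1)] ab by auto
  qed
  show ?thesis
    by (intro thread_comparison.intro thread_comparison_axioms.intro S1.thread_system_axioms
        S2.thread_system_axioms src tgt nx assms(3,4) S1.touched[OF assms(5,6)])
qed

section \<open>The thread system of a blossoming\<close>

text \<open>
  The element \<open>Inr p\<close> is the link \<open>p\<close>. In the blossoming it ends like \<open>\<sigma>\<^sub>p\<close> and starts like \<open>\<tau>\<^sub>p\<close>, which
  are its incoming and its outgoing representative. In the repetition, its copies are the connecting
  arrows.
\<close>

fun arrow_of :: "'a rep_arrow \<Rightarrow> ('a + nat) \<times> nat" where
  "arrow_of (Copy \<alpha> i) = (Inl \<alpha>, i)"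
| "arrow_of (Link p i) = (Inr p, i)"

fun incoming :: "'a + nat \<Rightarrow> 'a bl_arrow" where
  "incoming (Inl \<alpha>) = Old_Arrow \<alpha>"
| "incoming (Inr p) = Sigma p"

fun outgoing :: "'a + nat \<Rightarrow> 'a bl_arrow" where
  "outgoing (Inl \<alpha>) = Old_Arrow \<alpha>"
| "outgoing (Inr p) = Tau p"

locale blossomed =
  fixes Q :: "('v, 'a) pre_digraph" and I :: "('v, 'a, 'k::field) path_comb set"
    and Qb :: "('v bl_vertex, 'a bl_arrow) pre_digraph"
    and Ib :: "('v bl_vertex, 'a bl_arrow, 'k) path_comb set"
  assumes gentle: "gentle Q I" and blossoming: "blossoming Q I Qb Ib"
begin

definition X :: "('a + nat) set" where "X = Inl ` arcs Q \<union> Inr ` {1..blossom_number Q}"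
definition P :: "('a + nat) set" where "P = Inr ` {1..blossom_number Q}"
definition src :: "'a + nat \<Rightarrow> 'v" where "src a = old_vertex (tail Qb (outgoing a))"
definition tgt :: "'a + nat \<Rightarrow> 'v" where "tgt a = old_vertex (head Qb (incoming a))"
definition nx :: "'a + nat \<Rightarrow> 'a + nat" where
  "nx a = (THE b. b \<in> X \<and> src b = tgt a \<and> path_elem Qb [incoming a, outgoing b] \<notin> Ib)"

lemma fin_Q: "fin_digraph Q" and connected_Q: "connected Q" and arcs_nonempty: "arcs Q \<noteq> {}"
  using gentle by (auto simp: gentle_def locally_gentle_def quiver_def)

lemma X_iff [simp]: "Inl \<alpha> \<in> X \<longleftrightarrow> \<alpha> \<in> arcs Q" "Inr p \<in> X \<longleftrightarrow> p \<in> {1..blossom_number Q}"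
  and P_iff [simp]: "Inl \<alpha> \<notin> P" "Inr p \<in> P \<longleftrightarrow> p \<in> {1..blossom_number Q}"
  by (auto simp: X_def P_def)

lemma X_minus_P: "X - P = Inl ` arcs Q"
  by (auto simp: X_def P_def)

lemma blossoming_facts:
  shows arcs_Qb: "arcs Qb = Old_Arrow ` arcs Q \<union> Sigma ` {1..blossom_number Q} \<union> Tau ` {1..blossom_number Q}"
    and old_arrow: "\<And>\<alpha>. \<alpha> \<in> arcs Q \<Longrightarrow> tail Qb (Old_Arrow \<alpha>) = Old_Vertex (tail Q \<alpha>) \<and>
        head Qb (Old_Arrow \<alpha>) = Old_Vertex (head Q \<alpha>)"
    and new_arrow: "\<And>p. p \<in> {1..blossom_number Q} \<Longrightarrow> tail Qb (Sigma p) = Source p \<and>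
        head Qb (Sigma p) \<in> Old_Vertex ` verts Q \<and>
        tail Qb (Tau p) \<in> Old_Vertex ` verts Q \<and> head Qb (Tau p) = Sink p"
    and new_count: "\<And>v. v \<in> verts Q \<Longrightarrow>
        card {p \<in> {1..blossom_number Q}. head Qb (Sigma p) = Old_Vertex v} = 2 - in_degree Q v \<and>
        card {p \<in> {1..blossom_number Q}. tail Qb (Tau p) = Old_Vertex v} = 2 - out_degree Q v"
    and locally_gentle_Qb: "locally_gentle Qb Ib"
    and old_relation: "\<And>\<alpha> \<beta>. composable Q \<alpha> \<beta> \<Longrightarrow>
        path_elem Q [\<alpha>, \<beta>] \<in> I \<longleftrightarrow> path_elem Qb [Old_Arrow \<alpha>, Old_Arrow \<beta>] \<in> Ib"
    and max_path: "\<And>p. p \<in> {1..blossom_number Q} \<Longrightarrow> \<exists>w. maximal_path Qb Ib (Source p) w (Sink p)"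
  using blossoming unfolding blossoming_def Let_def
  by (elim conjE, (assumption | (elim ballE, assumption, blast) | blast))+

lemma fin_Qb: "fin_digraph Qb"
  using locally_gentle_Qb by (auto simp: locally_gentle_def quiver_def)

lemma incoming_in: "a \<in> X \<Longrightarrow> incoming a \<in> arcs Qb"
  and head_incoming: "a \<in> X \<Longrightarrow> head Qb (incoming a) = Old_Vertex (tgt a)"
  and tgt_V: "a \<in> X \<Longrightarrow> tgt a \<in> verts Q"
proof -
  interpret fin_digraph Q by (rule fin_Q)
  assume a: "a \<in> X"
  show "incoming a \<in> arcs Qb" using a by (cases a) (auto simp: arcs_Qb)
  have "\<exists>v\<in>verts Q. head Qb (incoming a) = Old_Vertex v"
    using a new_arrow old_arrow by (cases a) auto
  then show "head Qb (incoming a) = Old_Vertex (tgt a)" "tgt a \<in> verts Q"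
    by (auto simp: tgt_def)
qed

lemma outgoing_in: "a \<in> X \<Longrightarrow> outgoing a \<in> arcs Qb"
  and tail_outgoing: "a \<in> X \<Longrightarrow> tail Qb (outgoing a) = Old_Vertex (src a)"
proof -
  interpret fin_digraph Q by (rule fin_Q)
  assume a: "a \<in> X"
  show "outgoing a \<in> arcs Qb" using a by (cases a) (auto simp: arcs_Qb)
  have "\<exists>v\<in>verts Q. tail Qb (outgoing a) = Old_Vertex v"
    using a new_arrow old_arrow by (cases a) auto
  then show "tail Qb (outgoing a) = Old_Vertex (src a)"
    by (auto simp: src_def)
qed

lemma tgt_Inl: "\<alpha> \<in> arcs Q \<Longrightarrow> tgt (Inl \<alpha>) = head Q \<alpha>"
  and src_Inl: "\<alpha> \<in> arcs Q \<Longrightarrow> src (Inl \<alpha>) = tail Q \<alpha>"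
  using old_arrow by (simp_all add: src_def tgt_def)

lemma composable_Qb:
  "a \<in> X \<Longrightarrow> b \<in> X \<Longrightarrow> composable Qb (incoming a) (outgoing b) \<longleftrightarrow> tgt a = src b"
  by (simp add: composable_def incoming_in outgoing_in head_incoming tail_outgoing)

lemma incoming_eq [simp]: "incoming a = incoming b \<longleftrightarrow> a = b"
  by (cases a; cases b) auto

lemma outgoing_eq [simp]: "outgoing a = outgoing b \<longleftrightarrow> a = b"
  by (cases a; cases b) auto

lemma degree_le: "v \<in> verts Q \<Longrightarrow> in_degree Q v \<le> 2 \<and> out_degree Q v \<le> 2"
  using gentle by (simp add: gentle_def locally_gentle_def)

text \<open>
  The blossoming fills up the in-degree and the out-degree of each old vertex to two.
\<close>

lemma fibre_card:
  assumes v: "v \<in> verts Q"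
  shows "card {a \<in> X. tgt a = v} = 2" "card {a \<in> X. src a = v} = 2"
proof -
  interpret fin_digraph Q by (rule fin_Q)
  let ?P = "{1..blossom_number Q}"
  have split: "card (Inl ` A \<union> Inr ` C :: ('a + nat) set) = card A + card C"
    if "finite A" "finite C" for A :: "'a set" and C :: "nat set"
    using that by (subst card_Un_disjoint) (auto simp: card_image)
  have "{a \<in> X. tgt a = v} = Inl ` in_arcs Q v \<union> Inr ` {p \<in> ?P. head Qb (Sigma p) = Old_Vertex v}"
    using head_incoming[of "Inr _"] by (auto simp: X_def tgt_Inl in_arcs_def)
  then show "card {a \<in> X. tgt a = v} = 2"
    using new_count[OF v] degree_le[OF v] finite_in_arcs
      split[of "in_arcs Q v" "{p \<in> ?P. head Qb (Sigma p) = Old_Vertex v}"]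
    by (simp add: in_degree_def)
  have "{a \<in> X. src a = v} = Inl ` out_arcs Q v \<union> Inr ` {p \<in> ?P. tail Qb (Tau p) = Old_Vertex v}"
    using tail_outgoing[of "Inr _"] by (auto simp: X_def src_Inl out_arcs_def)
  then show "card {a \<in> X. src a = v} = 2"
    using new_count[OF v] degree_le[OF v] finite_out_arcs
      split[of "out_arcs Q v" "{p \<in> ?P. tail Qb (Tau p) = Old_Vertex v}"]
    by (simp add: out_degree_def)
qed

lemma at_most_one_Qb:
  assumes "\<alpha> \<in> arcs Qb"
  shows "composable Qb \<beta> \<alpha> \<Longrightarrow> composable Qb \<gamma> \<alpha> \<Longrightarrow> path_elem Qb [\<beta>, \<alpha>] \<notin> Ib \<Longrightarrow>
      path_elem Qb [\<gamma>, \<alpha>] \<notin> Ib \<Longrightarrow> \<beta> = \<gamma>"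
    and "composable Qb \<alpha> \<beta> \<Longrightarrow> composable Qb \<alpha> \<gamma> \<Longrightarrow> path_elem Qb [\<alpha>, \<beta>] \<in> Ib \<Longrightarrow>
      path_elem Qb [\<alpha>, \<gamma>] \<in> Ib \<Longrightarrow> \<beta> = \<gamma>"
    and "composable Qb \<alpha> \<beta> \<Longrightarrow> composable Qb \<alpha> \<gamma> \<Longrightarrow> path_elem Qb [\<alpha>, \<beta>] \<notin> Ib \<Longrightarrow>
      path_elem Qb [\<alpha>, \<gamma>] \<notin> Ib \<Longrightarrow> \<beta> = \<gamma>"
proof -
  have "(\<exists>\<^sub>\<le>\<^sub>1\<beta>. composable Qb \<beta> \<alpha> \<and> path_elem Qb [\<beta>, \<alpha>] \<notin> Ib) \<and>
      (\<exists>\<^sub>\<le>\<^sub>1\<beta>. composable Qb \<alpha> \<beta> \<and> path_elem Qb [\<alpha>, \<beta>] \<in> Ib) \<and>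
      (\<exists>\<^sub>\<le>\<^sub>1\<beta>. composable Qb \<alpha> \<beta> \<and> path_elem Qb [\<alpha>, \<beta>] \<notin> Ib)"
    using locally_gentle_Qb assms unfolding locally_gentle_def by blast
  then show "composable Qb \<beta> \<alpha> \<Longrightarrow> composable Qb \<gamma> \<alpha> \<Longrightarrow> path_elem Qb [\<beta>, \<alpha>] \<notin> Ib \<Longrightarrow>
      path_elem Qb [\<gamma>, \<alpha>] \<notin> Ib \<Longrightarrow> \<beta> = \<gamma>"
    and "composable Qb \<alpha> \<beta> \<Longrightarrow> composable Qb \<alpha> \<gamma> \<Longrightarrow> path_elem Qb [\<alpha>, \<beta>] \<in> Ib \<Longrightarrow>
      path_elem Qb [\<alpha>, \<gamma>] \<in> Ib \<Longrightarrow> \<beta> = \<gamma>"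
    and "composable Qb \<alpha> \<beta> \<Longrightarrow> composable Qb \<alpha> \<gamma> \<Longrightarrow> path_elem Qb [\<alpha>, \<beta>] \<notin> Ib \<Longrightarrow>
      path_elem Qb [\<alpha>, \<gamma>] \<notin> Ib \<Longrightarrow> \<beta> = \<gamma>"
    unfolding Uniq_def by blast+
qed

lemma follow_unique:
  assumes a: "a \<in> X" and "b \<in> X" "src b = tgt a" "path_elem Qb [incoming a, outgoing b] \<notin> Ib"
    and "c \<in> X" "src c = tgt a" "path_elem Qb [incoming a, outgoing c] \<notin> Ib"
  shows "b = c"
proof -
  have "composable Qb (incoming a) (outgoing b)" "composable Qb (incoming a) (outgoing c)"
    using assms by (simp_all add: composable_Qb)
  then have "outgoing b = outgoing c"
    using assms by (intro at_most_one_Qb(3)[OF incoming_in[OF a]])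
  then show ?thesis by simp
qed

text \<open>
  At most one of the two outgoing arrows at the target of \<open>a\<close> forms a relation with \<open>a\<close>.
\<close>

lemma follow_exists:
  assumes a: "a \<in> X"
  shows "\<exists>b. b \<in> X \<and> src b = tgt a \<and> path_elem Qb [incoming a, outgoing b] \<notin> Ib"
proof -
  obtain b c where bc: "{b \<in> X. src b = tgt a} = {b, c}" "b \<noteq> c"
    using fibre_card(2)[OF tgt_V[OF a]] by (auto simp: card_2_iff)
  have e: "e \<in> X \<and> src e = tgt a" if "e \<in> {b, c}" for e
    using that unfolding bc(1)[symmetric] by simp
  have comp: "composable Qb (incoming a) (outgoing e)" if "e \<in> {b, c}" for e
    using e[OF that] composable_Qb[OF a, of e] by simp
  have "path_elem Qb [incoming a, outgoing b] \<notin> Ib \<or> path_elem Qb [incoming a, outgoing c] \<notin> Ib"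
    using at_most_one_Qb(2)[OF incoming_in[OF a] comp comp, of b c] bc(2) by auto
  then show ?thesis using e[of b] e[of c] by auto
qed

lemma nx: assumes "a \<in> X"
  shows "nx a \<in> X" "src (nx a) = tgt a" "path_elem Qb [incoming a, outgoing (nx a)] \<notin> Ib"
proof -
  obtain b where b: "b \<in> X" "src b = tgt a" "path_elem Qb [incoming a, outgoing b] \<notin> Ib"
    using follow_exists[OF assms] by auto
  have "nx a = b"
    unfolding nx_def using b by (intro the_equality conjI) (auto intro: follow_unique[OF assms])
  then show "nx a \<in> X" "src (nx a) = tgt a" "path_elem Qb [incoming a, outgoing (nx a)] \<notin> Ib"
    using b by simp_all
qed

lemma nx_eq_iff:
  assumes "a \<in> X" "b \<in> X" "tgt a = src b"
  shows "nx a = b \<longleftrightarrow> path_elem Qb [incoming a, outgoing b] \<notin> Ib"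
proof
  assume "nx a = b"
  then show "path_elem Qb [incoming a, outgoing b] \<notin> Ib" using nx(3)[OF assms(1)] by simp
next
  assume "path_elem Qb [incoming a, outgoing b] \<notin> Ib"
  then show "nx a = b" by (intro follow_unique[OF assms(1)] nx[OF assms(1)] assms(2) assms(3)[symmetric])
qed

lemma nx_arrow_iff:
  assumes "composable Q \<alpha> \<beta>"
  shows "nx (Inl \<alpha>) = Inl \<beta> \<longleftrightarrow> path_elem Q [\<alpha>, \<beta>] \<notin> I"
  using assms nx_eq_iff[of "Inl \<alpha>" "Inl \<beta>"] old_relation[OF assms]
  by (simp add: composable_def tgt_Inl src_Inl)

lemma nx_arrow_composable:
  assumes "\<alpha> \<in> arcs Q" "\<beta> \<in> arcs Q" "nx (Inl \<alpha>) = Inl \<beta>"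
  shows "composable Q \<alpha> \<beta>"
  using nx(2)[of "Inl \<alpha>"] assms by (simp add: composable_def tgt_Inl src_Inl)

lemma nx_inj_on: "inj_on nx X"
proof (rule inj_onI)
  fix a b assume ab: "a \<in> X" "b \<in> X" "nx a = nx b"
  have "composable Qb (incoming a) (outgoing (nx a))" "composable Qb (incoming b) (outgoing (nx a))"
    using ab nx(1,2)[OF ab(1)] nx(2)[OF ab(2)] by (simp_all add: composable_Qb)
  then have "incoming a = incoming b"
    using nx(3)[OF ab(1)] nx(3)[OF ab(2)] ab(3)
    by (intro at_most_one_Qb(1)[OF outgoing_in[OF nx(1)[OF ab(1)]]]) simp_all
  then show "a = b" by simp
qed

text \<open>
  Take the maximal length of a path without relations that ends with the given arrow. It exists
  because the quotient is finite-dimensional, and such a path can be prolonged by the next arrow.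
\<close>

lemma ranked: "\<exists>rk :: 'a + nat \<Rightarrow> nat. \<forall>a\<in>X - P. nx a \<in> X - P \<longrightarrow> rk a < rk (nx a)"
proof -
  interpret fin_digraph Q by (rule fin_Q)
  obtain R where R: "R \<subseteq> {(\<alpha>, \<beta>). composable Q \<alpha> \<beta>}" "I = rel_ideal Q R"
    using gentle unfolding gentle_def locally_gentle_def by blast
  let ?G = "{p \<in> paths Q. \<not> has_factor R (snd p)}"
  have fin: "finite ?G"
    using gentle unfolding gentle_def R(2) finite_dim_quotient_iff[OF fin_Q R(1)] by blast
  define L where "L \<alpha> = {length w | u w. (u, w) \<in> ?G \<and> w \<noteq> [] \<and> last w = \<alpha>}" for \<alpha>
  have L_fin: "finite (L \<alpha>)" for \<alpha>
  proof -
    have "L \<alpha> \<subseteq> (length \<circ> snd) ` ?G" by (force simp: L_def)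
    then show ?thesis using fin by (blast intro: finite_subset)
  qed
  define rk where "rk = case_sum (\<lambda>\<alpha>. Max (L \<alpha>)) (\<lambda>_ :: nat. 0)"
  have "rk a < rk (nx a)" if a: "a \<in> X - P" "nx a \<in> X - P" for a
  proof -
    obtain \<alpha> \<beta> where ab: "a = Inl \<alpha>" "\<alpha> \<in> arcs Q" "nx a = Inl \<beta>" "\<beta> \<in> arcs Q"
      using a unfolding X_minus_P by blast
    have comp: "composable Q \<alpha> \<beta>" using nx_arrow_composable ab by metis
    have "path_elem Q [\<alpha>, \<beta>] \<notin> I" using nx_arrow_iff[OF comp] ab by metis
    then have good: "(\<alpha>, \<beta>) \<notin> R"
      unfolding R(2) path_elem_pair_mem_rel_ideal[OF fin_Q R(1) comp] .
    have "(tail Q \<alpha>, [\<alpha>]) \<in> ?G"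
    proof -
      have "awalk (tail Q \<alpha>) [\<alpha>] (head Q \<alpha>)" using ab(2) by (simp add: arc_implies_awalk)
      then have "(tail Q \<alpha>, [\<alpha>]) \<in> paths Q" unfolding paths_def by blast
      then show ?thesis by (simp add: has_factor_Cons)
    qed
    then have "1 \<in> L \<alpha>" unfolding L_def by force
    then have "Max (L \<alpha>) \<in> L \<alpha>" using L_fin by (intro Max_in) auto
    then obtain u w where w: "(u, w) \<in> ?G" "w \<noteq> []" "last w = \<alpha>" "Max (L \<alpha>) = length w"
      unfolding L_def by blast
    obtain v where v: "awalk u w v" using w(1) by (auto simp: paths_def)
    have "w = butlast w @ [\<alpha>]" using w by (metis append_butlast_last_id)
    then have "awalk u (butlast w @ [\<alpha>]) v" using v by simp
    then have "v = head Q \<alpha>" by (auto simp: awalk_simps)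
    then have "awalk v [\<beta>] (head Q \<beta>)"
      using comp by (simp add: composable_def arc_implies_awalk)
    with v have "awalk u (w @ [\<beta>]) (head Q \<beta>)" by (rule awalk_appendI)
    then have "(u, w @ [\<beta>]) \<in> ?G"
    proof -
      assume "awalk u (w @ [\<beta>]) (head Q \<beta>)"
      then have "(u, w @ [\<beta>]) \<in> paths Q" unfolding paths_def by blast
      then show ?thesis using w good by (simp add: has_factor_snoc)
    qed
    then have "Suc (length w) \<in> L \<beta>" unfolding L_def by force
    then have "Suc (length w) \<le> Max (L \<beta>)" using L_fin by (intro Max_ge)
    then show ?thesis unfolding ab(3) using ab(1) w(4) by (simp add: rk_def)
  qed
  then show ?thesis by (intro exI[of _ rk] ballI impI)
qed

lemma thread_system: "thread_system (verts Q) X P src tgt nx"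
proof
  interpret fin_digraph Q by (rule fin_Q)
  show "finite X" "P \<subseteq> X" by (auto simp: X_def P_def)
qed (use tgt_V fibre_card nx nx_inj_on ranked in auto)

lemma presented: "presented (verts Q) X P src tgt nx Q I Inl"
proof (rule presented.intro[OF thread_system presented_axioms.intro])
  obtain R where R: "R \<subseteq> {(\<alpha>, \<beta>). composable Q \<alpha> \<beta>}" "I = rel_ideal Q R"
    using gentle unfolding gentle_def locally_gentle_def by blast
  have "(\<alpha>, \<beta>) \<in> R \<longleftrightarrow> nx (Inl \<alpha>) \<noteq> Inl \<beta>" if comp: "composable Q \<alpha> \<beta>" for \<alpha> \<beta>
    using nx_arrow_iff[OF comp] unfolding R(2) path_elem_pair_mem_rel_ideal[OF fin_Q R(1) comp] by simp
  then have "R = {(\<alpha>, \<beta>). composable Q \<alpha> \<beta> \<and> nx (Inl \<alpha>) \<noteq> Inl \<beta>}"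
    using R(1) by blast
  then show "presents (verts Q) (X - P) src tgt nx Q I Inl"
    unfolding presents_def X_minus_P using R(2)
    by (simp add: tgt_Inl src_Inl inj_on_imp_bij_betw)
qed

lemma arc_Qb_cases:
  assumes "c \<in> arcs Qb"
  obtains (outgoing) b where "b \<in> X" "c = outgoing b"
  | (Sigma) p where "p \<in> {1..blossom_number Q}" "c = Sigma p"
proof -
  from assms consider \<alpha> where "\<alpha> \<in> arcs Q" "c = Old_Arrow \<alpha>"
    | p where "p \<in> {1..blossom_number Q}" "c = Sigma p"
    | p where "p \<in> {1..blossom_number Q}" "c = Tau p"
    unfolding arcs_Qb by blast
  then show ?thesis
  proof cases
    case (1 \<alpha>)
    then show ?thesis using outgoing[of "Inl \<alpha>"] by simp
  next
    case (2 p)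
    then show ?thesis by (rule Sigma)
  next
    case (3 p)
    then show ?thesis using outgoing[of "Inr p"] by simp
  qed
qed

text \<open>
  A maximal path from \<open>s\<^sub>p\<close> contains no relation, so it follows the thread that begins at \<open>\<sigma>\<^sub>p\<close>.
  It ends with the first \<open>\<tau>\<^sub>q\<close> on its way, and \<open>q = p\<close> since it leads to \<open>t\<^sub>p\<close>.
\<close>

lemma threads_close: "threads_close X P nx"
proof -
  interpret S: thread_system "verts Q" X P src tgt nx by (rule thread_system)
  interpret Qb: fin_digraph Qb by (rule fin_Qb)
  obtain R where R: "R \<subseteq> {(\<alpha>, \<beta>). composable Qb \<alpha> \<beta>}" "Ib = rel_ideal Qb R"
    using locally_gentle_Qb unfolding locally_gentle_def by blast
  \<comment> \<open>\<open>w\<close> is the rest of a maximal path that has been followed up to \<open>a\<close>\<close>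
  have follow: "S.next_link (nx a) = Inr p"
    if "a \<in> X" "set w \<subseteq> arcs Qb" "Qb.cas (Old_Vertex (tgt a)) w (Sink p)" "\<not> has_factor R (incoming a # w)"
    for a w p
    using that
  proof (induction w arbitrary: a)
    case Nil
    then show ?case by simp
  next
    case (Cons c w)
    then have c: "c \<in> arcs Qb" "tail Qb c = Old_Vertex (tgt a)" "(incoming a, c) \<notin> R" "\<not> has_factor R (c # w)"
      and w: "set w \<subseteq> arcs Qb" "Qb.cas (head Qb c) w (Sink p)"
      by (simp_all add: has_factor_Cons[of R "incoming a"])
    from c(1) show ?case
    proof (cases rule: arc_Qb_cases)
      case (Sigma q)
      then show ?thesis using c(2) new_arrow[OF Sigma(1)] by simp
    next
      case (outgoing b)
      have src: "src b = tgt a" using c(2) outgoing tail_outgoing by simp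
      have "composable Qb (incoming a) c"
        using composable_Qb[OF Cons.prems(1) outgoing(1)] src outgoing(2) by simp
      then have "path_elem Qb [incoming a, c] \<notin> Ib"
        using c(3) unfolding R(2) by (simp add: path_elem_pair_mem_rel_ideal[OF fin_Qb R(1)])
      then have nx: "nx a = b"
        using nx_eq_iff[OF Cons.prems(1) outgoing(1)] src outgoing(2) by simp
      show ?thesis
      proof (cases b)
        case (Inl \<beta>)
        then have "c = incoming b" "head Qb c = Old_Vertex (tgt b)"
          using outgoing head_incoming[OF outgoing(1)] by simp_all
        then have "S.next_link (nx b) = Inr p"
          using Cons.IH[OF outgoing(1) w(1)] w(2) c(4) by simp
        moreover have "b \<in> X - P" using outgoing(1) Inl by simp
        ultimately show ?thesis using S.next_link_nx nx by simp
      next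
        case (Inr q)
        then have q: "q \<in> {1..blossom_number Q}" "c = Tau q" using outgoing by simp_all
        have cas: "Qb.cas (Sink q) w (Sink p)" using w(2) new_arrow[OF q(1)] q(2) by simp
        have "w = []"
        proof (rule ccontr)
          assume "w \<noteq> []"
          then obtain e w' where e: "w = e # w'" by (cases w) auto
          then have "e \<in> arcs Qb" "tail Qb e = Sink q" using w(1) cas by auto
          then show False
            using tail_outgoing new_arrow by (cases rule: arc_Qb_cases) auto
        qed
        then have "q = p" using cas by simp
        then show ?thesis using S.next_link_link[of b] Inr q(1) nx by simp
      qed
    qed
  qed
  have link: "S.next_link (nx (Inr p)) = Inr p" if p: "p \<in> {1..blossom_number Q}" for p
  proof -
    obtain w where "maximal_path Qb Ib (Source p) w (Sink p)" using max_path[OF p] by blast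
    then have w: "w \<noteq> []" "Qb.awalk (Source p) w (Sink p)" "path_elem Qb w \<notin> Ib"
      by (simp_all add: maximal_path_def)
    then obtain c w' where cw: "w = c # w'" by (cases w) auto
    have c: "c \<in> arcs Qb" "tail Qb c = Source p" "set w' \<subseteq> arcs Qb" "Qb.cas (head Qb c) w' (Sink p)"
      using w(2) unfolding cw Qb.awalk_def by auto
    from c(1) have "c = Sigma p"
    proof (cases rule: arc_Qb_cases)
      case (outgoing b)
      then show ?thesis using c(2) tail_outgoing[OF outgoing(1)] by simp
    next
      case (Sigma q)
      then show ?thesis using c(2) new_arrow[OF Sigma(1)] by simp
    qed
    then have ci: "c = incoming (Inr p)" by simp
    have "Qb.awalk (tail Qb (hd w)) w (Sink p)" using w(2) c(2) cw by simp
    then have "\<not> has_factor R w"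
      using w(3) unfolding R(2) by (simp add: path_elem_mem_rel_ideal[OF fin_Qb R(1)])
    then show ?thesis
      using follow[of "Inr p" w' p] p c(3,4) head_incoming[of "Inr p"] unfolding cw ci by simp
  qed
  have "S.next_link (nx a) = S.next_link a" if "a \<in> X" for a
  proof (cases "a \<in> P")
    case True
    then obtain p where "p \<in> {1..blossom_number Q}" "a = Inr p" by (auto simp: P_def)
    then show ?thesis using link S.next_link_link[OF True] by simp
  next
    case False
    then show ?thesis using S.next_link_nx[of a] that by simp
  qed
  then show ?thesis unfolding threads_close_def
    by (intro exI[of _ S.next_link] conjI ballI) (simp_all add: S.next_link_link)
qed

section \<open>The finite gentle repetition and its reflections\<close>

text \<open>
  The four families of relations of the repetition come from the relations of the blossoming between
  the incoming representative of the first and the outgoing representative of the second element.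
\<close>

lemma repetition_presents:
  assumes k: "k \<ge> 1"
  shows "presents (verts Q \<times> {1..k}) (X \<times> {1..k} - P \<times> {k}) (copy_src (\<lambda>_. src))
    (copy_along k P (\<lambda>_. tgt)) (copy_along k P (\<lambda>_. nx))
    (rep_quiver Q Qb k) (snd (gentle_repetition Q I Qb Ib k)) arrow_of"
proof -
  let ?Q = "rep_quiver Q Qb k" and ?d = "blossom_number Q"
  have arcs: "c \<in> arcs ?Q \<longleftrightarrow> arrow_of c \<in> X \<times> {1..k} - P \<times> {k}" for c
    by (cases c) (auto simp: rep_quiver_def)
  have bij: "bij_betw arrow_of (arcs ?Q) (X \<times> {1..k} - P \<times> {k})"
    unfolding bij_betw_def
  proof (intro conjI equalityI subsetI)
    show "inj_on arrow_of (arcs ?Q)"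
    proof (rule inj_onI)
      fix c e :: "'a rep_arrow" assume "arrow_of c = arrow_of e"
      then show "c = e" by (cases c; cases e) auto
    qed
    show "z \<in> X \<times> {1..k} - P \<times> {k}" if "z \<in> arrow_of ` arcs ?Q" for z
      using that by (elim imageE) (simp only: arcs)
    show "z \<in> arrow_of ` arcs ?Q" if z: "z \<in> X \<times> {1..k} - P \<times> {k}" for z
    proof -
      have "\<exists>c. arrow_of c = z"
      proof (cases z)
        case (Pair a i)
        show ?thesis
        proof (cases a)
          case (Inl \<alpha>)
          then show ?thesis using Pair by (intro exI[of _ "Copy \<alpha> i"]) simp
        next
          case (Inr p)
          then show ?thesis using Pair by (intro exI[of _ "Link p i"]) simp
        qed
      qed
      then obtain c where c: "arrow_of c = z" ..
      then have "c \<in> arcs ?Q" using z by (simp only: arcs)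
      with c show ?thesis by blast
    qed
  qed
  have tail: "tail ?Q c = copy_src (\<lambda>_. src) (arrow_of c)" if "c \<in> arcs ?Q" for c
    using that by (cases c) (auto simp: rep_quiver_def copy_src_def src_def old_arrow)
  have head: "head ?Q c = copy_along k P (\<lambda>_. tgt) (arrow_of c)" if "c \<in> arcs ?Q" for c
    using that by (cases c) (auto simp: rep_quiver_def copy_along_def landing_def tgt_def old_arrow)
  have rel: "(c, e) \<in> rep_relations Q I Qb Ib k \<longleftrightarrow> copy_along k P (\<lambda>_. nx) (arrow_of c) \<noteq> arrow_of e"
    if comp: "composable ?Q c e" for c e
  proof -
    obtain a i where ai: "arrow_of c = (a, i)" by (cases "arrow_of c")
    obtain b j where bj: "arrow_of e = (b, j)" by (cases "arrow_of e")
    have ce: "c \<in> arcs ?Q" "e \<in> arcs ?Q" using comp by (auto simp: composable_def)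
    then have ab: "a \<in> X" "b \<in> X" using arcs ai bj by auto
    have "copy_along k P (\<lambda>_. tgt) (a, i) = copy_src (\<lambda>_. src) (b, j)"
      using comp head[OF ce(1)] tail[OF ce(2)] ai bj by (simp add: composable_def)
    then have t: "tgt a = src b" and j: "landing k P (a, i) = j"
      by (simp_all add: copy_along_def copy_src_def)
    have cb: "composable Qb (incoming a) (outgoing b)" using composable_Qb ab t by blast
    have "(c, e) \<in> rep_relations Q I Qb Ib k \<longleftrightarrow> path_elem Qb [incoming a, outgoing b] \<in> Ib"
    proof (cases c)
      case c: (Copy \<alpha> n)
      then have a: "a = Inl \<alpha>" "n = i" "j = i" using ai j by (auto simp: landing_def)
      show ?thesis
      proof (cases e)
        case (Copy \<beta> n')
        then have b: "b = Inl \<beta>" "n' = i" using bj a by auto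
        have "composable Q \<alpha> \<beta>"
          using ab t a b by (simp add: composable_def tgt_Inl src_Inl)
        then show ?thesis using old_relation[of \<alpha> \<beta>] c Copy a b by (simp add: rep_relations_def)
      next
        case (Link p n')
        then have b: "b = Inr p" "n' = i" using bj a by auto
        then show ?thesis using cb c Link a by (simp add: rep_relations_def)
      qed
    next
      case c: (Link p n)
      then have a: "a = Inr p" "n = i" "j = Suc i"
        using ai j ce(1) by (auto simp: landing_def rep_quiver_def)
      show ?thesis
      proof (cases e)
        case (Copy \<beta> n')
        then have b: "b = Inl \<beta>" "n' = Suc i" using bj a by auto
        then show ?thesis using cb c Copy a by (simp add: rep_relations_def)
      next
        case (Link q n')
        then have b: "b = Inr q" "n' = Suc i" using bj a by auto
        then show ?thesis using cb c Link a by (simp add: rep_relations_def)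
      qed
    qed
    also have "\<dots> \<longleftrightarrow> nx a \<noteq> b" using nx_eq_iff[OF ab t] by simp
    finally show ?thesis using j by (simp add: ai bj copy_along_def)
  qed
  have R: "rep_relations Q I Qb Ib k \<inter> {(c, e). composable ?Q c e} =
    {(c, e). composable ?Q c e \<and> copy_along k P (\<lambda>_. nx) (arrow_of c) \<noteq> arrow_of e}"
    using rel by blast
  have "snd (gentle_repetition Q I Qb Ib k) =
    rel_ideal ?Q {(c, e). composable ?Q c e \<and> copy_along k P (\<lambda>_. nx) (arrow_of c) \<noteq> arrow_of e}"
    unfolding gentle_repetition_def R by simp
  moreover have "verts ?Q = verts Q \<times> {1..k}" by (simp add: rep_quiver_def)
  ultimately show ?thesis
    unfolding presents_def using bij tail head by (intro conjI ballI)
qed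

text \<open>
  Each copy of \<open>Q\<close> is connected, and a link joins each copy to the next one. There is a link, since
  otherwise \<open>Q\<close> would have a cyclic path without relations.
\<close>

lemma repetition_connected:
  assumes k: "k \<ge> 1"
  shows "connected (rep_quiver Q Qb k)" "arcs (rep_quiver Q Qb k) \<noteq> {}"
proof -
  let ?Q = "rep_quiver Q Qb k"
  interpret S: thread_system "verts Q" X P src tgt nx by (rule thread_system)
  have wf: "wf_digraph Q" using fin_Q by (simp add: fin_digraph_def)
  have rep: "presented (verts Q \<times> {1..k}) (X \<times> {1..k}) (P \<times> {k}) (copy_src (\<lambda>_. src))
    (copy_along k P (\<lambda>_. tgt)) (copy_along k P (\<lambda>_. nx))
    ?Q (snd (gentle_repetition Q I Qb Ib k)) arrow_of"
    by (intro presented.intro presented_axioms.intro repetition_presents[OF k]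
        copies_thread_system[OF k] thread_system)
  have wf': "wf_digraph ?Q" using presented.fin_digraph_Q[OF rep] by (simp add: fin_digraph_def)
  obtain \<alpha> where \<alpha>: "\<alpha> \<in> arcs Q" using arcs_nonempty by blast
  have "P \<noteq> {}" by (rule S.P_nonempty) (use \<alpha> in \<open>auto simp: X_minus_P\<close>)
  then obtain p where p: "p \<in> {1..blossom_number Q}" by (auto simp: P_def)
  have "Copy \<alpha> 1 \<in> arcs ?Q" using \<alpha> k by (auto simp: rep_quiver_def)
  then show "arcs ?Q \<noteq> {}" by blast
  have "verts Q \<noteq> {}" using connected_Q unfolding connected_iff_constant[OF wf] by blast
  then have ne: "verts ?Q \<noteq> {}" using k by (auto simp: rep_quiver_def)
  have "f u = f v"
    if f: "\<forall>c\<in>arcs ?Q. f (tail ?Q c) = f (head ?Q c)" and uv: "u \<in> verts ?Q" "v \<in> verts ?Q"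
    for f :: "'v \<times> nat \<Rightarrow> bool" and u v
  proof -
    have copy: "f (a, i) = f (b, i)" if "a \<in> verts Q" "b \<in> verts Q" "i \<in> {1..k}" for a b i
    proof -
      have "f (tail Q \<beta>, i) = f (head Q \<beta>, i)" if "\<beta> \<in> arcs Q" for \<beta>
      proof -
        have "Copy \<beta> i \<in> arcs ?Q" using that \<open>i \<in> {1..k}\<close> by (simp add: rep_quiver_def)
        from bspec[OF f this] show ?thesis by (simp add: rep_quiver_def)
      qed
      then have const: "\<forall>\<beta>\<in>arcs Q. f (tail Q \<beta>, i) = f (head Q \<beta>, i)" ..
      have "\<forall>g :: 'v \<Rightarrow> bool. (\<forall>a\<in>arcs Q. g (tail Q a) = g (head Q a)) \<longrightarrow>
          (\<forall>u\<in>verts Q. \<forall>v\<in>verts Q. g u = g v)"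
        using connected_Q unfolding connected_iff_constant[OF wf] by (rule conjunct2)
      from spec[OF this, of "\<lambda>a. f (a, i)"] const
      have "\<forall>u\<in>verts Q. \<forall>v\<in>verts Q. f (u, i) = f (v, i)" by (rule mp)
      from bspec[OF bspec[OF this that(1)] that(2)] show ?thesis .
    qed
    obtain v0 where v0: "v0 \<in> verts Q" using \<open>verts Q \<noteq> {}\<close> by blast
    have ends: "src (Inr p) \<in> verts Q" "tgt (Inr p) \<in> verts Q"
      using p S.src_in[of "Inr p"] S.tgt_in[of "Inr p"] by simp_all
    have step: "f (v0, Suc i) = f (v0, 1)" if "Suc i \<in> {1..k}" for i
      using that
    proof (induction i)
      case (Suc i)
      have "Link p (Suc i) \<in> arcs ?Q" using Suc.prems p by (simp add: rep_quiver_def)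
      from bspec[OF f this] have "f (src (Inr p), Suc i) = f (tgt (Inr p), Suc (Suc i))"
        by (simp add: rep_quiver_def src_def tgt_def)
      moreover have "f (src (Inr p), Suc i) = f (v0, Suc i)"
        using copy[OF ends(1) v0] Suc.prems by simp
      moreover have "f (tgt (Inr p), Suc (Suc i)) = f (v0, Suc (Suc i))"
        using copy[OF ends(2) v0] Suc.prems by simp
      ultimately show ?case using Suc.IH Suc.prems by simp
    qed simp
    have all: "f z = f (v0, 1)" if zV: "z \<in> verts ?Q" for z
    proof -
      obtain a i where z: "z = (a, i)" "a \<in> verts Q" "i \<in> {1..k}"
        using zV by (cases z) (simp add: rep_quiver_def)
      then obtain i' where "i = Suc i'" by (cases i) auto
      then show ?thesis using copy[OF z(2) v0 z(3)] step[of i'] z by simp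
    qed
    from all[OF uv(1)] all[OF uv(2)] show ?thesis by simp
  qed
  then show "connected ?Q"
    unfolding connected_iff_constant[OF wf'] using ne by (intro conjI allI impI ballI)
qed

text \<open>
  As \<open>x\<close> has in-degree and out-degree two, both elements that end at \<open>x\<close> and both that start at \<open>x\<close> are
  arrows; the mates come from (c3).
\<close>

lemma reflection:
  assumes x: "x \<in> verts Q"
    and c1: "\<not> (\<exists>\<alpha>\<in>arcs Q. tail Q \<alpha> = x \<and> head Q \<alpha> = x)"
    and c2: "in_degree Q x = 2" "out_degree Q x = 2"
    and c3: "\<forall>\<beta>\<in>arcs Q. head Q \<beta> = x \<longrightarrow>
      (\<exists>\<gamma>\<in>arcs Q. head Q \<gamma> = tail Q \<beta> \<and> path_elem Q [\<gamma>, \<beta>] \<in> I)"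
  obtains mate where "thread_reflection (verts Q) X P src tgt nx x mate"
proof -
  interpret S: thread_system "verts Q" X P src tgt nx by (rule thread_system)
  have fill: "Inl ` A = F" if "Inl ` A \<subseteq> F" "card A = 2" "card F = 2" "F \<subseteq> X" for A :: "'a set" and F
    using that by (intro card_subset_eq) (auto simp: card_image intro: finite_subset[OF _ S.finite_X])
  have tx: "Inl ` in_arcs Q x = {a \<in> X. tgt a = x}"
    using c2(1) fibre_card(1)[OF x] by (intro fill) (auto simp: in_arcs_def in_degree_def tgt_Inl)
  have sx: "Inl ` out_arcs Q x = {a \<in> X. src a = x}"
    using c2(2) fibre_card(2)[OF x] by (intro fill) (auto simp: out_arcs_def out_degree_def src_Inl)
  have into: "\<exists>\<beta>. b = Inl \<beta> \<and> \<beta> \<in> arcs Q \<and> head Q \<beta> = x" if "b \<in> X" "tgt b = x" for b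
  proof -
    have "b \<in> Inl ` in_arcs Q x" unfolding tx using that by simp
    then show ?thesis by (auto simp: in_arcs_def)
  qed
  have mate: "\<exists>c. c \<in> X \<and> c \<notin> P \<and> tgt c = src b \<and> nx c \<noteq> b" if b: "b \<in> X" "tgt b = x" for b
  proof -
    obtain \<beta> where \<beta>: "b = Inl \<beta>" "\<beta> \<in> arcs Q" "head Q \<beta> = x" using into[OF b] by blast
    then obtain \<gamma> where \<gamma>: "\<gamma> \<in> arcs Q" "head Q \<gamma> = tail Q \<beta>" "path_elem Q [\<gamma>, \<beta>] \<in> I"
      using c3 by blast
    then have "composable Q \<gamma> \<beta>" using \<beta> by (simp add: composable_def)
    then have "nx (Inl \<gamma>) \<noteq> b" using nx_arrow_iff \<gamma>(3) \<beta>(1) by blast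
    then show ?thesis using \<beta> \<gamma> by (intro exI[of _ "Inl \<gamma>"]) (simp add: tgt_Inl src_Inl)
  qed
  have "thread_reflection (verts Q) X P src tgt nx x
    (\<lambda>b. SOME c. c \<in> X \<and> c \<notin> P \<and> tgt c = src b \<and> nx c \<noteq> b)"
  proof (rule thread_reflection.intro[OF thread_system thread_reflection_axioms.intro[OF x]])
    fix b assume b: "b \<in> X" "tgt b = x"
    obtain \<beta> where \<beta>: "b = Inl \<beta>" "\<beta> \<in> arcs Q" "head Q \<beta> = x" using into[OF b] by blast
    have "nx b \<in> {a \<in> X. src a = x}" using nx(1,2)[OF b(1)] b(2) by simp
    then have "nx b \<in> Inl ` out_arcs Q x" unfolding sx .
    then show "b \<notin> P \<and> nx b \<notin> P \<and> src b \<noteq> x" using \<beta> c1 by (auto simp: src_Inl)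
    show "(SOME c. c \<in> X \<and> c \<notin> P \<and> tgt c = src b \<and> nx c \<noteq> b) \<in> X \<and>
      (SOME c. c \<in> X \<and> c \<notin> P \<and> tgt c = src b \<and> nx c \<noteq> b) \<notin> P \<and>
      tgt (SOME c. c \<in> X \<and> c \<notin> P \<and> tgt c = src b \<and> nx c \<noteq> b) = src b \<and>
      nx (SOME c. c \<in> X \<and> c \<notin> P \<and> tgt c = src b \<and> nx c \<noteq> b) \<noteq> b"
      using someI_ex[OF mate[OF b]] .
  qed
  then show ?thesis by (rule that)
qed

end

theorem corollary5p12:
  fixes Q Q' :: "('v, 'a) pre_digraph"
    and I I' :: "('v, 'a, 'k::alg_closed_field) path_comb set"
    and Qb Qb' :: "('v bl_vertex, 'a bl_arrow) pre_digraph"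
    and Ib Ib' :: "('v bl_vertex, 'a bl_arrow, 'k) path_comb set"
    and x :: 'v and k :: nat
  assumes "gentle Q I"
    and "x \<in> verts Q"
    and c1: "\<not> (\<exists>\<alpha>\<in>arcs Q. tail Q \<alpha> = x \<and> head Q \<alpha> = x)"
    and c2: "in_degree Q x = 2" "out_degree Q x = 2"
    and c3: "\<forall>\<beta>\<in>arcs Q. head Q \<beta> = x \<longrightarrow>
      (\<exists>\<gamma>\<in>arcs Q. head Q \<gamma> = tail Q \<beta> \<and> path_elem Q [\<gamma>, \<beta>] \<in> I)"
    and "(Q', I') = apr_reflection Q I x"
    and "blossoming Q I Qb Ib"
    and "blossoming Q' I' Qb' Ib'"
    and "k \<ge> 1"
  shows "\<exists>B. (apr_step ^^ k) (gentle_repetition Q I Qb Ib k) B \<and>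
    bound_quiver_iso B (gentle_repetition Q' I' Qb' Ib' k)"
proof -
  interpret B: blossomed Q I Qb Ib
    by (rule blossomed.intro) fact+
  obtain mate where refl: "thread_reflection (verts Q) B.X B.P B.src B.tgt B.nx x mate"
    using B.reflection[OF assms(2) c1 c2 c3] .
  interpret R: thread_reflection "verts Q" B.X B.P B.src B.tgt B.nx x mate by (rule refl)
  have PR: "presented_reflection (verts Q) B.X B.P B.src B.tgt B.nx x mate Q I Inl"
    by (rule presented_reflection.intro[OF refl B.presented])
  have Q': "Q' = apr_quiver Q I x" and I': "I' = rel_ideal Q' (apr_relations Q I x)"
    using assms(7) by (simp_all add: apr_reflection_def)
  have pres': "presented (verts Q) B.X B.P R.src' R.tgt' R.nx' Q' I' Inl"
    using presented_reflection.reflected_presented[OF PR] unfolding I' Q' .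
  have conn': "connected Q'"
    using presented_reflection.reflected_connected[OF PR B.connected_Q] unfolding Q' .
  have Q'_sel: "verts Q' = verts Q" "arcs Q' = arcs Q"
    by (simp_all add: Q' apr_quiver_def)
  have ne': "arcs Q' \<noteq> {}" using B.arcs_nonempty Q'_sel by simp
  have "gentle Q' I'" by (rule presented.gentle_Q[OF pres' conn' ne'])
  then interpret B': blossomed Q' I' Qb' Ib'
    using assms(9) by (rule blossomed.intro)
  have num: "blossom_number Q' = blossom_number Q" by (simp add: blossom_number_def Q'_sel)
  have X': "B'.X = B.X" and P': "B'.P = B.P"
    by (simp_all add: B'.X_def B.X_def B'.P_def B.P_def num Q'_sel)
  have pres2: "presented (verts Q) B.X B.P B'.src B'.tgt B'.nx Q' I' Inl"
    using B'.presented unfolding X' P' Q'_sel .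
  have close': "threads_close B.X B.P R.nx'"
    by (rule R.reflected_threads_close[OF B.threads_close])
  have close2: "threads_close B.X B.P B'.nx"
    using B'.threads_close unfolding X' P' .
  interpret C: thread_comparison "verts Q" B.X B.P R.src' R.tgt' B'.src B'.tgt R.nx' B'.nx
    by (rule presented_comparison[OF pres' pres2 close' close2 conn' ne'])
  let ?G = "gentle_repetition Q I Qb Ib k" and ?G' = "gentle_repetition Q' I' Qb' Ib' k"
  have G: "?G = (rep_quiver Q Qb k, snd ?G)" "?G' = (rep_quiver Q' Qb' k, snd ?G')"
    by (simp_all add: gentle_repetition_def)
  obtain Qk Ik where steps: "(apr_step ^^ k) (rep_quiver Q Qb k, snd ?G) (Qk, Ik)"
    and presk: "presents (verts Q \<times> {1..k}) (B.X \<times> {1..k} - B.P \<times> {k}) (copy_src (\<lambda>_. R.src'))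
      (copy_along k B.P (\<lambda>_. R.tgt')) (copy_along k B.P (\<lambda>_. R.nx')) Qk Ik arrow_of"
    using R.all_steps[OF assms(10) B.repetition_presents[OF assms(10)] B.repetition_connected[OF assms(10)]] .
  have presk': "presents (verts Q \<times> {1..k}) (B.X \<times> {1..k} - B.P \<times> {k}) (copy_src (\<lambda>_. B'.src))
      (copy_along k B.P (\<lambda>_. B'.tgt)) (copy_along k B.P (\<lambda>_. B'.nx)) (rep_quiver Q' Qb' k) (snd ?G') arrow_of"
    using B'.repetition_presents[OF assms(10)] unfolding X' P' Q'_sel .
  have "bound_quiver_iso (Qk, Ik) (rep_quiver Q' Qb' k, snd ?G')"
    by (rule copies_iso[OF assms(10) C.S1.thread_system_axioms C.S2.thread_system_axioms
        C.relabel_bij C.relabel_P C.relabel_src C.relabel_tgt C.relabel_nx presk presk'])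
  with steps show ?thesis unfolding G(1)[symmetric] G(2)[symmetric] by blast
qed

end
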